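(* In the setting and notation of the context, assume the classic scaling $n=\alpha/\epsilon^d$ for a fixed $\alpha\in(0,1)$. Conditioned on the event $\lVert\boldsymbol\rho^{(n)}(0)\rVert_{\mathrm{TV}}=\lVert\rho_0\rVert_{L^1(\mathbb{T}^d)}$, for every $\phi\in C^\infty(\mathbb{T}^d\times\{1,\dots,d\}\times\{+,-\})$ the real-valued process $t\mapsto\langle\phi,C^{(n)}(t)\rangle$ is exponentially tight in $D(0,T)$ with speed $$\frac{\epsilon^dn^2}{\epsilon^2}=\frac{\alpha^2}{\epsilon^{d+2}}=\alpha^{1-2/d}n^{1+2/d}.$$
   Context: Fix $d\in\mathbb{N}$ and $T>0$. Let $\mathbb{T}^d=\mathbb{R}^d/\mathbb{Z}^d$. For each $n\in\mathbb{N}$ let $\epsilon=\epsilon_n\to0$ with $1/\epsilon\in\mathbb{N}$, and $\mathbb{T}_\epsilon^d=(\epsilon\mathbb{Z}/\mathbb{Z})^d$; $\mathds 1_l$ is the $l$-th unit vector; $x\sim y$ means $y=x\pm\epsilon\mathds1_l$ for some $l$ and sign. Dynamics: $(\eta(t),\widetilde W(t),\widetilde C(t))$ is the continuous-time Markov process with $\eta(t)\in\{0,1\}^{\mathbb{T}_\epsilon^d}$, $\widetilde W(t),\widetilde C(t)\in\mathbb{N}_0^{\mathbb{T}_\epsilon^d\times\mathbb{T}_\epsilon^d}$ such that for each ordered pair $(x,y)$ with $x\sim y$: at rate $\epsilon^{-2}\eta(x)(1-\eta(y))$ the particle at $x$ jumps to $y$ and $\widetilde W_{xy}$ increases by $1$;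 at rate $\epsilon^{-2}\eta(x)\eta(y)$, $\widetilde C_{xy}$ increases by $1$ ($\eta$ unchanged). Initial condition: $\rho_0\in C(\mathbb{T}^d)$ nonnegative; $\eta(x,0)$ independent Bernoulli with parameter $n\int_{B_\epsilon(x)}\rho_0\le1$, $B_\epsilon(x)=\prod_i[x_i-\epsilon/2,x_i+\epsilon/2]$; $\widetilde W(0)=\widetilde C(0)=0$. Empirical measure: $\boldsymbol\rho^{(n)}(t)=\frac1n\sum_{x}\eta(x,t)\delta_x$; $\lVert\cdot\rVert_{\mathrm{TV}}$ is total variation. Unidirectional collision number: $C^{(n)}_{l,\pm}(t)=\frac{\epsilon^2}{\epsilon^dn^2}\sum_{x}\widetilde C_{x,x\pm\epsilon\mathds1_l}(t)\,\delta_{x\pm\frac\epsilon2\mathds1_l}$, with $\langle\phi,C^{(n)}(t)\rangle=\sum_l\sum_\pm\int\phi_{l,\pm}\,dC^{(n)}_{l,\pm}(t)$. $D(0,T)$ is the space of real càdlàg paths with the Skorohod $J_1$ topology. A sequence $X^n$ is exponentially tight with speed $\beta_n\to\infty$ if for every $a>0$ there is a compact $K\subset D(0,T)$ with $\limsup_n\beta_n^{-1}\log\mathbb P(X^n\notin K)\le -a$. *)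

theory Defs
  imports "HOL-Probability.Probability"
begin

section \<open>Discrete torus (\<epsilon> = 1/N), sites are maps 'd \<Rightarrow> nat with values < N\<close>

definition sites :: "nat \<Rightarrow> ('d::finite \<Rightarrow> nat) set" where
  "sites N = {x. \<forall>i. x i < N}"

definition shift :: "nat \<Rightarrow> ('d::finite \<Rightarrow> nat) \<Rightarrow> 'd \<Rightarrow> bool \<Rightarrow> ('d \<Rightarrow> nat)" where
  "shift N x l s = x(l := (if s then (x l + 1) mod N else (x l + N - 1) mod N))"

definition edges :: "nat \<Rightarrow> (('d::finite \<Rightarrow> nat) \<times> ('d \<Rightarrow> nat)) set" where
  "edges N = {(x, shift N x l s) | x l s. x \<in> sites N}"

definition pt :: "nat \<Rightarrow> ('d::finite \<Rightarrow> nat) \<Rightarrow> real^'d" where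
  "pt N x = (\<chi> i. real (x i) / real N)"

definition bern_param :: "nat \<Rightarrow> real \<Rightarrow> (real^'d \<Rightarrow> real) \<Rightarrow> ('d::finite \<Rightarrow> nat) \<Rightarrow> real" where
  "bern_param N n rho0 x =
     n * integral (cbox (pt N x - (\<chi> i. 1 / (2 * real N))) (pt N x + (\<chi> i. 1 / (2 * real N)))) rho0"

section \<open>Probability space for the graphical (Harris) construction\<close>

text \<open>Init x: uniform variable deciding eta(x,0); Clock x y j: j-th exponential
  inter-arrival time (rate eps^-2 = N^2) of the Poisson clock of the ordered pair (x,y).\<close>
datatype 'd rv_idx = Init "'d \<Rightarrow> nat" | Clock "'d \<Rightarrow> nat" "'d \<Rightarrow> nat" nat

definition omega_comp :: "nat \<Rightarrow> 'd rv_idx \<Rightarrow> real measure" where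
  "omega_comp N i = (case i of
      Init _ \<Rightarrow> uniform_measure lborel {0..1}
    | Clock _ _ _ \<Rightarrow> density lborel (exponential_density (real N ^ 2)))"

definition prob_N :: "nat \<Rightarrow> ('d rv_idx \<Rightarrow> real) measure" where
  "prob_N N = PiM UNIV (omega_comp N)"

record 'd lstate =
  occ  :: "('d \<Rightarrow> nat) \<Rightarrow> bool"
  Wc   :: "('d \<Rightarrow> nat) \<Rightarrow> ('d \<Rightarrow> nat) \<Rightarrow> nat"
  Cc   :: "('d \<Rightarrow> nat) \<Rightarrow> ('d \<Rightarrow> nat) \<Rightarrow> nat"
  used :: "('d \<Rightarrow> nat) \<Rightarrow> ('d \<Rightarrow> nat) \<Rightarrow> nat"
  clock :: real

text \<open>time of the j-th ring (0-based) of the clock of (x,y)\<close>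
definition arrival :: "('d rv_idx \<Rightarrow> real) \<Rightarrow> ('d \<Rightarrow> nat) \<Rightarrow> ('d \<Rightarrow> nat) \<Rightarrow> nat \<Rightarrow> real" where
  "arrival \<omega> x y j = (\<Sum>i\<le>j. \<omega> (Clock x y i))"

definition init_state :: "nat \<Rightarrow> real \<Rightarrow> (real^'d \<Rightarrow> real) \<Rightarrow> ('d::finite rv_idx \<Rightarrow> real) \<Rightarrow> 'd lstate" where
  "init_state N n rho0 \<omega> =
     \<lparr> occ = (\<lambda>x. x \<in> sites N \<and> \<omega> (Init x) < bern_param N n rho0 x),
       Wc = (\<lambda>_ _. 0), Cc = (\<lambda>_ _. 0), used = (\<lambda>_ _. 0), clock = 0 \<rparr>"

definition next_edge :: "nat \<Rightarrow> ('d::finite rv_idx \<Rightarrow> real) \<Rightarrow> 'd lstate \<Rightarrow> ('d \<Rightarrow> nat) \<times> ('d \<Rightarrow> nat)" where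
  "next_edge N \<omega> s = (SOME e. e \<in> edges N \<and>
      (\<forall>e'\<in>edges N. arrival \<omega> (fst e) (snd e) (used s (fst e) (snd e))
                      \<le> arrival \<omega> (fst e') (snd e') (used s (fst e') (snd e'))))"

definition step :: "nat \<Rightarrow> ('d::finite rv_idx \<Rightarrow> real) \<Rightarrow> 'd lstate \<Rightarrow> 'd lstate" where
  "step N \<omega> s = (case next_edge N \<omega> s of (x, y) \<Rightarrow>
     (let \<tau> = arrival \<omega> x y (used s x y);
          s' = s\<lparr> used := (used s)(x := (used s x)(y := used s x y + 1)), clock := \<tau> \<rparr>
      in if occ s x \<and> \<not> occ s y then
           s'\<lparr> occ := (occ s)(x := False, y := True),
               Wc := (Wc s)(x := (Wc s x)(y := Wc s x y + 1)) \<rparr>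
         else if occ s x \<and> occ s y then
           s'\<lparr> Cc := (Cc s)(x := (Cc s x)(y := Cc s x y + 1)) \<rparr>
         else s'))"

definition traj :: "nat \<Rightarrow> real \<Rightarrow> (real^'d \<Rightarrow> real) \<Rightarrow> ('d::finite rv_idx \<Rightarrow> real) \<Rightarrow> nat \<Rightarrow> 'd lstate" where
  "traj N n rho0 \<omega> m = (step N \<omega> ^^ m) (init_state N n rho0 \<omega>)"

definition state_at :: "nat \<Rightarrow> real \<Rightarrow> (real^'d \<Rightarrow> real) \<Rightarrow> ('d::finite rv_idx \<Rightarrow> real) \<Rightarrow> real \<Rightarrow> 'd lstate" where
  "state_at N n rho0 \<omega> t = traj N n rho0 \<omega> (GREATEST m. clock (traj N n rho0 \<omega> m) \<le> t)"

definition coll_pair :: "nat \<Rightarrow> real \<Rightarrow> ('d::finite \<Rightarrow> bool \<Rightarrow> real^'d \<Rightarrow> real) \<Rightarrow> 'd lstate \<Rightarrow> real" where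
  "coll_pair N n \<phi> s =
     ((1 / real N)^2 / ((1 / real N)^CARD('d) * n^2)) *
     (\<Sum>x\<in>sites N. \<Sum>l\<in>UNIV. \<Sum>b\<in>UNIV.
        real (Cc s x (shift N x l b)) *
        \<phi> l b (pt N x + (if b then 1 / (2 * real N) else - 1 / (2 * real N)) *\<^sub>R axis l 1))"

definition coll_path :: "real \<Rightarrow> nat \<Rightarrow> real \<Rightarrow> (real^'d \<Rightarrow> real) \<Rightarrow> ('d::finite \<Rightarrow> bool \<Rightarrow> real^'d \<Rightarrow> real)
                         \<Rightarrow> ('d rv_idx \<Rightarrow> real) \<Rightarrow> real \<Rightarrow> real" where
  "coll_path T N n rho0 \<phi> \<omega> = (\<lambda>t. coll_pair N n \<phi> (state_at N n rho0 \<omega> (max 0 (min t T))))"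

definition mass_event :: "nat \<Rightarrow> real \<Rightarrow> (real^'d \<Rightarrow> real) \<Rightarrow> ('d::finite rv_idx \<Rightarrow> real) set" where
  "mass_event N n rho0 = {\<omega>. real (card {x \<in> sites N. occ (init_state N n rho0 \<omega>) x}) / n
                               = integral (cbox 0 (\<chi> i. 1)) (\<lambda>z. \<bar>rho0 z\<bar>)}"

definition cadlag_space :: "real \<Rightarrow> (real \<Rightarrow> real) set" where
  "cadlag_space T = {f.
     (\<forall>t\<in>{0..<T}. (f \<longlongrightarrow> f t) (at_right t)) \<and>
     (\<forall>t\<in>{0<..T}. \<exists>L. (f \<longlongrightarrow> L) (at_left t)) \<and>
     (\<forall>t<0. f t = f 0) \<and> (\<forall>t>T. f t = f T)}"

definition time_changes :: "real \<Rightarrow> (real \<Rightarrow> real) set" where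
  "time_changes T = {r. strict_mono_on {0..T} r \<and> continuous_on {0..T} r \<and> r 0 = 0 \<and> r T = T}"

definition skorohod_dist :: "real \<Rightarrow> (real \<Rightarrow> real) \<Rightarrow> (real \<Rightarrow> real) \<Rightarrow> real" where
  "skorohod_dist T f g = (INF r\<in>time_changes T.
      max (SUP t\<in>{0..T}. \<bar>r t - t\<bar>) (SUP t\<in>{0..T}. \<bar>f t - g (r t)\<bar>))"

definition skorohod_top :: "real \<Rightarrow> (real \<Rightarrow> real) topology" where
  "skorohod_top T = Metric_space.mtopology (cadlag_space T) (skorohod_dist T)"

coinductive smooth_fun :: "('a::real_normed_vector \<Rightarrow> real) \<Rightarrow> bool" where
  "(\<forall>x. f differentiable (at x)) \<Longrightarrow> (\<forall>v. smooth_fun (\<lambda>x. frechet_derivative f (at x) v))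
     \<Longrightarrow> smooth_fun f"

definition outer_prob :: "'a measure \<Rightarrow> 'a set \<Rightarrow> real" where
  "outer_prob M A = (INF B\<in>{B \<in> sets M. A \<inter> space M \<subseteq> B}. measure M B)"

definition cond_outer_prob :: "'a measure \<Rightarrow> 'a set \<Rightarrow> 'a set \<Rightarrow> real" where
  "cond_outer_prob M B A = outer_prob M (A \<inter> B) / measure M B"

definition ln_ereal :: "real \<Rightarrow> ereal" where
  "ln_ereal p = (if p \<le> 0 then -\<infinity> else ereal (ln p))"

definition exp_tight_cond ::
  "real \<Rightarrow> (nat \<Rightarrow> real) \<Rightarrow> (nat \<Rightarrow> 'a measure) \<Rightarrow> (nat \<Rightarrow> 'a set) \<Rightarrow> (nat \<Rightarrow> 'a \<Rightarrow> real \<Rightarrow> real) \<Rightarrow> bool" where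
  "exp_tight_cond T \<beta> M B X \<longleftrightarrow>
     (\<forall>a>0. \<exists>K. K \<subseteq> cadlag_space T \<and> compactin (skorohod_top T) K \<and>
        limsup (\<lambda>k. ereal (1 / \<beta> k) *
            ln_ereal (cond_outer_prob (M k) (B k) {\<omega> \<in> space (M k). X k \<omega> \<notin> K})) \<le> ereal (- a))"

end

theory Submission
  imports Defs "HOL-Complex_Analysis.Great_Picard"
begin

text \<open>
  Every clock rings at rate \<open>N\<^sup>2\<close>, so the number of rings in a time window of length \<open>h\<close> has exponential
  moments of order \<open>ln (1/h)\<close> bounded by \<open>exp (C \<beta>)\<close>, where \<open>\<beta>\<close> is the speed, and a jump of the path has
  size \<open>O(1/\<beta>)\<close>. Chernoff's bound on all dyadic scales up to \<open>2 ^ (-\<beta>)\<close> shows that, up to probability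
  \<open>exp (-a \<beta>)\<close>, the path has modulus of continuity \<open>A / ln (1/h)\<close> with an additive error \<open>O(1/\<beta>)\<close>. With the
  same probability its jumps are \<open>\<delta>\<close>-separated for a very small \<open>\<delta>\<close> depending on \<open>N\<close>. The set of all
  such paths is compact: \<open>\<delta>\<close>-separated step functions form a compact set for each \<open>N\<close>, and a
  sequence with \<open>N\<close> tending to infinity has a uniformly convergent subsequence by an asymptotic
  Arzela-Ascoli argument. Conditioning costs only a factor \<open>exp (o(\<beta>))\<close>: if the prescribed number \<open>m\<close> of
  particles is an integer, it is the mean of the initial particle number, and one can choose \<open>m\<close> sites
  avoiding all those of Bernoulli parameter below \<open>1/N^d\<close> and containing all those of parameter above
  \<open>1 - 1/N^d\<close>, so that the event has probability at least \<open>(1/N^d) ^ (N^d)\<close>.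
\<close>

section \<open>The Skorohod metric\<close>

text \<open>The logarithmic modulus comes from one computation: \<open>\<gamma> / i\<close> or more
  rings in a given window of length \<open>(1/2)^i\<close> cost \<open>2 powr (- \<gamma>)\<close>,
  up to a factor exponential in the speed, and this price does not depend on \<open>i\<close>. A
  \<gamma> proportional to the speed therefore treats all dyadic scales alike. The scales must stop
  while the number of windows is still exponential in the speed, which leaves the additive error.
  Below the last scale single jumps are visible, and for fixed \<open>N\<close> a modulus with an
  error does not prevent jumps from merging in a limit; this is why separation is imposed as well,
  with its own \<delta> for every index.

  All rings are counted, whether or not they cause a collision. The bounds then hold for every
  initial configuration, and conditioning amounts to dividing by the probability of the event. The
  exceptional events are defined through products of weights of bounded expectation and are
  measurable, so the outer probability is bounded without any measurability of the path.\<close>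

lemma time_change_maps:
  assumes "0 \<le> T" "r \<in> time_changes T" "t \<in> {0..T}"
  shows "r t \<in> {0..T}"
proof -
  have m: "strict_mono_on {0..T} r" and e: "r 0 = 0" "r T = T"
    using assms by (auto simp: time_changes_def)
  have "r 0 \<le> r t" "r t \<le> r T"
    using strict_mono_on_leD[OF m, of 0 t] strict_mono_on_leD[OF m, of t T] assms by auto
  with e show ?thesis by auto
qed

lemma time_change_image:
  assumes "0 \<le> T" "r \<in> time_changes T"
  shows "r ` {0..T} = {0..T}"
proof
  show "r ` {0..T} \<subseteq> {0..T}" using time_change_maps[OF assms] by auto
  show "{0..T} \<subseteq> r ` {0..T}"
  proof
    fix y assume "y \<in> {0..T}"
    moreover have "continuous_on {0..T} r" "r 0 = 0" "r T = T"
      using assms by (auto simp: time_changes_def)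
    ultimately have "\<exists>x\<ge>0. x \<le> T \<and> r x = y"
      using IVT'[of r 0 y T] assms(1) by auto
    then show "y \<in> r ` {0..T}" by auto
  qed
qed

lemma time_change_inj:
  assumes "r \<in> time_changes T" shows "inj_on r {0..T}"
  using assms by (auto simp: time_changes_def intro: strict_mono_on_imp_inj_on)

lemma id_time_change: "id \<in> time_changes T"
  by (auto simp: time_changes_def strict_mono_on_def)

lemma time_changes_nonempty: "time_changes T \<noteq> {}"
  using id_time_change by blast

lemma comp_time_change:
  assumes "0 \<le> T" "r \<in> time_changes T" "r' \<in> time_changes T"
  shows "r' \<circ> r \<in> time_changes T"
proof -
  note im = time_change_image[OF assms(1,2)]
  have "strict_mono_on {0..T} (r' \<circ> r)"
    using assms time_change_maps[OF assms(1,2)]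
    unfolding time_changes_def strict_mono_on_def by auto
  moreover have "continuous_on {0..T} (r' \<circ> r)"
    using assms im by (intro continuous_on_compose) (auto simp: time_changes_def)
  ultimately show ?thesis using assms by (auto simp: time_changes_def)
qed

lemma inverse_time_change:
  assumes "0 \<le> T" "r \<in> time_changes T"
  obtains q where "q \<in> time_changes T" "\<And>t. t \<in> {0..T} \<Longrightarrow> q (r t) = t"
    "\<And>t. t \<in> {0..T} \<Longrightarrow> r (q t) = t"
proof -
  define q where "q = inv_into {0..T} r"
  note inj = time_change_inj[OF assms(2)] and im = time_change_image[OF assms]
  have qr: "q (r t) = t" if "t \<in> {0..T}" for t
    using inj that by (simp add: q_def)
  have rq: "r (q t) = t" if "t \<in> {0..T}" for t
    using that im by (simp add: q_def f_inv_into_f)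
  have qm: "q t \<in> {0..T}" if "t \<in> {0..T}" for t
    using that im unfolding q_def by (metis inv_into_into)
  have m: "strict_mono_on {0..T} r" and cont: "continuous_on {0..T} r" and e: "r 0 = 0" "r T = T"
    using assms by (auto simp: time_changes_def)
  have "strict_mono_on {0..T} q"
  proof (rule strict_mono_onI)
    fix s t assume st: "s \<in> {0..T}" "t \<in> {0..T}" "s < t"
    show "q s < q t"
    proof (rule ccontr)
      assume "\<not> q s < q t"
      then have "r (q t) \<le> r (q s)"
        using strict_mono_on_leD[OF m qm[OF st(2)] qm[OF st(1)]] by simp
      with st rq show False by simp
    qed
  qed
  moreover have "continuous_on {0..T} q"
    using continuous_on_inv[OF cont, of q] qr im by auto
  moreover have "q 0 = 0" "q T = T" using qr[of 0] qr[of T] e assms(1) by auto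
  ultimately have "q \<in> time_changes T" by (simp add: time_changes_def)
  then show ?thesis using that qr rq by blast
qed

text \<open>The distance is built from real-valued suprema, which bound their terms only for bounded
  families; boundedness of the paths supplies this. One-sided limits bound the path near each time,
  and compactness of the interval makes finitely many neighbourhoods enough.\<close>

lemma cadlag_bounded:
  assumes "f \<in> cadlag_space T" "0 \<le> T"
  obtains B where "\<And>t. t \<in> {0..T} \<Longrightarrow> \<bar>f t\<bar> \<le> B"
proof -
  have loc: "\<exists>e>0. \<exists>B. \<forall>s\<in>{0..T}. \<bar>s - t\<bar> < e \<longrightarrow> \<bar>f s\<bar> \<le> B" if t: "t \<in> {0..T}" for t
  proof -
    have R: "\<exists>e>0. \<forall>s\<in>{0..T}. t < s \<and> s - t < e \<longrightarrow> \<bar>f s\<bar> \<le> \<bar>f t\<bar> + 1"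
    proof (cases "t < T")
      case True
      then have "(f \<longlongrightarrow> f t) (at_right t)" using assms t by (auto simp: cadlag_space_def)
      then have "\<forall>\<^sub>F s in at_right t. dist (f s) (f t) < 1" by (rule tendstoD) simp
      then obtain b where "b > t" "\<And>s. t < s \<Longrightarrow> s < b \<Longrightarrow> dist (f s) (f t) < 1"
        unfolding eventually_at_right_field by blast
      then show ?thesis
        by (intro exI[of _ "b - t"]) (force simp: dist_real_def)
    next
      case False
      then show ?thesis using t by (intro exI[of _ 1]) auto
    qed
    have L: "\<exists>e>0. \<exists>B. \<forall>s\<in>{0..T}. s < t \<and> t - s < e \<longrightarrow> \<bar>f s\<bar> \<le> B"
    proof (cases "0 < t")
      case True
      then have "\<exists>L. (f \<longlongrightarrow> L) (at_left t)" using assms t by (simp add: cadlag_space_def)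
      then obtain L where "(f \<longlongrightarrow> L) (at_left t)" by blast
      then have "\<forall>\<^sub>F s in at_left t. dist (f s) L < 1" by (rule tendstoD) simp
      then obtain b where "b < t" "\<And>s. b < s \<Longrightarrow> s < t \<Longrightarrow> dist (f s) L < 1"
        unfolding eventually_at_left_field by blast
      then show ?thesis
        by (intro exI[of _ "t - b"] conjI exI[of _ "\<bar>L\<bar> + 1"]) (force simp: dist_real_def)+
    next
      case False
      then show ?thesis using t by (intro exI[of _ 1]) auto
    qed
    from R obtain e1 where e1: "e1 > 0" "\<forall>s\<in>{0..T}. t < s \<and> s - t < e1 \<longrightarrow> \<bar>f s\<bar> \<le> \<bar>f t\<bar> + 1"
      by blast
    from L obtain e2 B where e2: "e2 > 0" "\<forall>s\<in>{0..T}. s < t \<and> t - s < e2 \<longrightarrow> \<bar>f s\<bar> \<le> B"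
      by blast
    have "\<bar>f s\<bar> \<le> max (\<bar>f t\<bar> + 1) B" if "s \<in> {0..T}" "\<bar>s - t\<bar> < min e1 e2" for s
      using e1(2) e2(2) that by (cases s t rule: linorder_cases) (force simp: le_max_iff_disj)+
    with e1(1) e2(1) show ?thesis 
      by (intro exI[of _ "min e1 e2"] conjI exI[of _ "max (\<bar>f t\<bar> + 1) B"]) auto
  qed
  have "compact {0..T}" by simp
  from loc obtain e B where eB: "\<And>t. t \<in> {0..T} \<Longrightarrow> e t > 0"
    "\<And>t s. t \<in> {0..T} \<Longrightarrow> s \<in> {0..T} \<Longrightarrow> \<bar>s - t\<bar> < e t \<Longrightarrow> \<bar>f s\<bar> \<le> B t" by metis
  obtain C where C: "C \<subseteq> {0..T}" "finite C" "{0..T} \<subseteq> (\<Union>c\<in>C. ball c (e c))"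
    by (rule compactE_image[of "{0..T}" "{0..T}" "\<lambda>c. ball c (e c)"]) (use eB in auto)
  have "\<bar>f t\<bar> \<le> (\<Sum>c\<in>C. \<bar>B c\<bar>)" if t: "t \<in> {0..T}" for t
  proof -
    obtain c where c: "c \<in> C" "t \<in> ball c (e c)" using C t by blast
    then have "\<bar>f t\<bar> \<le> B c" using eB(2)[of c t] C t by (auto simp: dist_real_def)
    also have "\<dots> \<le> \<bar>B c\<bar>" by simp
    also have "\<dots> \<le> (\<Sum>c\<in>C. \<bar>B c\<bar>)" using c C by (intro member_le_sum) auto
    finally show ?thesis .
  qed
  then show ?thesis using that by blast
qed

text \<open>Witness form of a distance bound: a witness gives
  \<open>skorohod_dist T f g \<le> e\<close>, and a distance strictly below \<open>e\<close> between
  paths of \<open>cadlag_space T\<close> gives a witness. Limits of paths are handled through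
  witnesses instead of infima and suprema.\<close>

definition skorohod_close :: "real \<Rightarrow> (real \<Rightarrow> real) \<Rightarrow> (real \<Rightarrow> real) \<Rightarrow> real \<Rightarrow> (real \<Rightarrow> real) \<Rightarrow> bool" where
  "skorohod_close T f g e r \<longleftrightarrow>
     r \<in> time_changes T \<and> (\<forall>t\<in>{0..T}. \<bar>r t - t\<bar> \<le> e \<and> \<bar>f t - g (r t)\<bar> \<le> e)"

definition skorohod_cost :: "real \<Rightarrow> (real \<Rightarrow> real) \<Rightarrow> (real \<Rightarrow> real) \<Rightarrow> (real \<Rightarrow> real) \<Rightarrow> real" where
  "skorohod_cost T f g r = max (SUP t\<in>{0..T}. \<bar>r t - t\<bar>) (SUP t\<in>{0..T}. \<bar>f t - g (r t)\<bar>)"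

lemma skorohod_dist_cost: "skorohod_dist T f g = (INF r\<in>time_changes T. skorohod_cost T f g r)"
  by (simp add: skorohod_dist_def skorohod_cost_def)

lemma time_change_bdd:
  assumes "0 \<le> T" "r \<in> time_changes T"
  shows "bdd_above ((\<lambda>t. \<bar>r t - t\<bar>) ` {0..T})"
  using time_change_maps[OF assms] by (intro bdd_aboveI[of _ T]) force

lemma skorohod_cost_nonneg:
  assumes "0 \<le> T" "r \<in> time_changes T"
  shows "0 \<le> skorohod_cost T f g r"
proof -
  have "\<bar>r 0 - 0\<bar> \<le> (SUP t\<in>{0..T}. \<bar>r t - t\<bar>)"
    using assms time_change_bdd by (intro cSUP_upper) auto
  then show ?thesis by (auto simp: skorohod_cost_def le_max_iff_disj)
qed

lemma skorohod_dist_nonneg: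
  assumes "0 \<le> T" shows "0 \<le> skorohod_dist T f g"
  unfolding skorohod_dist_cost
  using assms time_changes_nonempty skorohod_cost_nonneg by (intro cINF_greatest) auto

lemma skorohod_dist_le:
  assumes "0 \<le> T" "skorohod_close T f g e r"
  shows "skorohod_dist T f g \<le> e"
proof -
  have r: "r \<in> time_changes T" using assms by (simp add: skorohod_close_def)
  have "skorohod_dist T f g \<le> skorohod_cost T f g r"
    unfolding skorohod_dist_cost using r assms skorohod_cost_nonneg
    by (intro cINF_lower bdd_belowI[of _ 0]) auto
  also have "\<dots> \<le> e"
    using assms unfolding skorohod_cost_def skorohod_close_def
    by (intro max.boundedI cSUP_least) auto
  finally show ?thesis .
qed

text \<open>The infimum need not be attained, hence the strict hypothesis. Boundedness of cadlag
  paths is what allows each term to be read off from the two suprema.\<close>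

lemma skorohod_distD:
  assumes T: "0 \<le> T" and fg: "f \<in> cadlag_space T" "g \<in> cadlag_space T"
    and d: "skorohod_dist T f g < e"
  obtains r where "skorohod_close T f g e r"
proof -
  have "\<exists>r\<in>time_changes T. skorohod_cost T f g r < e"
    using d time_changes_nonempty[of T] skorohod_cost_nonneg[OF T] unfolding skorohod_dist_cost
    by (subst (asm) cINF_less_iff) (auto intro: bdd_belowI[of _ 0])
  then obtain r where r: "r \<in> time_changes T" "skorohod_cost T f g r < e" by blast
  obtain B where B: "\<And>t. t \<in> {0..T} \<Longrightarrow> \<bar>f t\<bar> \<le> B" using cadlag_bounded fg T by metis
  obtain C where C: "\<And>t. t \<in> {0..T} \<Longrightarrow> \<bar>g t\<bar> \<le> C" using cadlag_bounded fg T by metis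
  have bd: "bdd_above ((\<lambda>t. \<bar>f t - g (r t)\<bar>) ` {0..T})"
  proof (rule bdd_aboveI2)
    fix t assume "t \<in> {0..T}"
    then show "\<bar>f t - g (r t)\<bar> \<le> B + C"
      using B[of t] C[of "r t"] time_change_maps[OF T r(1)] by fastforce
  qed
  have "\<bar>r t - t\<bar> \<le> e" "\<bar>f t - g (r t)\<bar> \<le> e" if "t \<in> {0..T}" for t
    using cSUP_upper[OF that time_change_bdd[OF T r(1)]] cSUP_upper[OF that bd] r(2)
    by (auto simp: skorohod_cost_def)
  with r show ?thesis by (intro that[of r]) (auto simp: skorohod_close_def)
qed

text \<open>A time change permutes \<open>{0..T}\<close>, so reindexing along it turns the suprema
  for \<open>r\<close> into those for its inverse with the two paths exchanged. This is the source
  of symmetry.\<close>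

lemma skorohod_cost_inverse:
  assumes "0 \<le> T" "r \<in> time_changes T"
  shows "\<exists>q\<in>time_changes T. skorohod_cost T g f q = skorohod_cost T f g r"
proof -
  obtain q where q: "q \<in> time_changes T" "\<And>t. t \<in> {0..T} \<Longrightarrow> q (r t) = t"
    "\<And>t. t \<in> {0..T} \<Longrightarrow> r (q t) = t" using inverse_time_change[OF assms] by blast
  note im = time_change_image[OF assms, symmetric]
  have "(\<lambda>t. \<bar>q t - t\<bar>) ` {0..T} = (\<lambda>t. \<bar>r t - t\<bar>) ` {0..T}"
    by (subst im) (auto simp: image_image q abs_minus_commute)
  moreover have "(\<lambda>t. \<bar>g t - f (q t)\<bar>) ` {0..T} = (\<lambda>t. \<bar>f t - g (r t)\<bar>) ` {0..T}"
    by (subst im) (auto simp: image_image q abs_minus_commute)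
  ultimately show ?thesis using q(1) by (intro bexI[of _ q]) (auto simp: skorohod_cost_def)
qed

lemma skorohod_dist_commute:
  assumes "0 \<le> T" shows "skorohod_dist T f g = skorohod_dist T g f"
proof -
  have "skorohod_cost T f g ` time_changes T = skorohod_cost T g f ` time_changes T"
    using skorohod_cost_inverse[OF assms] by (auto simp: image_iff) metis+
  then show ?thesis by (simp add: skorohod_dist_cost)
qed

lemma skorohod_dist_triangle:
  assumes T: "0 \<le> T" and c: "f \<in> cadlag_space T" "g \<in> cadlag_space T" "h \<in> cadlag_space T"
  shows "skorohod_dist T f h \<le> skorohod_dist T f g + skorohod_dist T g h"
proof (rule field_le_epsilon)
  fix e :: real assume e: "0 < e"
  define a b where "a = skorohod_dist T f g + e/2" and "b = skorohod_dist T g h + e/2"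
  obtain r where r: "skorohod_close T f g a r"
    using skorohod_distD[OF T c(1,2), of a] e by (auto simp: a_def)
  obtain q where q: "skorohod_close T g h b q"
    using skorohod_distD[OF T c(2,3), of b] e by (auto simp: b_def)
  have "skorohod_close T f h (a + b) (q \<circ> r)"
    unfolding skorohod_close_def
  proof (intro conjI ballI)
    show "q \<circ> r \<in> time_changes T"
      using r q comp_time_change[OF T] by (auto simp: skorohod_close_def)
    fix t assume t: "t \<in> {0..T}"
    then have "r t \<in> {0..T}" using r time_change_maps[OF T] by (auto simp: skorohod_close_def)
    then have "\<bar>r t - t\<bar> \<le> a" "\<bar>f t - g (r t)\<bar> \<le> a" "\<bar>q (r t) - r t\<bar> \<le> b" "\<bar>g (r t) - h (q (r t))\<bar> \<le> b"
      using r q t unfolding skorohod_close_def by blast+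
    then show "\<bar>(q \<circ> r) t - t\<bar> \<le> a + b" "\<bar>f t - h ((q \<circ> r) t)\<bar> \<le> a + b" by auto
  qed
  from skorohod_dist_le[OF T this]
  show "skorohod_dist T f h \<le> skorohod_dist T f g + skorohod_dist T g h + e"
    by (simp add: a_def b_def)
qed

text \<open>Small time changes keep a point to the right of \<open>t\<close> inside a right
  neighbourhood of \<open>t\<close>, so the right limits of the two paths agree. There is no such
  argument at \<open>T\<close>, where one uses that every time change fixes \<open>T\<close>;
  outside the interval both paths are constant.\<close>

lemma skorohod_dist_zero_imp_eq:
  assumes T: "0 < T" and c: "f \<in> cadlag_space T" "g \<in> cadlag_space T"
    and d: "skorohod_dist T f g = 0"
  shows "f = g"
proof -
  have close: "\<exists>r. skorohod_close T f g e r" if "e > 0" for e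
    using skorohod_distD[of T f g e] T c d that by auto
  have right: "f t = g t" if t: "0 \<le> t" "t < T" for t
  proof -
    have "(f \<longlongrightarrow> g t) (at_right t)"
    proof (rule tendstoI)
      fix e :: real assume e: "0 < e"
      have "(g \<longlongrightarrow> g t) (at_right t)" using c t by (auto simp: cadlag_space_def)
      then have "\<forall>\<^sub>F s in at_right t. dist (g s) (g t) < e/2" using e by (intro tendstoD) auto
      then obtain b where b: "b > t" "\<And>s. t < s \<Longrightarrow> s < b \<Longrightarrow> dist (g s) (g t) < e/2"
        unfolding eventually_at_right_field by blast
      have "dist (f s) (g t) < e" if s: "t < s" "s < min b T" for s
      proof -
        \<comment> \<open>Being smaller than the distances from \<open>s\<close> to \<open>t\<close>
          and to \<open>b\<close>, \<open>h\<close> keeps \<open>r s\<close> between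
          \<open>t\<close> and \<open>b\<close>, where \<open>g\<close> differs from
          \<open>g t\<close> by less than \<open>e/2\<close>; the other \<open>e/2\<close> pays for
          the value error at \<open>s\<close>.\<close>
        define h where "h = min (e/2) (min (s - t) (b - s) / 2)"
        have "h > 0" using s e by (auto simp: h_def)
        then obtain r where "skorohod_close T f g h r" using close by blast
        then have "\<bar>r s - s\<bar> \<le> h" "\<bar>f s - g (r s)\<bar> \<le> h"
          using s t unfolding skorohod_close_def by auto
        moreover have "h < s - t" "h < b - s" using s by (auto simp: h_def min_less_iff_disj)
        then have "t < r s" "r s < b" using calculation(1) by linarith+
        moreover have "h \<le> e/2" by (simp add: h_def)
        ultimately show ?thesis using b(2)[of "r s"] unfolding dist_real_def by linarith
      qed
      then show "\<forall>\<^sub>F s in at_right t. dist (f s) (g t) < e"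
        unfolding eventually_at_right_field using b(1) t by (intro exI[of _ "min b T"]) auto
    qed
    moreover have "(f \<longlongrightarrow> f t) (at_right t)" using c t by (auto simp: cadlag_space_def)
    ultimately show ?thesis using tendsto_unique[of "at_right t" f] by simp
  qed
  have "\<bar>f T - g T\<bar> \<le> e" if e: "e > 0" for e
  proof -
    obtain r where r: "skorohod_close T f g e r" using close[OF e] by blast
    then have "\<bar>f T - g (r T)\<bar> \<le> e" using T unfolding skorohod_close_def by auto
    then show ?thesis using r by (simp add: skorohod_close_def time_changes_def)
  qed
  then have fT: "f T = g T" using field_le_epsilon[of "\<bar>f T - g T\<bar>" 0] by auto
  show ?thesis
  proof
    fix t
    consider "t < 0" | "0 \<le> t" "t < T" | "t = T" | "t > T" by linarith
    then show "f t = g t"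
      using right[of t] right[of 0] fT T c by cases (auto simp: cadlag_space_def)
  qed
qed

lemma Metric_space_skorohod:
  assumes "0 < T" shows "Metric_space (cadlag_space T) (skorohod_dist T)"
proof
  fix f g h
  show "0 \<le> skorohod_dist T f g" using skorohod_dist_nonneg assms by simp
  show "skorohod_dist T f g = skorohod_dist T g f" using skorohod_dist_commute assms by simp
  assume fg: "f \<in> cadlag_space T" "g \<in> cadlag_space T"
  have "skorohod_dist T f f \<le> 0"
    using assms by (intro skorohod_dist_le[of _ _ _ _ id]) (auto simp: skorohod_close_def id_time_change)
  then show "skorohod_dist T f g = 0 \<longleftrightarrow> f = g"
    using skorohod_dist_zero_imp_eq[OF assms fg] skorohod_dist_nonneg[of T f f] assms by auto
  assume "h \<in> cadlag_space T"
  then show "skorohod_dist T f h \<le> skorohod_dist T f g + skorohod_dist T g h"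
    using skorohod_dist_triangle fg assms by simp
qed

section \<open>Compact sets of paths\<close>

text \<open>Time changes fix \<open>0\<close> and \<open>T\<close>, so a jump time converging to
  either endpoint cannot be carried to its limit. Making the endpoints nodes imposes the gap there
  too. The inequality is not strict, so the condition survives limits of the nodes.\<close>

definition jump_skeleton :: "real \<Rightarrow> real \<Rightarrow> nat \<Rightarrow> (nat \<Rightarrow> real) \<Rightarrow> bool" where
  "jump_skeleton T \<delta> m \<tau> \<longleftrightarrow> \<tau> 0 = 0 \<and> \<tau> (Suc m) = T \<and> (\<forall>i\<le>m. \<tau> i + \<delta> \<le> \<tau> (Suc i))"

text \<open>The value index is the number of interior nodes already passed. The endpoint nodes are
  not counted, so for separated nodes the function is constant before \<open>0\<close> and after
  \<open>T\<close>, as \<open>cadlag_space\<close> demands.\<close>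

definition step_fun :: "nat \<Rightarrow> (nat \<Rightarrow> real) \<Rightarrow> (nat \<Rightarrow> real) \<Rightarrow> real \<Rightarrow> real" where
  "step_fun m \<tau> v x = v (card {i \<in> {1..m}. \<tau> i \<le> x})"

text \<open>The additive error \<open>\<eta>\<close> accounts for the jumps.\<close>

definition log_modulus :: "real \<Rightarrow> real \<Rightarrow> real \<Rightarrow> (real \<Rightarrow> real) \<Rightarrow> bool" where
  "log_modulus T A \<eta> f \<longleftrightarrow>
     (\<forall>i\<ge>1. \<forall>s\<in>{0..T}. \<forall>t\<in>{0..T}. \<bar>s - t\<bar> < (1/2)^i \<longrightarrow> \<bar>f s - f t\<bar> \<le> A / real i + \<eta>)"

lemma ex_nat_gt_ge1: "\<exists>i::nat. i \<ge> 1 \<and> c < real i"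
proof -
  obtain i :: nat where "max c 1 < real i" using reals_Archimedean2 by blast
  then show ?thesis by (intro exI[of _ i]) auto
qed

text \<open>Cantor's diagonal argument for real functions with one common bound on a countable set.
  It serves both a dense set of times and the finite list of nodes and values of a step
  function.\<close>

lemma ex_convergent_subsequence:
  fixes f :: "nat \<Rightarrow> 'a \<Rightarrow> real"
  assumes "countable S" "\<And>n x. x \<in> S \<Longrightarrow> \<bar>f n x\<bar> \<le> M"
  shows "\<exists>k. strict_mono (k :: nat \<Rightarrow> nat) \<and> (\<forall>x\<in>S. \<exists>l. (\<lambda>n. f (k n) x) \<longlonglongrightarrow> l)"
proof (rule function_convergent_subsequence[of S f M])
  show "countable S" by fact
  show "norm (f n x) \<le> M" if "x \<in> S" for n x using assms(2)[OF that] by simp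
qed blast

lemma log_modulusD:
  assumes "log_modulus T A \<eta> f" "1 \<le> i" "s \<in> {0..T}" "t \<in> {0..T}" "\<bar>s - t\<bar> < (1/2)^i"
  shows "\<bar>f s - f t\<bar> \<le> A / real i + \<eta>"
  using assms unfolding log_modulus_def by blast

section \<open>Step functions with separated nodes\<close>

lemma jump_skeleton_gap:
  assumes "jump_skeleton T \<delta> m \<tau>" "i \<le> j" "j \<le> Suc m"
  shows "\<tau> i + real (j - i) * \<delta> \<le> \<tau> j"
  using assms(2,3)
proof (induction rule: dec_induct)
  case (step n)
  then have "\<tau> n + \<delta> \<le> \<tau> (Suc n)" using assms(1) by (auto simp: jump_skeleton_def)
  with step show ?case by (simp add: Suc_diff_le algebra_simps)
qed simp

lemma jump_skeleton_mono:
  assumes "jump_skeleton T \<delta> m \<tau>" "0 < \<delta>" "i \<le> j" "j \<le> Suc m"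
  shows "\<tau> i \<le> \<tau> j"
proof -
  have "0 \<le> real (j - i) * \<delta>" using assms(2) by simp
  then show ?thesis using jump_skeleton_gap[OF assms(1,3,4)] by linarith
qed

lemma jump_skeleton_range:
  assumes "jump_skeleton T \<delta> m \<tau>" "0 < \<delta>" "j \<le> Suc m"
  shows "\<tau> j \<in> {0..T}"
  using jump_skeleton_mono[OF assms(1,2), of 0 j] jump_skeleton_mono[OF assms(1,2), of j "Suc m"] assms
  by (auto simp: jump_skeleton_def)

text \<open>The upper bound on \<open>x\<close> is demanded for \<open>i < m\<close> only: the last
  piece has no right end and also covers the times from \<open>T\<close> on.\<close>

lemma step_fun_eq:
  assumes "jump_skeleton T \<delta> m \<tau>" "0 < \<delta>" "i \<le> m" "\<tau> i \<le> x" "i < m \<Longrightarrow> x < \<tau> (Suc i)"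
  shows "step_fun m \<tau> v x = v i"
proof -
  have "{j \<in> {1..m}. \<tau> j \<le> x} = {1..i}"
  proof (intro set_eqI iffI)
    fix j assume "j \<in> {j \<in> {1..m}. \<tau> j \<le> x}"
    then have j: "1 \<le> j" "j \<le> m" "\<tau> j \<le> x" by auto
    have "j \<le> i"
    proof (rule ccontr)
      assume "\<not> j \<le> i"
      then have "\<tau> (Suc i) \<le> \<tau> j" "i < m" using jump_skeleton_mono[OF assms(1,2), of "Suc i" j] j by auto
      with assms(5) j show False by simp
    qed
    then show "j \<in> {1..i}" using j by simp
  next
    fix j assume j: "j \<in> {1..i}"
    then show "j \<in> {j \<in> {1..m}. \<tau> j \<le> x}"
      using jump_skeleton_mono[OF assms(1,2), of j i] assms by auto
  qed
  then show ?thesis by (simp add: step_fun_def)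
qed

lemma step_fun_cases:
  assumes "jump_skeleton T \<delta> m \<tau>" "0 < \<delta>" "0 \<le> x"
  obtains i where "i \<le> m" "\<tau> i \<le> x" "i < m \<Longrightarrow> x < \<tau> (Suc i)"
proof -
  define i where "i = Max {i. i \<le> m \<and> \<tau> i \<le> x}"
  have fin: "finite {i. i \<le> m \<and> \<tau> i \<le> x}" and ne: "0 \<in> {i. i \<le> m \<and> \<tau> i \<le> x}"
    using assms by (auto simp: jump_skeleton_def)
  then have "i \<in> {i. i \<le> m \<and> \<tau> i \<le> x}" unfolding i_def by (intro Max_in) auto
  moreover have "x < \<tau> (Suc i)" if "i < m"
  proof (rule ccontr)
    assume "\<not> x < \<tau> (Suc i)"
    then have "Suc i \<in> {i. i \<le> m \<and> \<tau> i \<le> x}" using that by auto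
    then have "Suc i \<le> i" unfolding i_def using Max_ge[OF fin] by blast
    then show False by simp
  qed
  ultimately show ?thesis using that by blast
qed

text \<open>On either side of \<open>x\<close> the comparison of \<open>y\<close> with a node is
  eventually frozen, as \<open>\<tau> i \<le> x\<close> from the right and as
  \<open>\<tau> i < x\<close> from the left. There are finitely many nodes, so the count is frozen
  as well.\<close>

lemma eventually_const_step:
  fixes \<tau> :: "nat \<Rightarrow> real"
  shows "\<forall>\<^sub>F y in at_right x. step_fun m \<tau> v y = step_fun m \<tau> v x"
    and "\<exists>L. \<forall>\<^sub>F y in at_left x. step_fun m \<tau> v y = L"
proof -
  have "\<forall>\<^sub>F y in at_right x. (\<tau> i \<le> y \<longleftrightarrow> \<tau> i \<le> x)" for i
  proof (cases "\<tau> i \<le> x")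
    case True
    then show ?thesis by (auto simp: eventually_at_right_field intro!: exI[of _ "x+1"])
  next
    case False
    then show ?thesis by (auto simp: eventually_at_right_field intro!: exI[of _ "\<tau> i"])
  qed
  then have "\<forall>\<^sub>F y in at_right x. \<forall>i\<in>{1..m}. (\<tau> i \<le> y \<longleftrightarrow> \<tau> i \<le> x)"
    by (intro eventually_ball_finite) auto
  then show "\<forall>\<^sub>F y in at_right x. step_fun m \<tau> v y = step_fun m \<tau> v x"
    by eventually_elim (auto simp: step_fun_def intro!: arg_cong[of _ _ v] arg_cong[of _ _ card])
  have "\<forall>\<^sub>F y in at_left x. (\<tau> i \<le> y \<longleftrightarrow> \<tau> i < x)" for i
  proof (cases "\<tau> i < x")
    case True
    then show ?thesis by (auto simp: eventually_at_left_field intro!: exI[of _ "\<tau> i"])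
  next
    case False
    then show ?thesis by (auto simp: eventually_at_left_field intro!: exI[of _ "x - 1"])
  qed
  then have "\<forall>\<^sub>F y in at_left x. \<forall>i\<in>{1..m}. (\<tau> i \<le> y \<longleftrightarrow> \<tau> i < x)"
    by (intro eventually_ball_finite) auto
  then have "\<forall>\<^sub>F y in at_left x. step_fun m \<tau> v y = v (card {i\<in>{1..m}. \<tau> i < x})"
    by eventually_elim (auto simp: step_fun_def intro!: arg_cong[of _ _ v] arg_cong[of _ _ card])
  then show "\<exists>L. \<forall>\<^sub>F y in at_left x. step_fun m \<tau> v y = L" by blast
qed

lemma step_fun_cadlag:
  assumes "jump_skeleton T \<delta> m \<tau>" "0 < \<delta>"
  shows "step_fun m \<tau> v \<in> cadlag_space T"
  unfolding cadlag_space_def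
proof (intro CollectI conjI ballI allI impI)
  fix t
  show "(step_fun m \<tau> v \<longlongrightarrow> step_fun m \<tau> v t) (at_right t)"
    using eventually_const_step(1) by (rule tendsto_eventually)
  show "\<exists>L. (step_fun m \<tau> v \<longlongrightarrow> L) (at_left t)"
    using eventually_const_step(2) tendsto_eventually by metis
next
  have pos: "\<tau> i > 0" if "i \<in> {1..m}" for i
  proof -
    have "\<tau> 0 + real (i - 0) * \<delta> \<le> \<tau> i" using jump_skeleton_gap[OF assms(1), of 0 i] that by simp
    moreover have "0 < real i * \<delta>" "\<tau> 0 = 0" using that assms by (auto simp: jump_skeleton_def)
    ultimately show ?thesis by simp
  qed
  fix t :: real assume t: "t < 0"
  have "{i \<in> {1..m}. \<tau> i \<le> t} = {i \<in> {1..m}. \<tau> i \<le> 0}" using pos t by force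
  then show "step_fun m \<tau> v t = step_fun m \<tau> v 0" by (simp add: step_fun_def)
next
  fix t :: real assume t: "T < t"
  have "\<tau> m \<le> T" using jump_skeleton_range[OF assms, of m] by auto
  then show "step_fun m \<tau> v t = step_fun m \<tau> v T"
    using step_fun_eq[OF assms, of m t v] step_fun_eq[OF assms, of m T v] t by simp
qed

text \<open>Chaining at the coarsest scale \<open>i = 1\<close>: the modulus there compares times at
  distance strictly below \<open>1/2\<close>, so steps of length \<open>1/4\<close> are admissible
  and \<open>q\<close> of them reach \<open>t\<close>.\<close>

lemma log_modulus_bound:
  assumes "log_modulus T A \<eta> f" "t \<in> {0..T}" "t \<le> real q / 4"
  shows "\<bar>f t - f 0\<bar> \<le> real q * (A + \<eta>)"
  using assms(2,3)
proof (induction q arbitrary: t)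
  case (Suc q)
  define s where "s = max 0 (t - 1/4)"
  have s: "s \<in> {0..T}" "s \<le> real q / 4" "\<bar>t - s\<bar> < (1/2)^1" using Suc.prems by (auto simp: s_def max_def)
  have "\<bar>f t - f s\<bar> \<le> A / real 1 + \<eta>"
    using log_modulusD[OF assms(1) _ Suc.prems(1) s(1,3)] by simp
  with Suc.IH[OF s(1,2)] show ?case by (simp add: algebra_simps)
qed auto

lemma log_modulus_uniform_bound:
  assumes "log_modulus T A \<eta> f" "t \<in> {0..T}" "f 0 = 0" "0 \<le> A + \<eta>"
  shows "\<bar>f t\<bar> \<le> real (nat \<lceil>4 * T\<rceil>) * (A + \<eta>)"
proof -
  have "t \<le> real (nat \<lceil>4 * T\<rceil>) / 4" using assms(2) real_nat_ceiling_ge[of "4 * T"] by simp linarith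
  from log_modulus_bound[OF assms(1,2) this] show ?thesis using assms by simp
qed

text \<open>With additive error \<open>0\<close> the bound \<open>A / i\<close> tends to zero, so
  the function is continuous on the interval.\<close>

lemma log_modulus_zero_cadlag:
  assumes "log_modulus T A 0 f" "\<forall>t<0. f t = f 0" "\<forall>t>T. f t = f T"
  shows "f \<in> cadlag_space T"
proof -
  have cont: "\<exists>d>0. \<forall>s\<in>{0..T}. \<bar>s - t\<bar> < d \<longrightarrow> \<bar>f s - f t\<bar> < e" if "t \<in> {0..T}" "e > 0" for t e
  proof -
    obtain i :: nat where i: "i \<ge> 1" "A / e < real i" using ex_nat_gt_ge1 by blast
    have "A / real i < e" using i that by (simp add: field_simps)
    then have "\<bar>f s - f t\<bar> < e" if "s \<in> {0..T}" "\<bar>s - t\<bar> < (1/2)^i" for s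
      using log_modulusD[OF assms(1) i(1) that(1) \<open>t \<in> {0..T}\<close> that(2)] by simp
    then show ?thesis by (intro exI[of _ "(1/2)^i"]) auto
  qed
  show ?thesis unfolding cadlag_space_def
  proof (intro CollectI conjI ballI)
    fix t assume t: "t \<in> {0..<T}"
    show "(f \<longlongrightarrow> f t) (at_right t)"
    proof (rule tendstoI)
      fix e :: real assume "0 < e"
      then obtain d where d: "d > 0" "\<forall>s\<in>{0..T}. \<bar>s - t\<bar> < d \<longrightarrow> \<bar>f s - f t\<bar> < e" using cont[of t] t by auto
      then show "\<forall>\<^sub>F s in at_right t. dist (f s) (f t) < e"
        unfolding eventually_at_right_field dist_real_def using t
        by (intro exI[of _ "min T (t + d)"]) auto
    qed
  next
    fix t assume t: "t \<in> {0<..T}"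
    have "(f \<longlongrightarrow> f t) (at_left t)"
    proof (rule tendstoI)
      fix e :: real assume "0 < e"
      then obtain d where d: "d > 0" "\<forall>s\<in>{0..T}. \<bar>s - t\<bar> < d \<longrightarrow> \<bar>f s - f t\<bar> < e" using cont[of t] t by auto
      then show "\<forall>\<^sub>F s in at_left t. dist (f s) (f t) < e"
        unfolding eventually_at_left_field dist_real_def using t
        by (intro exI[of _ "max 0 (t - d)"]) auto
    qed
    then show "\<exists>L. (f \<longlongrightarrow> L) (at_left t)" by blast
  qed (use assms in auto)
qed

text \<open>The members may jump, but by a vanishing amount. A subsequence converging on a countable
  dense set of times is uniformly Cauchy, because comparison with a fine grid costs
  \<open>A / i\<close> plus an error that is eventually small. In the limit the error is
  zero.\<close>

lemma asymptotic_Arzela_Ascoli: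
  fixes f :: "nat \<Rightarrow> real \<Rightarrow> real"
  assumes T: "0 < T" and A: "0 \<le> A" and H: "\<And>n. log_modulus T A (\<eta> n) (f n)" "\<And>n. f n 0 = 0"
    "\<And>n. 0 \<le> \<eta> n" "\<eta> \<longlonglongrightarrow> 0"
  shows "\<exists>k g. strict_mono (k :: nat \<Rightarrow> nat) \<and> uniform_limit {0..T} (\<lambda>n. f (k n)) g sequentially
    \<and> log_modulus T A 0 g"
proof -
  obtain E where "\<forall>x\<in>range \<eta>. norm x \<le> E"
    using convergent_imp_bounded[OF H(4)] unfolding bounded_iff by blast
  then have E: "\<eta> n \<le> E" for n by (auto simp: abs_le_iff)
  \<comment> \<open>All grid points \<open>T * (p / P)\<close> belong to this countable set, so one
    subsequence serves every later choice of the grid.\<close>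
  define D where "D = (\<lambda>q. T * q) ` (\<rat> \<inter> {0..1})"
  have cD: "countable D" unfolding D_def using countable_rat by auto
  have bD: "\<bar>f n x\<bar> \<le> real (nat \<lceil>4 * T\<rceil>) * (A + E)" if "x \<in> D" for n x
  proof -
    have "x \<in> {0..T}" using that T by (auto simp: D_def mult_left_le)
    then have "\<bar>f n x\<bar> \<le> real (nat \<lceil>4 * T\<rceil>) * (A + \<eta> n)"
      using log_modulus_uniform_bound[OF H(1) _ H(2)] A H(3)[of n] by simp
    also have "\<dots> \<le> real (nat \<lceil>4 * T\<rceil>) * (A + E)" using E[of n] by (intro mult_left_mono) auto
    finally show ?thesis by simp
  qed
  obtain k where k: "strict_mono (k::nat\<Rightarrow>nat)" "\<And>x. x \<in> D \<Longrightarrow> \<exists>l. (\<lambda>n. f (k n) x) \<longlonglongrightarrow> l"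
    using ex_convergent_subsequence[of D f, OF cD bD] by blast
  have eta: "(\<lambda>n. \<eta> (k n)) \<longlonglongrightarrow> 0" using LIMSEQ_subseq_LIMSEQ[OF H(4) k(1)] by (simp add: comp_def)
  have "uniformly_Cauchy_on {0..T} (\<lambda>n. f (k n))"
  proof (rule uniformly_Cauchy_onI)
    fix e :: real assume e: "0 < e"
    \<comment> \<open>The budget is \<open>e/8\<close> each for \<open>A / i\<close>, for the
      additive error and for the grid values: two comparisons with a grid point cost less than
      \<open>e/4\<close> each, and the grid values differ by less than \<open>e/8\<close>.\<close>
    obtain i :: nat where i: "i \<ge> 1" "8 * A / e < real i" using ex_nat_gt_ge1 by blast
    have "8 * A < e * real i" using i(2) e by (simp add: pos_divide_less_eq mult.commute)
    then have Ai: "A / real i < e/8" using i(1) by (simp add: pos_divide_less_eq)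
    have "(0::real) < (1/2)^i" by simp
    obtain P :: nat where P: "P \<ge> 1" "T * 2^i < real P" using ex_nat_gt_ge1 by blast
    have mesh: "T / real P < (1/2)^i"
      using P by (simp add: power_one_over pos_divide_less_eq pos_less_divide_eq)
    define F where "F = (\<lambda>p. T * (real p / real P)) ` {..P}"
    have FD: "F \<subseteq> D"
    proof
      fix x assume "x \<in> F"
      then obtain p where p: "p \<le> P" "x = T * (real p / real P)" by (auto simp: F_def)
      then have "real p / real P \<in> \<rat> \<inter> {0..1}" using P by (auto simp: divide_le_eq)
      then show "x \<in> D" using p(2) unfolding D_def by blast
    qed
    have "\<forall>\<^sub>F n in sequentially. \<forall>m\<ge>n. \<bar>f (k m) x - f (k n) x\<bar> < e/8" if "x \<in> F" for x
    proof -
      have "Cauchy (\<lambda>n. f (k n) x)" using k(2)[of x] that FD by (auto intro: LIMSEQ_imp_Cauchy)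
      then obtain M where "\<forall>m\<ge>M. \<forall>n\<ge>M. dist (f (k m) x) (f (k n) x) < e/8"
        using e metric_CauchyD[of _ "e/8"] by fastforce
      then show ?thesis unfolding eventually_sequentially dist_real_def
        by (intro exI[of _ M]) auto
    qed
    then have "\<forall>\<^sub>F n in sequentially. \<forall>x\<in>F. \<forall>m\<ge>n. \<bar>f (k m) x - f (k n) x\<bar> < e/8"
      by (intro eventually_ball_finite) (auto simp: F_def)
    then obtain M1 where M1: "\<And>n m x. M1 \<le> n \<Longrightarrow> x \<in> F \<Longrightarrow> m \<ge> n \<Longrightarrow> \<bar>f (k m) x - f (k n) x\<bar> < e/8"
      unfolding eventually_sequentially by blast
    have "\<forall>\<^sub>F n in sequentially. \<eta> (k n) < e/8" using order_tendstoD(2)[OF eta, of "e/8"] e by simp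
    then obtain M2 where M2: "\<And>n. M2 \<le> n \<Longrightarrow> \<eta> (k n) < e/8"
      unfolding eventually_sequentially by blast
    show "\<exists>M. \<forall>x\<in>{0..T}. \<forall>m\<ge>M. \<forall>n\<ge>M. dist (f (k m) x) (f (k n) x) < e"
    proof (intro exI ballI allI impI)
      fix x m n assume x: "x \<in> {0..T}" and mn: "max M1 M2 \<le> m" "max M1 M2 \<le> n"
      \<comment> \<open>Index of the last grid point not after \<open>x\<close>; its distance to
        \<open>x\<close> is less than the mesh.\<close>
      define p where "p = nat \<lfloor>x * real P / T\<rfloor>"
      define y where "y = T * (real p / real P)"
      have nn: "0 \<le> x * real P / T" using x T by auto
      have p1: "real p \<le> x * real P / T" using nn unfolding p_def by simp
      have p2: "x * real P / T < real p + 1" using nn unfolding p_def by linarith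
      have "x * real P / T \<le> real P" using x T mult_right_mono[of x T "real P"]
        by (simp add: pos_divide_le_eq mult.commute)
      then have "real p \<le> real P" using p1 by linarith
      then have yF: "y \<in> F" unfolding y_def F_def by (intro imageI) simp
      have p1': "real p * T \<le> x * real P" using p1 T by (simp add: pos_le_divide_eq)
      have p2': "x * real P < (real p + 1) * T" using p2 T by (simp add: pos_divide_less_eq)
      have "y \<le> x" using p1' P unfolding y_def by (simp add: pos_divide_le_eq mult.commute)
      moreover have "x < (real p + 1) * T / real P" using p2' P by (simp add: pos_less_divide_eq)
      then have "x - y < T / real P" unfolding y_def by (simp add: add_divide_distrib algebra_simps)
      ultimately have xy: "\<bar>x - y\<bar> < (1/2)^i" using mesh by simp
      have yT: "y \<in> {0..T}" using \<open>y \<le> x\<close> x T by (auto simp: y_def)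
      have "\<bar>f (k j) x - f (k j) y\<bar> \<le> A / real i + \<eta> (k j)" for j
        using log_modulusD[OF H(1) i(1) x yT xy] .
      from this[of m] this[of n] have "\<bar>f (k m) x - f (k m) y\<bar> < e/4" "\<bar>f (k n) x - f (k n) y\<bar> < e/4"
        using M2[of m] M2[of n] Ai mn by linarith+
      moreover have "\<bar>f (k m) y - f (k n) y\<bar> < e/8"
        using M1[of m y n] M1[of n y m] yF mn
        by (cases "m \<le> n") (auto simp: abs_minus_commute)
      ultimately show "dist (f (k m) x) (f (k n) x) < e" unfolding dist_real_def using e by linarith
    qed
  qed
  then obtain g where g: "uniform_limit {0..T} (\<lambda>n. f (k n)) g sequentially"
    unfolding uniformly_convergent_eq_Cauchy[symmetric] uniformly_convergent_on_def by blast
  have "log_modulus T A 0 g" unfolding log_modulus_def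
  proof (intro allI impI ballI)
    fix i :: nat and s t assume a: "1 \<le> i" "s \<in> {0..T}" "t \<in> {0..T}" "\<bar>s - t\<bar> < (1/2)^i"
    have "(\<lambda>n. \<bar>f (k n) s - f (k n) t\<bar>) \<longlonglongrightarrow> \<bar>g s - g t\<bar>"
      using tendsto_uniform_limitI[OF g] a by (intro tendsto_intros) auto
    moreover have "(\<lambda>n. A / real i + \<eta> (k n)) \<longlonglongrightarrow> A / real i + 0"
      using eta by (intro tendsto_intros)
    moreover have "\<forall>n. \<bar>f (k n) s - f (k n) t\<bar> \<le> A / real i + \<eta> (k n)"
      using log_modulusD[OF H(1) a] by blast
    ultimately show "\<bar>g s - g t\<bar> \<le> A / real i + 0" by (meson LIMSEQ_le)
  qed
  then show ?thesis using k(1) g by blast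
qed

text \<open>The strict inequality between the time distance and the dyadic length leaves room for a
  small displacement of both times, so the bound for a nearby \<open>h\<close> can be used at the
  displaced times.\<close>

lemma log_modulus_closed:
  assumes T: "0 \<le> T"
    and close: "\<And>e. e > 0 \<Longrightarrow> \<exists>h r. log_modulus T A \<eta> h \<and> skorohod_close T g h e r"
  shows "log_modulus T A \<eta> g"
  unfolding log_modulus_def
proof (intro allI impI ballI)
  fix i :: nat and s t assume a: "1 \<le> i" "s \<in> {0..T}" "t \<in> {0..T}" "\<bar>s - t\<bar> < (1/2)^i"
  show "\<bar>g s - g t\<bar> \<le> A / real i + \<eta>"
  proof (rule field_le_epsilon)
    fix e :: real assume e: "0 < e"
    \<comment> \<open>A third of the slack: the two displacements together use at most two thirds,
      and the inequality stays strict. The bound \<open>e/2\<close> covers the two value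
      errors.\<close>
    define d where "d = min (e/2) (((1/2)^i - \<bar>s - t\<bar>) / 3)"
    have d: "0 < d" "d \<le> e/2" "3 * d \<le> (1/2)^i - \<bar>s - t\<bar>"
      using e a unfolding d_def by (auto simp: min_def)
    then obtain h r where h: "log_modulus T A \<eta> h" "skorohod_close T g h d r" using close by blast
    then have r: "r \<in> time_changes T" by (simp add: skorohod_close_def)
    have b: "\<bar>r s - s\<bar> \<le> d" "\<bar>g s - h (r s)\<bar> \<le> d" "\<bar>r t - t\<bar> \<le> d" "\<bar>g t - h (r t)\<bar> \<le> d"
      using h(2) a unfolding skorohod_close_def by blast+
    have "\<bar>r s - r t\<bar> < (1/2)^i" using b(1,3) d by linarith
    then have "\<bar>h (r s) - h (r t)\<bar> \<le> A / real i + \<eta>"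
      using log_modulusD[OF h(1) a(1) time_change_maps[OF T r a(2)] time_change_maps[OF T r a(3)]] by blast
    then show "\<bar>g s - g t\<bar> \<le> A / real i + \<eta> + e" using b(2,4) d by linarith
  qed
qed

section \<open>Piecewise linear time changes with prescribed images of the nodes\<close>

definition tent :: "real \<Rightarrow> real \<Rightarrow> real \<Rightarrow> real" where
  "tent \<delta> c x = max 0 (1 - \<bar>x - c\<bar> / \<delta>)"

lemma tent_bounds: "0 < \<delta> \<Longrightarrow> \<bar>tent \<delta> c x\<bar> \<le> 1"
  by (auto simp: tent_def)

lemma tent_lipschitz:
  assumes "0 < \<delta>" shows "\<bar>tent \<delta> c x - tent \<delta> c y\<bar> \<le> \<bar>x - y\<bar> / \<delta>"
proof -
  have "\<bar>\<bar>x - c\<bar> / \<delta> - \<bar>y - c\<bar> / \<delta>\<bar> \<le> \<bar>x - y\<bar> / \<delta>"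
    using assms by (auto simp: diff_divide_distrib[symmetric] intro!: divide_right_mono)
  then show ?thesis unfolding tent_def max_def by (smt (verit))
qed

lemma jump_skeleton_dist:
  assumes "jump_skeleton T \<delta> m \<tau>" "0 < \<delta>" "i \<le> Suc m" "j \<le> Suc m" "i \<noteq> j"
  shows "\<delta> \<le> \<bar>\<tau> i - \<tau> j\<bar>"
proof -
  have *: "\<delta> \<le> \<tau> b - \<tau> a" if "a < b" "b \<le> Suc m" for a b
  proof -
    have "1 * \<delta> \<le> real (b - a) * \<delta>" using that assms(2) by (intro mult_right_mono) auto
    then show ?thesis using jump_skeleton_gap[OF assms(1), of a b] that by simp
  qed
  show ?thesis using *[of i j] *[of j i] assms by (cases "i < j") auto
qed

text \<open>The time change \<open>x + (\<Sum>i. (\<tau>' i - \<tau> i) * tent \<delta> (\<tau> i) x)\<close> maps the jump times of one step function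
  onto those of the other. It is strictly increasing as soon as the perturbation is \<open>\<delta>\<close>-small.\<close>

lemma step_fun_close:
  assumes sk: "jump_skeleton T \<delta> m \<tau>" "jump_skeleton T \<delta> m \<tau>'" and d: "0 < \<delta>"
    and S: "(\<Sum>i\<le>Suc m. \<bar>\<tau>' i - \<tau> i\<bar>) < \<delta>" "(\<Sum>i\<le>Suc m. \<bar>\<tau>' i - \<tau> i\<bar>) \<le> e"
    and v: "\<And>i. i \<le> m \<Longrightarrow> \<bar>v i - v' i\<bar> \<le> e"
  shows "\<exists>r. skorohod_close T (step_fun m \<tau> v) (step_fun m \<tau>' v') e r"
proof -
  define p where "p x = (\<Sum>i\<le>Suc m. (\<tau>' i - \<tau> i) * tent \<delta> (\<tau> i) x)" for x
  define r where "r x = x + p x" for x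
  define s where "s = (\<Sum>i\<le>Suc m. \<bar>\<tau>' i - \<tau> i\<bar>)"
  have r_node: "r (\<tau> j) = \<tau>' j" if j: "j \<le> Suc m" for j
  proof -
    have "p (\<tau> j) = (\<Sum>i\<le>Suc m. if i = j then \<tau>' j - \<tau> j else 0)"
      unfolding p_def
    proof (rule sum.cong)
      fix i assume i: "i \<in> {..Suc m}"
      show "(\<tau>' i - \<tau> i) * tent \<delta> (\<tau> i) (\<tau> j) = (if i = j then \<tau>' j - \<tau> j else 0)"
      proof (cases "i = j")
        case False
        \<comment> \<open>The gap condition keeps every other node out of the interior of this
          tent's support, so at a node only its own displacement acts.\<close>
        then have "\<delta> \<le> \<bar>\<tau> j - \<tau> i\<bar>" using jump_skeleton_dist[OF sk(1) d] i j by auto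
        then have "1 \<le> \<bar>\<tau> j - \<tau> i\<bar> / \<delta>" using d by (simp add: pos_le_divide_eq)
        then have "tent \<delta> (\<tau> i) (\<tau> j) = 0" by (simp add: tent_def)
        then show ?thesis using False by simp
      qed (simp add: tent_def)
    qed simp
    then show ?thesis using j by (simp add: r_def)
  qed
  have p_lip: "\<bar>p x - p y\<bar> \<le> s * (\<bar>x - y\<bar> / \<delta>)" for x y
  proof -
    have "p x - p y = (\<Sum>i\<le>Suc m. (\<tau>' i - \<tau> i) * (tent \<delta> (\<tau> i) x - tent \<delta> (\<tau> i) y))"
      unfolding p_def sum_subtractf[symmetric] by (simp add: algebra_simps)
    also have "\<bar>\<dots>\<bar> \<le> (\<Sum>i\<le>Suc m. \<bar>\<tau>' i - \<tau> i\<bar> * (\<bar>x - y\<bar> / \<delta>))"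
      by (rule order_trans[OF sum_abs], rule sum_mono)
         (use tent_lipschitz[OF d] in \<open>auto simp: abs_mult simp del: times_divide_eq_right intro!: mult_left_mono\<close>)
    finally show ?thesis unfolding s_def sum_distrib_right .
  qed
  have p_le: "\<bar>p x\<bar> \<le> s" for x
  proof -
    have "\<bar>p x\<bar> \<le> (\<Sum>i\<le>Suc m. \<bar>\<tau>' i - \<tau> i\<bar> * 1)"
      unfolding p_def
      by (rule order_trans[OF sum_abs], rule sum_mono)
         (use tent_bounds[OF d] in \<open>auto simp: abs_mult intro!: mult_left_le\<close>)
    then show ?thesis by (simp add: s_def)
  qed
  have r_mono: "r x < r y" if "x < y" for x y
  proof -
    have "s * (\<bar>x - y\<bar> / \<delta>) = (s / \<delta>) * (y - x)" using that by simp
    also have "\<dots> < 1 * (y - x)" using S(1) d that by (intro mult_strict_right_mono) (auto simp: s_def)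
    finally show ?thesis using p_lip[of x y] by (simp add: r_def)
  qed
  have "continuous_on {0..T} r"
    unfolding r_def p_def tent_def using d by (intro continuous_intros) auto
  moreover have "r 0 = 0" "r T = T"
    using r_node[of 0] r_node[of "Suc m"] sk by (auto simp: jump_skeleton_def)
  ultimately have tc: "r \<in> time_changes T" using r_mono by (auto simp: time_changes_def strict_mono_on_def)
  have "\<bar>step_fun m \<tau> v x - step_fun m \<tau>' v' (r x)\<bar> \<le> e" if x: "x \<in> {0..T}" for x
  proof -
    \<comment> \<open>An increasing map that sends nodes to nodes preserves the index of the piece,
      so only the values \<open>v i\<close> and \<open>v' i\<close> remain to be compared.\<close>
    obtain i where i: "i \<le> m" "\<tau> i \<le> x" "i < m \<Longrightarrow> x < \<tau> (Suc i)"
      using step_fun_cases[OF sk(1) d] x by auto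
    have "\<tau>' i \<le> r x" using r_node[of i] i r_mono[of "\<tau> i" x] by (cases "\<tau> i = x") auto
    moreover have "r x < \<tau>' (Suc i)" if "i < m" using r_node[of "Suc i"] r_mono[of x "\<tau> (Suc i)"] i that by auto
    ultimately show ?thesis
      using step_fun_eq[OF sk(1) d i, of v] step_fun_eq[OF sk(2) d i(1), of "r x" v'] v[OF i(1)] by auto
  qed
  moreover have "\<bar>r x - x\<bar> \<le> e" for x using p_le[of x] S(2) by (simp add: r_def s_def)
  ultimately show ?thesis using tc by (auto simp: skorohod_close_def)
qed

section \<open>Subsequences of separated step functions\<close>

lemma infinite_nat_subseq:
  fixes A :: "nat set"
  assumes "infinite A"
  shows "\<exists>k :: nat \<Rightarrow> nat. strict_mono k \<and> (\<forall>n. k n \<in> A)"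
  using assms enumerate_in_set strict_mono_enumerate by metis

text \<open>The gap \<delta> bounds the number of jumps in terms of \<open>T / \<delta>\<close>, so
  the pigeonhole principle fixes it along a subsequence. The paths are then described by finitely
  many bounded reals, and convergence of these gives Skorohod convergence by moving the
  nodes.\<close>

lemma step_fun_subseq:
  fixes T \<delta> R :: real and m :: "nat \<Rightarrow> nat"
  assumes T: "0 < T" and d: "0 < \<delta>" and sk: "\<And>n. jump_skeleton T \<delta> (m n) (\<tau> n)"
    and R: "\<And>n x. x \<in> {0..T} \<Longrightarrow> \<bar>step_fun (m n) (\<tau> n) (v n) x\<bar> \<le> R"
  shows "\<exists>(k :: nat \<Rightarrow> nat) M \<tau>' v'. strict_mono k \<and> jump_skeleton T \<delta> M \<tau>' \<and>
    (\<forall>e>0. \<forall>\<^sub>F n in sequentially.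
        \<exists>r. skorohod_close T (step_fun M \<tau>' v') (step_fun (m (k n)) (\<tau> (k n)) (v (k n))) e r)"
proof -
  have "m n \<le> nat \<lceil>T / \<delta>\<rceil>" for n
  proof -
    have "real (Suc (m n)) * \<delta> \<le> T"
      using jump_skeleton_gap[OF sk[of n], of 0 "Suc (m n)"] sk[of n] by (auto simp: jump_skeleton_def)
    then have "real (Suc (m n)) \<le> T / \<delta>" using d by (simp add: pos_le_divide_eq)
    then have "real (m n) \<le> real (nat \<lceil>T / \<delta>\<rceil>)" using real_nat_ceiling_ge[of "T/\<delta>"] by linarith
    then show ?thesis by simp
  qed
  then have "finite (range m)" by (intro finite_subset[of "range m" "{..nat \<lceil>T / \<delta>\<rceil>}"]) auto
  then obtain n0 where "infinite {n. m n = m n0}"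
    using pigeonhole_infinite[of UNIV m] by auto
  then obtain k1 :: "nat \<Rightarrow> nat" where k1: "strict_mono k1" "\<And>n. k1 n \<in> {n. m n = m n0}"
    using infinite_nat_subseq[of "{n. m n = m n0}"] by blast
  define M where "M = m n0"
  have mM: "m (k1 n) = M" for n using k1(2)[of n] by (simp add: M_def)
  have skM: "jump_skeleton T \<delta> M (\<tau> (k1 n))" for n using sk[of "k1 n"] by (simp add: mM)
  \<comment> \<open>A Boolean tag merges nodes and values into one family, so that a single
    extraction makes both converge.\<close>
  define S where "S = Pair True ` {..Suc M} \<union> Pair False ` {..M}"
  define F where "F n = (\<lambda>(b,i). if b then \<tau> (k1 n) i else v (k1 n) i)" for n
  have cS: "countable S" unfolding S_def by (intro countable_finite) auto
  have bS: "\<bar>F n x\<bar> \<le> max T R" if x: "x \<in> S" for n x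
  proof -
    from x consider i where "x = (True, i)" "i \<le> Suc M" | i where "x = (False, i)" "i \<le> M"
      by (auto simp: S_def)
    then show ?thesis
    proof cases
      case 1
      then show ?thesis using jump_skeleton_range[OF skM[of n] d, of i] by (auto simp: F_def)
    next
      case 2
      have i: "i \<le> m (k1 n)" using 2 mM by simp
      \<comment> \<open>The value with index \<open>i\<close> is attained at node \<open>i\<close>,
        since the next node is strictly later; the bound on the path therefore bounds the
        values.\<close>
      have "\<tau> (k1 n) i < \<tau> (k1 n) (Suc i)" using skM[of n] 2 d unfolding jump_skeleton_def by fastforce
      then have "step_fun (m (k1 n)) (\<tau> (k1 n)) (v (k1 n)) (\<tau> (k1 n) i) = v (k1 n) i"
        using step_fun_eq[OF sk d i order_refl] by simp
      then show ?thesis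
        using R[OF jump_skeleton_range[OF skM[of n] d, of i], of "k1 n"] 2 by (auto simp: F_def)
    qed
  qed
  obtain k2 where k2: "strict_mono (k2::nat\<Rightarrow>nat)" "\<And>x. x \<in> S \<Longrightarrow> \<exists>l. (\<lambda>n. F (k2 n) x) \<longlonglongrightarrow> l"
    using ex_convergent_subsequence[of S F, OF cS bS] by blast
  define k where "k = k1 \<circ> k2"
  define \<tau>' where "\<tau>' i = lim (\<lambda>n. \<tau> (k n) i)" for i
  define v' where "v' i = lim (\<lambda>n. v (k n) i)" for i
  have lt: "(\<lambda>n. \<tau> (k n) i) \<longlonglongrightarrow> \<tau>' i" if "i \<le> Suc M" for i
    using k2(2)[of "(True,i)"] that unfolding \<tau>'_def
    by (auto simp: S_def F_def k_def limI)
  have lv: "(\<lambda>n. v (k n) i) \<longlonglongrightarrow> v' i" if "i \<le> M" for i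
    using k2(2)[of "(False,i)"] that unfolding v'_def
    by (auto simp: S_def F_def k_def limI)
  have skk: "jump_skeleton T \<delta> M (\<tau> (k n))" for n using skM[of "k2 n"] by (simp add: k_def)
  have sk': "jump_skeleton T \<delta> M \<tau>'" unfolding jump_skeleton_def
  proof (intro conjI allI impI)
    have "\<tau> (k n) 0 = 0" "\<tau> (k n) (Suc M) = T" for n using skk[of n] by (auto simp: jump_skeleton_def)
    then show "\<tau>' 0 = 0" "\<tau>' (Suc M) = T" using lt[of 0] lt[of "Suc M"] by (auto simp: LIMSEQ_const_iff)
    fix i assume i: "i \<le> M"
    have "(\<lambda>n. \<tau> (k n) i + \<delta>) \<longlonglongrightarrow> \<tau>' i + \<delta>" using lt[of i] i by (intro tendsto_intros) auto
    moreover have "(\<lambda>n. \<tau> (k n) (Suc i)) \<longlonglongrightarrow> \<tau>' (Suc i)" using lt i by auto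
    moreover have "\<tau> (k n) i + \<delta> \<le> \<tau> (k n) (Suc i)" for n using skk[of n] i by (auto simp: jump_skeleton_def)
    ultimately show "\<tau>' i + \<delta> \<le> \<tau>' (Suc i)" using LIMSEQ_le by blast
  qed
  have "strict_mono k" unfolding k_def using k1 k2 by (simp add: strict_mono_o)
  moreover have "\<forall>\<^sub>F n in sequentially.
        \<exists>r. skorohod_close T (step_fun M \<tau>' v') (step_fun (m (k n)) (\<tau> (k n)) (v (k n))) e r"
    if e: "e > 0" for e
  proof -
    have "(\<lambda>n. \<Sum>i\<le>Suc M. \<bar>\<tau> (k n) i - \<tau>' i\<bar>) \<longlonglongrightarrow> (\<Sum>i\<le>Suc M. \<bar>\<tau>' i - \<tau>' i\<bar>)"
      using lt by (intro tendsto_intros) auto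
    then have lim0: "(\<lambda>n. \<Sum>i\<le>Suc M. \<bar>\<tau> (k n) i - \<tau>' i\<bar>) \<longlonglongrightarrow> 0" by simp
    have "\<forall>\<^sub>F n in sequentially. (\<Sum>i\<le>Suc M. \<bar>\<tau> (k n) i - \<tau>' i\<bar>) < min \<delta> e"
      using order_tendstoD(2)[OF lim0, of "min \<delta> e"] d e by simp
    moreover have "\<forall>\<^sub>F n in sequentially. \<forall>i\<in>{..M}. \<bar>v' i - v (k n) i\<bar> < e"
    proof (intro eventually_ball_finite ballI)
      fix i assume "i \<in> {..M}"
      then have "\<forall>\<^sub>F n in sequentially. dist (v (k n) i) (v' i) < e" using lv e by (intro tendstoD) auto
      then show "\<forall>\<^sub>F n in sequentially. \<bar>v' i - v (k n) i\<bar> < e"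
        by (simp add: dist_real_def abs_minus_commute)
    qed simp
    ultimately show ?thesis
    proof eventually_elim
      case (elim n)
      have "m (k n) = M" by (simp add: k_def mM)
      then show ?case
        using step_fun_close[OF sk' skk[of n] d, of e v' "v (k n)"] elim by force
    qed
  qed
  ultimately show ?thesis using sk' by blast
qed

text \<open>Each index has its own separation \<open>\<delta> n\<close>, which may decay at any
  speed: the first set already contains the limits along indices tending to infinity, which are
  continuous once \<open>\<eta>\<close> tends to zero. The condition at \<open>0\<close> turns the
  modulus into a uniform bound.\<close>

definition path_compactum :: "real \<Rightarrow> real \<Rightarrow> (nat \<Rightarrow> real) \<Rightarrow> (nat \<Rightarrow> real) \<Rightarrow> (real \<Rightarrow> real) set" where
  "path_compactum T A \<eta> \<delta> =
     {f \<in> cadlag_space T. f 0 = 0 \<and> log_modulus T A 0 f} \<union>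
     (\<Union>n. {step_fun m \<tau> v | m \<tau> v. jump_skeleton T (\<delta> n) m \<tau> \<and> step_fun m \<tau> v 0 = 0
              \<and> log_modulus T A (\<eta> n) (step_fun m \<tau> v)})"

lemma path_compactum_cadlag:
  assumes "\<And>n. 0 < \<delta> n"
  shows "path_compactum T A \<eta> \<delta> \<subseteq> cadlag_space T"
  using step_fun_cadlag assms by (fastforce simp: path_compactum_def)

text \<open>Sequential compactness, with three cases: infinitely many members in the continuous
  part, infinitely many in one step set, or step sets with index tending to infinity. The asymptotic
  argument covers the first and the third. In the second the limit has to lie in the same step set,
  so the modulus and the initial value must pass to Skorohod limits.\<close>

lemma compact_path_compactum:
  assumes T: "0 < T" and A: "0 \<le> A" and \<eta>: "\<And>n. 0 \<le> \<eta> n" "\<eta> \<longlonglongrightarrow> 0" and \<delta>: "\<And>n. 0 < \<delta> n"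
  shows "compactin (skorohod_top T) (path_compactum T A \<eta> \<delta>)"
proof -
  let ?K = "path_compactum T A \<eta> \<delta>"
  interpret Metric_space "cadlag_space T" "skorohod_dist T" by (rule Metric_space_skorohod[OF T])
  define C where "C = {f \<in> cadlag_space T. f 0 = 0 \<and> log_modulus T A 0 f}"
  define D where "D n = {step_fun m \<tau> v | m \<tau> v. jump_skeleton T (\<delta> n) m \<tau> \<and> step_fun m \<tau> v 0 = 0
              \<and> log_modulus T A (\<eta> n) (step_fun m \<tau> v)}" for n
  have K: "?K = C \<union> (\<Union>n. D n)" by (simp add: path_compactum_def C_def D_def)
  note sub = path_compactum_cadlag[of \<delta> T A \<eta>, OF \<delta>]
  have conv: "limitin mtopology (\<sigma> \<circ> k) l sequentially"
    if "range \<sigma> \<subseteq> ?K" "l \<in> cadlag_space T"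
      "\<And>e. e > 0 \<Longrightarrow> \<forall>\<^sub>F n in sequentially. \<exists>r. skorohod_close T l (\<sigma> (k n)) e r" for \<sigma> k l
    unfolding limitin_metric
  proof (intro conjI allI impI that(2))
    fix e :: real assume "0 < e"
    then have "\<forall>\<^sub>F n in sequentially. \<exists>r. skorohod_close T l (\<sigma> (k n)) (e/2) r" using that(3) by simp
    then show "\<forall>\<^sub>F n in sequentially. (\<sigma> \<circ> k) n \<in> cadlag_space T \<and> skorohod_dist T ((\<sigma> \<circ> k) n) l < e"
    proof eventually_elim
      case (elim n)
      then have "skorohod_dist T l (\<sigma> (k n)) \<le> e/2" using skorohod_dist_le[of T, OF less_imp_le[OF T]] by blast
      then show ?case using that(1) sub \<open>0 < e\<close> commute[of l] by (auto simp: image_subset_iff subset_iff)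
    qed
  qed
  have asym: "\<exists>l k. l \<in> ?K \<and> strict_mono (k::nat\<Rightarrow>nat) \<and> limitin mtopology (\<sigma> \<circ> k) l sequentially"
    if \<sigma>: "range \<sigma> \<subseteq> ?K" and k0: "strict_mono k0" and
      H: "\<And>n. log_modulus T A (\<theta> n) (\<sigma> (k0 n))" "\<And>n. \<sigma> (k0 n) 0 = 0" "\<And>n. 0 \<le> \<theta> n" "\<theta> \<longlonglongrightarrow> 0"
    for \<sigma> :: "nat \<Rightarrow> real \<Rightarrow> real" and \<theta> :: "nat \<Rightarrow> real" and k0 :: "nat \<Rightarrow> nat"
  proof -
    obtain k g where kg: "strict_mono (k :: nat \<Rightarrow> nat)"
      "uniform_limit {0..T} (\<lambda>n. \<sigma> (k0 (k n))) g sequentially" "log_modulus T A 0 g"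
      using asymptotic_Arzela_Ascoli[OF T A, of \<theta> "\<lambda>n. \<sigma> (k0 n)"] H by blast
    \<comment> \<open>The uniform limit is controlled only on \<open>{0..T}\<close>; clamping the
      time supplies the constant continuation required of a path.\<close>
    define l where "l t = g (max 0 (min t T))" for t
    have lg: "l t = g t" if "t \<in> {0..T}" for t using that by (auto simp: l_def)
    have "log_modulus T A 0 l" using kg(3) lg unfolding log_modulus_def by simp
    moreover have "\<forall>t<0. l t = l 0" "\<forall>t>T. l t = l T" using T by (auto simp: l_def)
    ultimately have lc: "l \<in> cadlag_space T" "log_modulus T A 0 l" using log_modulus_zero_cadlag by auto
    have "(\<lambda>n. \<sigma> (k0 (k n)) 0) \<longlonglongrightarrow> g 0" using tendsto_uniform_limitI[OF kg(2), of 0] T by auto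
    then have "l 0 = 0" using H(2) lg[of 0] T LIMSEQ_unique[OF _ tendsto_const] by fastforce
    then have "l \<in> ?K" using lc by (simp add: K C_def)
    moreover have "limitin mtopology (\<sigma> \<circ> (k0 \<circ> k)) l sequentially"
    proof (rule conv[OF \<sigma> lc(1)])
      fix e :: real assume "0 < e"
      then have "\<forall>\<^sub>F n in sequentially. \<forall>t\<in>{0..T}. dist (\<sigma> (k0 (k n)) t) (g t) < e"
        using uniform_limitD[OF kg(2)] by simp
      then show "\<forall>\<^sub>F n in sequentially. \<exists>r. skorohod_close T l (\<sigma> ((k0 \<circ> k) n)) e r"
      proof eventually_elim
        case (elim n)
        then have "skorohod_close T l (\<sigma> ((k0 \<circ> k) n)) e id"
          using \<open>0 < e\<close> lg by (force simp: skorohod_close_def id_time_change dist_real_def abs_minus_commute)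
        then show ?case by blast
      qed
    qed
    ultimately show ?thesis using kg(1) k0 by (metis strict_mono_o)
  qed
  have "\<exists>l k. l \<in> ?K \<and> strict_mono (k::nat\<Rightarrow>nat) \<and> limitin mtopology (\<sigma> \<circ> k) l sequentially"
    if \<sigma>: "range \<sigma> \<subseteq> ?K" for \<sigma> :: "nat \<Rightarrow> real \<Rightarrow> real"
  proof (cases "infinite {n. \<sigma> n \<in> C}")
    case True
    then obtain k0 :: "nat \<Rightarrow> nat" where "strict_mono k0" "\<And>n. \<sigma> (k0 n) \<in> C" using infinite_nat_subseq[of "{n. \<sigma> n \<in> C}"] by blast
    then show ?thesis using asym[OF \<sigma>, of k0 "\<lambda>_. 0"] by (auto simp: C_def)
  next
    case False
    then have "infinite {n. \<sigma> n \<notin> C}" using infinite_UNIV_nat finite_Un[of "{n. \<sigma> n \<in> C}" "{n. \<sigma> n \<notin> C}"]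
      by (metis (mono_tags) Collect_neg_eq Compl_partition)
    then obtain k0 :: "nat \<Rightarrow> nat" where k0: "strict_mono k0" "\<And>n. \<sigma> (k0 n) \<notin> C"
      using infinite_nat_subseq[of "{n. \<sigma> n \<notin> C}"] by blast
    have "\<exists>j. \<sigma> (k0 n) \<in> D j" for n using \<sigma> k0(2)[of n] K by (auto simp: image_subset_iff)
    then obtain j where j: "\<And>n. \<sigma> (k0 n) \<in> D (j n)" by metis
    show ?thesis
    proof (cases "\<exists>i. infinite {n. j n = i}")
      case True
      then obtain i where "infinite {n. j n = i}" by blast
      then obtain k1 :: "nat \<Rightarrow> nat" where k1: "strict_mono k1" "\<And>n. j (k1 n) = i"
        using infinite_nat_subseq[of "{n. j n = i}"] by blast
      define k2 where "k2 = k0 \<circ> k1"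
      have k2: "strict_mono k2" "\<And>n. \<sigma> (k2 n) \<in> D i"
        using k0 k1 j unfolding k2_def by (auto simp: strict_mono_o) metis
      then have "\<forall>n. \<exists>m \<tau> v. \<sigma> (k2 n) = step_fun m \<tau> v \<and> jump_skeleton T (\<delta> i) m \<tau> \<and> step_fun m \<tau> v 0 = 0
              \<and> log_modulus T A (\<eta> i) (step_fun m \<tau> v)" unfolding D_def by blast
      then obtain m \<tau> v where mtv: "\<And>n. \<sigma> (k2 n) = step_fun (m n) (\<tau> n) (v n)"
        "\<And>n. jump_skeleton T (\<delta> i) (m n) (\<tau> n)" "\<And>n. \<sigma> (k2 n) 0 = 0" "\<And>n. log_modulus T A (\<eta> i) (\<sigma> (k2 n))"
        by metis
      have bd: "\<bar>step_fun (m n) (\<tau> n) (v n) x\<bar> \<le> real (nat \<lceil>4 * T\<rceil>) * (A + \<eta> i)" if "x \<in> {0..T}" for n x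
        using log_modulus_uniform_bound[OF mtv(4) that mtv(3)] A \<eta>(1)[of i] mtv(1) by simp
      obtain k3 :: "nat \<Rightarrow> nat" and M \<tau>' v' where k3: "strict_mono k3" "jump_skeleton T (\<delta> i) M \<tau>'"
        "\<And>e. e > 0 \<Longrightarrow> \<forall>\<^sub>F n in sequentially.
          \<exists>r. skorohod_close T (step_fun M \<tau>' v') (step_fun (m (k3 n)) (\<tau> (k3 n)) (v (k3 n))) e r"
        using step_fun_subseq[of T "\<delta> i" m \<tau> v, OF T \<delta> mtv(2) bd] by blast
      let ?l = "step_fun M \<tau>' v'"
      have lc: "?l \<in> cadlag_space T" using step_fun_cadlag[OF k3(2) \<delta>] .
      have ev: "\<forall>\<^sub>F n in sequentially. \<exists>r. skorohod_close T ?l (\<sigma> (k2 (k3 n))) e r" if "e > 0" for e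
        using k3(3)[OF that] by (simp add: mtv(1))
      have ex: "\<exists>n r. skorohod_close T ?l (\<sigma> (k2 (k3 n))) e r" if "e > 0" for e
        using eventually_happens[OF ev[OF that]] by auto
      have lm: "log_modulus T A (\<eta> i) ?l"
        using log_modulus_closed[of T A "\<eta> i" ?l] T ex mtv(4) by (metis less_imp_le)
      have "\<bar>?l 0\<bar> \<le> e" if e: "e > 0" for e
      proof -
        obtain n r where "skorohod_close T ?l (\<sigma> (k2 (k3 n))) e r" using ex[OF e] by blast
        then have "\<forall>t\<in>{0..T}. \<bar>?l t - \<sigma> (k2 (k3 n)) (r t)\<bar> \<le> e" "r 0 = 0"
          unfolding skorohod_close_def time_changes_def by auto
        then have "\<bar>?l 0 - \<sigma> (k2 (k3 n)) 0\<bar> \<le> e" using T by (metis atLeastAtMost_iff less_imp_le order_refl)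
        then show ?thesis using mtv(3) by simp
      qed
      then have "?l 0 = 0" using field_le_epsilon[of "\<bar>?l 0\<bar>" 0] by auto
      then have "?l \<in> D i" using k3(2) lm unfolding D_def by blast
      then have "?l \<in> ?K" by (auto simp: K)
      moreover have "limitin mtopology (\<sigma> \<circ> (k2 \<circ> k3)) ?l sequentially"
        using conv[OF \<sigma> lc, of "k2 \<circ> k3"] ev by simp
      ultimately show ?thesis using k2(1) k3(1) by (metis strict_mono_o)
    next
      case False
      \<comment> \<open>Each index occurs finitely often, so only finitely many terms have an index
        below any given \<open>Z\<close>.\<close>
      have "filterlim j at_top sequentially"
        unfolding filterlim_at_top eventually_sequentially
      proof
        fix Z :: nat
        have "finite (\<Union>i<Z. {n. j n = i})" using False by auto
        then have "finite {n. j n < Z}" by (rule finite_subset[rotated]) auto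
        then obtain N where "\<forall>n\<in>{n. j n < Z}. n < N" using finite_nat_set_iff_bounded by blast
        then show "\<exists>N. \<forall>n\<ge>N. Z \<le> j n" by (metis mem_Collect_eq not_less)
      qed
      then have lim: "(\<lambda>n. \<eta> (j n)) \<longlonglongrightarrow> 0" using \<eta>(2) filterlim_compose by blast
      have jj: "log_modulus T A (\<eta> (j n)) (\<sigma> (k0 n)) \<and> \<sigma> (k0 n) 0 = 0" for n
        using j[of n] unfolding D_def by force
      show ?thesis using asym[OF \<sigma> k0(1), of "\<lambda>n. \<eta> (j n)"] jj \<eta>(1) lim by simp
    qed
  qed
  then show ?thesis
    unfolding skorohod_top_def compactin_sequentially using sub by blast
qed

section \<open>The graphical construction\<close>

lemma finite_sites: "finite (sites N :: ('d::finite \<Rightarrow> nat) set)"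
  and card_sites: "card (sites N :: ('d::finite \<Rightarrow> nat) set) = N ^ CARD('d)"
proof -
  have *: "sites N = (\<Pi>\<^sub>E i\<in>(UNIV::'d set). {..<N})" by (auto simp: sites_def PiE_def Pi_def)
  show "finite (sites N :: ('d \<Rightarrow> nat) set)" unfolding * by (intro finite_PiE) auto
  show "card (sites N :: ('d \<Rightarrow> nat) set) = N ^ CARD('d)" unfolding * by (subst card_PiE) auto
qed

lemma edges_image:
  "edges N = (\<lambda>(x, l, b). (x, shift N x l b)) ` ((sites N :: ('d::finite \<Rightarrow> nat) set) \<times> UNIV \<times> UNIV)"
  unfolding edges_def by (auto simp: image_iff) blast

lemma finite_edges: "finite (edges N :: (('d::finite \<Rightarrow> nat) \<times> ('d \<Rightarrow> nat)) set)"
  unfolding edges_image using finite_sites by (intro finite_imageI finite_cartesian_product) auto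

lemma card_edges: "card (edges N :: (('d::finite \<Rightarrow> nat) \<times> ('d \<Rightarrow> nat)) set) \<le> 2 * CARD('d) * N ^ CARD('d)"
proof -
  have "card (edges N :: (('d \<Rightarrow> nat) \<times> ('d \<Rightarrow> nat)) set)
      \<le> card ((sites N :: ('d \<Rightarrow> nat) set) \<times> (UNIV :: 'd set) \<times> (UNIV :: bool set))"
    unfolding edges_image using finite_sites by (intro card_image_le finite_cartesian_product) auto
  also have "\<dots> = 2 * CARD('d) * N ^ CARD('d)" by (simp add: card_cartesian_product card_sites)
  finally show ?thesis .
qed

lemma edges_nonempty:
  assumes "0 < N" shows "edges N \<noteq> ({} :: (('d::finite \<Rightarrow> nat) \<times> ('d \<Rightarrow> nat)) set)"
proof -
  have "(\<lambda>_. 0) \<in> (sites N :: ('d \<Rightarrow> nat) set)" using assms by (simp add: sites_def)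
  then show ?thesis unfolding edges_image by blast
qed

definition ring :: "('d rv_idx \<Rightarrow> real) \<Rightarrow> (('d \<Rightarrow> nat) \<times> ('d \<Rightarrow> nat)) \<times> nat \<Rightarrow> real" where
  "ring \<omega> p = arrival \<omega> (fst (fst p)) (snd (fst p)) (snd p)"

text \<open>Collects labels (edge and number of the ring) and not times, so that simultaneous rings
  of different clocks are counted separately.\<close>

definition rings :: "nat \<Rightarrow> ('d::finite rv_idx \<Rightarrow> real) \<Rightarrow> real set \<Rightarrow> ((('d \<Rightarrow> nat) \<times> ('d \<Rightarrow> nat)) \<times> nat) set" where
  "rings N \<omega> I = {p. fst p \<in> edges N \<and> ring \<omega> p \<in> I}"

definition usede :: "'d lstate \<Rightarrow> ('d \<Rightarrow> nat) \<times> ('d \<Rightarrow> nat) \<Rightarrow> nat" where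
  "usede s e = used s (fst e) (snd e)"

text \<open>Holds almost surely, and makes the rings of each clock positive and strictly increasing.
  The dynamics reads only the clocks of edges, so only these are constrained.\<close>

definition positive_clocks :: "nat \<Rightarrow> ('d::finite rv_idx \<Rightarrow> real) \<Rightarrow> bool" where
  "positive_clocks N \<omega> \<longleftrightarrow> (\<forall>x y j. (x, y) \<in> edges N \<longrightarrow> 0 < \<omega> (Clock x y j))"

lemma ring_pos:
  assumes "positive_clocks N \<omega>" "e \<in> edges N" shows "0 < ring \<omega> (e, j)"
  unfolding ring_def arrival_def using assms
  by (intro sum_pos) (auto simp: positive_clocks_def)

lemma ring_Suc: "ring \<omega> (e, Suc j) = ring \<omega> (e, j) + \<omega> (Clock (fst e) (snd e) (Suc j))"
  by (simp add: ring_def arrival_def)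

lemma ring_less_Suc:
  assumes "positive_clocks N \<omega>" "e \<in> edges N" shows "ring \<omega> (e, j) < ring \<omega> (e, Suc j)"
  using assms by (auto simp: ring_Suc positive_clocks_def)

text \<open>The edge set is finite and nonempty for \<open>0 < N\<close>, so a minimiser exists and
  the choice in the definition is a genuine one.\<close>

lemma next_edge:
  fixes \<omega> :: "'d::finite rv_idx \<Rightarrow> real"
  assumes "0 < N"
  shows "next_edge N \<omega> s \<in> edges N"
    and "e \<in> edges N \<Longrightarrow> ring \<omega> (next_edge N \<omega> s, usede s (next_edge N \<omega> s)) \<le> ring \<omega> (e, usede s e)"
proof -
  let ?E = "edges N :: (('d \<Rightarrow> nat) \<times> ('d \<Rightarrow> nat)) set" and ?f = "\<lambda>e. ring \<omega> (e, usede s e)"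
  have "\<exists>e. e \<in> ?E \<and> (\<forall>e'\<in>?E. ?f e \<le> ?f e')"
    using ex_is_arg_min_if_finite[OF finite_edges edges_nonempty[OF assms], of ?f]
    unfolding is_arg_min_linorder by blast
  then have "next_edge N \<omega> s \<in> ?E \<and> (\<forall>e'\<in>?E. ?f (next_edge N \<omega> s) \<le> ?f e')"
    unfolding next_edge_def ring_def usede_def fst_conv snd_conv by (rule someI_ex)
  then show "next_edge N \<omega> s \<in> ?E" "e \<in> ?E \<Longrightarrow> ?f (next_edge N \<omega> s) \<le> ?f e" by auto
qed

lemma step_clock: "clock (step N \<omega> s) = ring \<omega> (next_edge N \<omega> s, usede s (next_edge N \<omega> s))"
  by (simp add: step_def Let_def ring_def usede_def split: prod.split)

lemma step_usede: "usede (step N \<omega> s) e = usede s e + (if e = next_edge N \<omega> s then 1 else 0)"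
  by (cases e) (auto simp add: step_def Let_def usede_def split: prod.split)

lemma step_Cc: "Cc s x y \<le> Cc (step N \<omega> s) x y"
  "Cc (step N \<omega> s) x y \<le> Cc s x y + (if (x, y) = next_edge N \<omega> s then 1 else 0)"
  by (auto simp add: step_def Let_def split: prod.split)

section \<open>Event times of the jump chain\<close>

context
  fixes N :: nat and n :: real and rho0 :: "real^'d::finite \<Rightarrow> real" and \<omega> :: "'d rv_idx \<Rightarrow> real"
  assumes N: "0 < N" and pos: "positive_clocks N \<omega>"
begin

abbreviation "st m \<equiv> traj N n rho0 \<omega> m"
abbreviation "edge m \<equiv> next_edge N \<omega> (st m)"
abbreviation "mark m \<equiv> (edge m, usede (st m) (edge m))"
abbreviation "tm m \<equiv> clock (st m)"

lemma st_Suc: "st (Suc m) = step N \<omega> (st m)"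
  by (simp add: traj_def)

lemma tm_0: "tm 0 = 0" by (simp add: traj_def init_state_def)

lemma tm_Suc: "tm (Suc m) = ring \<omega> (mark m)" by (simp add: st_Suc step_clock)

lemma tm_le_ring: "e \<in> edges N \<Longrightarrow> tm m \<le> ring \<omega> (e, usede (st m) e)"
proof (induction m)
  case 0
  then show ?case by (simp add: tm_0 less_imp_le[OF ring_pos[OF pos 0]])
next
  case (Suc m)
  have "tm (Suc m) \<le> ring \<omega> (e, usede (st m) e)"
    unfolding tm_Suc using next_edge(2)[OF N Suc.prems] by simp
  also have "\<dots> \<le> ring \<omega> (e, usede (st (Suc m)) e)"
    using less_imp_le[OF ring_less_Suc[OF pos Suc.prems]] by (auto simp: st_Suc step_usede)
  finally show ?case .
qed

lemma tm_mono: "incseq tm"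
  by (rule incseq_SucI) (simp add: tm_Suc tm_le_ring next_edge(1)[OF N])

lemma usede_mono: "m \<le> m' \<Longrightarrow> usede (st m) e \<le> usede (st m') e"
  by (induction rule: dec_induct) (auto simp: st_Suc step_usede)

text \<open>Processing a mark raises the counter of its edge, and counters never decrease, so the
  same pair of edge and counter cannot return.\<close>

lemma mark_inj: "inj mark"
proof -
  have *: "mark m \<noteq> mark m'" if "m < m'" for m m'
  proof
    assume eq: "mark m = mark m'"
    have "usede (st (Suc m)) (edge m) \<le> usede (st m') (edge m)" using usede_mono that by simp
    moreover have "usede (st m) (edge m) = usede (st m') (edge m)" using eq by (metis prod.inject)
    ultimately show False by (simp add: st_Suc step_usede)
  qed
  show ?thesis
  proof (rule injI)
    fix m m' assume "mark m = mark m'"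
    then show "m = m'" using *[of m m'] *[of m' m] by (metis linorder_neq_iff)
  qed
qed

lemma mark_rings: "mark m \<in> rings N \<omega> I \<longleftrightarrow> tm (Suc m) \<in> I"
  by (simp add: rings_def tm_Suc next_edge(1)[OF N])

lemma tm_pos: "0 < tm (Suc m)"
  unfolding tm_Suc using ring_pos[OF pos next_edge(1)[OF N]] by simp

definition num_rings :: "real \<Rightarrow> nat" where
  "num_rings t = (GREATEST m. tm m \<le> t)"

lemma state_at_num_rings: "state_at N n rho0 \<omega> t = st (num_rings t)"
  by (simp add: state_at_def num_rings_def)

context
  fixes T :: real
  assumes T: "0 \<le> T" and fin: "finite (rings N \<omega> {0<..T})"
begin

text \<open>Distinct steps use distinct marks, so finitely many rings up to \<open>T\<close> allow
  only finitely many steps. This rules out explosion and gives \<open>GREATEST\<close> its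
  meaning.\<close>

lemma finite_tm: "finite {m. tm m \<le> T}"
proof -
  have "finite (mark -` rings N \<omega> {0<..T})"
    using fin mark_inj by (intro finite_vimageI) auto
  then have "finite (Suc ` (mark -` rings N \<omega> {0<..T}))" by simp
  moreover have "{m. tm m \<le> T} \<subseteq> insert 0 (Suc ` (mark -` rings N \<omega> {0<..T}))"
  proof
    fix m assume m: "m \<in> {m. tm m \<le> T}"
    show "m \<in> insert 0 (Suc ` (mark -` rings N \<omega> {0<..T}))"
    proof (cases m)
      case (Suc m')
      then have "mark m' \<in> rings N \<omega> {0<..T}" using m tm_pos[of m'] by (simp add: mark_rings)
      then show ?thesis using Suc by auto
    qed simp
  qed
  ultimately show ?thesis by (meson finite_insert finite_subset)
qed

text \<open>The maximum exists by finiteness, and the event times are nondecreasing. The equivalence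
  replaces \<open>GREATEST\<close> from here on.\<close>

lemma le_num_rings_iff:
  assumes "t \<in> {0..T}" shows "m \<le> num_rings t \<longleftrightarrow> tm m \<le> t"
proof -
  obtain B where B: "\<And>m. tm m \<le> T \<Longrightarrow> m \<le> B"
    using finite_tm unfolding finite_nat_set_iff_bounded_le by blast
  have B': "\<And>m. tm m \<le> t \<Longrightarrow> m \<le> B" using B assms by fastforce
  have "tm 0 \<le> t" using assms tm_0 by simp
  then have c: "tm (num_rings t) \<le> t" unfolding num_rings_def using B' by (rule GreatestI_nat)
  have "m \<le> num_rings t" if "tm m \<le> t" unfolding num_rings_def using that B' by (rule Greatest_le_nat)
  moreover have "tm m \<le> t" if "m \<le> num_rings t" using incseqD[OF tm_mono that] c by simp
  ultimately show ?thesis by blast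
qed

lemma num_rings_mono: "s \<in> {0..T} \<Longrightarrow> t \<in> {0..T} \<Longrightarrow> s \<le> t \<Longrightarrow> num_rings s \<le> num_rings t"
  using le_num_rings_iff[of s "num_rings s"] le_num_rings_iff[of t "num_rings s"] by simp

text \<open>The steps made between the two times use distinct marks in the window. A subset of the
  rings is enough, as the increment only has to be bounded from above.\<close>

lemma num_rings_increment:
  assumes "s \<in> {0..T}" "t \<in> {0..T}" "s \<le> t"
  shows "\<exists>F. finite F \<and> F \<subseteq> rings N \<omega> {s<..t} \<and> card F = num_rings t - num_rings s"
proof (intro exI conjI)
  let ?F = "mark ` {num_rings s..<num_rings t}"
  show "finite ?F" by simp
  show "card ?F = num_rings t - num_rings s"
    using mark_inj by (subst card_image) (auto intro: inj_on_subset)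
  show "?F \<subseteq> rings N \<omega> {s<..t}"
  proof
    fix p assume "p \<in> ?F"
    then obtain m where m: "num_rings s \<le> m" "m < num_rings t" "p = mark m" by auto
    have "\<not> tm (Suc m) \<le> s" "tm (Suc m) \<le> t"
      using m le_num_rings_iff[OF assms(1), of "Suc m"] le_num_rings_iff[OF assms(2), of "Suc m"] by auto
    then show "p \<in> rings N \<omega> {s<..t}" by (simp add: m(3) mark_rings)
  qed
qed

lemma num_rings_eq_card:
  assumes "t \<in> {0..T}" shows "num_rings t = card {i \<in> {1..num_rings T}. tm i \<le> t}"
proof -
  have "{i \<in> {1..num_rings T}. tm i \<le> t} = {1..num_rings t}"
  proof (intro set_eqI iffI)
    fix i assume "i \<in> {i \<in> {1..num_rings T}. tm i \<le> t}"
    then show "i \<in> {1..num_rings t}" using le_num_rings_iff[OF assms, of i] by simp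
  next
    fix i assume i: "i \<in> {1..num_rings t}"
    then have "i \<le> num_rings T" using num_rings_mono[of t T] assms T by simp
    then show "i \<in> {i \<in> {1..num_rings T}. tm i \<le> t}" using i le_num_rings_iff[OF assms, of i] by simp
  qed
  then show ?thesis by simp
qed

end

text \<open>Consecutive event times belong to different marks, so the separation of rings separates
  them; the two empty windows give the gaps at \<open>0\<close> and \<open>T\<close>. Nodes beyond
  the last event are set to \<open>T\<close>, so that the final node is the endpoint.\<close>

lemma jump_skeleton_rings:
  assumes T: "0 < T" and d: "0 < \<delta>" "\<delta> \<le> T" and fin: "finite (rings N \<omega> {0<..T})"
    and first: "rings N \<omega> {0<..\<delta>} = {}" and last: "rings N \<omega> {T-\<delta><..T} = {}"
    and sep: "\<And>p q. p \<in> rings N \<omega> {0<..T} \<Longrightarrow> q \<in> rings N \<omega> {0<..T} \<Longrightarrow> p \<noteq> q \<Longrightarrow> \<delta> \<le> \<bar>ring \<omega> p - ring \<omega> q\<bar>"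
  shows "jump_skeleton T \<delta> (num_rings T) (\<lambda>i. if i \<le> num_rings T then tm i else T)"
proof -
  have T0: "0 \<le> T" using T by simp
  note lc = le_num_rings_iff[OF T0 fin, of T]
  have "tm i + \<delta> \<le> tm (Suc i)" if i: "i < num_rings T" for i
  proof -
    have r: "mark i \<in> rings N \<omega> {0<..T}" using i lc[of "Suc i"] T tm_pos[of i] by (simp add: mark_rings)
    show ?thesis
    proof (cases i)
      case 0
      have "mark i \<notin> rings N \<omega> {0<..\<delta>}" using first by simp
      then have "\<delta> < tm (Suc i)" using tm_pos[of i] by (simp add: mark_rings)
      then show ?thesis using 0 tm_0 by simp
    next
      case (Suc j)
      have r': "mark j \<in> rings N \<omega> {0<..T}" using i Suc lc[of "Suc j"] T tm_pos[of j] by (simp add: mark_rings)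
      have "mark i \<noteq> mark j"
      proof
        assume "mark i = mark j"
        then have "i = j" by (rule injD[OF mark_inj])
        then show False using Suc by simp
      qed
      then have "\<delta> \<le> \<bar>tm (Suc i) - tm (Suc j)\<bar>" unfolding tm_Suc by (rule sep[OF r r'])
      then show ?thesis using incseqD[OF tm_mono, of i "Suc i"] Suc by simp
    qed
  qed
  moreover have "tm (num_rings T) + \<delta> \<le> T"
  proof (cases "num_rings T")
    case 0
    then show ?thesis using tm_0 d by simp
  next
    case (Suc j)
    have "tm (Suc j) \<le> T" using lc[of "Suc j"] Suc T by simp
    moreover have "mark j \<notin> rings N \<omega> {T-\<delta><..T}" using last by simp
    ultimately show ?thesis using Suc by (simp add: mark_rings)
  qed
  ultimately show ?thesis unfolding jump_skeleton_def using tm_0 by (auto simp: le_eq_less_or_eq)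
qed

end

subsection \<open>The collision path\<close>

text \<open>A step raises at most one collision counter. The evaluation points lie at most half a
  mesh outside the unit cube, hence in the cube on which \<open>B\<close> bounds the test
  functions.\<close>

lemma coll_pair_step:
  fixes \<phi> :: "'d::finite \<Rightarrow> bool \<Rightarrow> real^'d \<Rightarrow> real"
  assumes N: "0 < N" and n: "0 < n"
    and B: "\<And>l b z. z \<in> cbox (\<chi> i. -1) (\<chi> i. 2) \<Longrightarrow> \<bar>\<phi> l b z\<bar> \<le> B"
  shows "\<bar>coll_pair N n \<phi> (step N \<omega> s) - coll_pair N n \<phi> s\<bar>
          \<le> (1 / real N)^2 / ((1 / real N)^CARD('d) * n^2) * (2 * real CARD('d) * B)"
proof -
  define c where "c = (1 / real N)^2 / ((1 / real N)^CARD('d) * n^2)"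
  have c: "0 \<le> c" by (simp add: c_def)
  define z where "z x l b = pt N x + (if b then 1 / (2 * real N) else - 1 / (2 * real N)) *\<^sub>R axis l (1::real)"
    for x :: "'d \<Rightarrow> nat" and l :: 'd and b
  have zc: "z x l b \<in> cbox (\<chi> i. -1) (\<chi> i. 2)" if "x \<in> sites N" for x l b
  proof -
    have "-1 \<le> z x l b $ i \<and> z x l b $ i \<le> 2" for i
    proof -
      have "0 \<le> real (x i) / real N" "real (x i) / real N \<le> 1"
        using that N by (auto simp: sites_def divide_le_eq less_imp_le)
      moreover have "0 \<le> 1 / (2 * real N)" "1 / (2 * real N) \<le> 1" using N by (auto simp: divide_le_eq)
      moreover have "z x l b $ i \<in> {real (x i) / real N, real (x i) / real N + 1 / (2 * real N),
          real (x i) / real N - 1 / (2 * real N)}" by (auto simp: z_def pt_def axis_def)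
      ultimately show ?thesis by (smt (verit) empty_iff insert_iff)
    qed
    then show ?thesis by (simp add: mem_box_cart)
  qed
  have B0: "0 \<le> B"
  proof -
    have "(\<lambda>_. 0) \<in> (sites N :: ('d \<Rightarrow> nat) set)" using N by (simp add: sites_def)
    from order_trans[OF abs_ge_zero B[OF zc[OF this]]] show ?thesis .
  qed
  define e where "e = next_edge N \<omega> s"
  have summand: "\<bar>(real (Cc (step N \<omega> s) x y) - real (Cc s x y)) * \<phi> l b (z x l b)\<bar> \<le> (if (x, y) = e then B else 0)"
    if "x \<in> sites N" for x y l b
  proof -
    have "\<bar>real (Cc (step N \<omega> s) x y) - real (Cc s x y)\<bar> \<le> (if (x, y) = e then 1 else 0)"
      using step_Cc(1)[of s x y N \<omega>] step_Cc(2)[of N \<omega> s x y] by (auto simp: e_def split: if_splits)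
    then have "\<bar>(real (Cc (step N \<omega> s) x y) - real (Cc s x y)) * \<phi> l b (z x l b)\<bar> \<le> (if (x, y) = e then 1 else 0) * B"
      unfolding abs_mult using B[OF zc[OF that]] by (intro mult_mono) auto
    then show ?thesis by (simp split: if_splits)
  qed
  have "coll_pair N n \<phi> (step N \<omega> s) - coll_pair N n \<phi> s =
      c * (\<Sum>x\<in>sites N. \<Sum>l\<in>UNIV. \<Sum>b\<in>UNIV.
        (real (Cc (step N \<omega> s) x (shift N x l b)) - real (Cc s x (shift N x l b))) * \<phi> l b (z x l b))"
    unfolding coll_pair_def c_def[symmetric] z_def[symmetric]
    by (simp add: right_diff_distrib[symmetric] left_diff_distrib sum_subtractf)
  \<comment> \<open>Keeping only the first component of the edge counts all
    \<open>2 * CARD('d)\<close> directions at that site. This stays valid when several directions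
    lead to the same neighbour, as happens for \<open>N \<le> 2\<close>.\<close>
  also have "\<bar>\<dots>\<bar> \<le> c * (\<Sum>x\<in>sites N. \<Sum>l\<in>(UNIV::'d set). \<Sum>b\<in>(UNIV::bool set). if x = fst e then B else 0)"
    unfolding abs_mult abs_of_nonneg[OF c]
  proof (intro mult_left_mono c order_trans[OF sum_abs] sum_mono)
    fix x :: "'d \<Rightarrow> nat" and l :: 'd and b :: bool assume x: "x \<in> sites N"
    have "(if (x, shift N x l b) = e then B else 0) \<le> (if x = fst e then B else 0)" using B0 by auto
    then show "\<bar>(real (Cc (step N \<omega> s) x (shift N x l b)) - real (Cc s x (shift N x l b))) * \<phi> l b (z x l b)\<bar>
        \<le> (if x = fst e then B else 0)" using summand[OF x, of "shift N x l b" l b] by linarith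
  qed
  also have "\<dots> = c * (2 * real CARD('d) * (\<Sum>x\<in>sites N. if x = fst e then B else 0))"
    by (simp add: sum_distrib_left ac_simps)
  also have "\<dots> \<le> c * (2 * real CARD('d) * B)"
    using c B0 by (intro mult_left_mono) (auto simp: sum.delta finite_sites)
  finally show ?thesis by (simp add: c_def)
qed

lemma lipschitz_seq:
  fixes v :: "nat \<Rightarrow> real"
  assumes "\<And>m. \<bar>v (Suc m) - v m\<bar> \<le> c" "a \<le> b"
  shows "\<bar>v b - v a\<bar> \<le> c * real (b - a)"
  using assms(2)
proof (induction rule: dec_induct)
  case (step m)
  then show ?case using assms(1)[of m] by (simp add: Suc_diff_le algebra_simps)
qed simp

lemma coll_path_step_fun:
  fixes \<phi> :: "'d::finite \<Rightarrow> bool \<Rightarrow> real^'d \<Rightarrow> real"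
  assumes N: "0 < N" and pos: "positive_clocks N \<omega>" and T: "0 < T" and fin: "finite (rings N \<omega> {0<..T})"
  shows "coll_path T N n rho0 \<phi> \<omega> =
    step_fun (num_rings N n rho0 \<omega> T)
      (\<lambda>i. if i \<le> num_rings N n rho0 \<omega> T then clock (traj N n rho0 \<omega> i) else T)
      (\<lambda>i. coll_pair N n \<phi> (traj N n rho0 \<omega> i))"
proof
  fix x :: real
  let ?tm = "\<lambda>i. clock (traj N n rho0 \<omega> i)" and ?c = "num_rings N n rho0 \<omega>"
  define t where "t = max 0 (min x T)"
  have t: "t \<in> {0..T}" using T by (auto simp: t_def)
  have T0: "0 \<le> T" using T by simp
  note lc = le_num_rings_iff[OF N pos T0 fin]
  \<comment> \<open>Event times of index at least one are positive and at most \<open>T\<close>, so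
    comparing them with \<open>x\<close> or with the clamped time \<open>t\<close> is the
    same.\<close>
  have "{i \<in> {1..?c T}. (if i \<le> ?c T then ?tm i else T) \<le> x} = {i \<in> {1..?c T}. ?tm i \<le> t}"
  proof (intro Collect_cong conj_cong refl)
    fix i assume i: "i \<in> {1..?c T}"
    have "0 < ?tm i" using tm_pos[OF N pos, of n rho0 "i - 1"] i by simp
    moreover have "?tm i \<le> T" using lc[of T i] i T by simp
    ultimately show "((if i \<le> ?c T then ?tm i else T) \<le> x) = (?tm i \<le> t)" using i by (auto simp: t_def)
  qed
  then have "card {i \<in> {1..?c T}. (if i \<le> ?c T then ?tm i else T) \<le> x} = ?c t"
    using num_rings_eq_card[OF N pos T0 fin t, of n rho0] by simp
  then show "coll_path T N n rho0 \<phi> \<omega> x =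
    step_fun (?c T) (\<lambda>i. if i \<le> ?c T then ?tm i else T) (\<lambda>i. coll_pair N n \<phi> (traj N n rho0 \<omega> i)) x"
    unfolding coll_path_def step_fun_def state_at_num_rings[OF N pos] t_def[symmetric] by simp
qed

text \<open>Every processed ring is charged with a full jump, whether or not a collision occurs. The
  bound does not see the occupation variables, so it is uniform over initial configurations.\<close>

lemma coll_path_increment:
  fixes \<phi> :: "'d::finite \<Rightarrow> bool \<Rightarrow> real^'d \<Rightarrow> real"
  assumes N: "0 < N" and n: "0 < n" and pos: "positive_clocks N \<omega>" and T: "0 < T"
    and fin: "finite (rings N \<omega> {0<..T})"
    and B: "\<And>l b z. z \<in> cbox (\<chi> i. -1) (\<chi> i. 2) \<Longrightarrow> \<bar>\<phi> l b z\<bar> \<le> B"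
    and st: "s \<in> {0..T}" "t \<in> {0..T}" "s \<le> t"
  shows "\<exists>F. finite F \<and> F \<subseteq> rings N \<omega> {s<..t} \<and>
    \<bar>coll_path T N n rho0 \<phi> \<omega> t - coll_path T N n rho0 \<phi> \<omega> s\<bar>
      \<le> (1 / real N)^2 / ((1 / real N)^CARD('d) * n^2) * (2 * real CARD('d) * B) * real (card F)"
proof -
  have T0: "0 \<le> T" using T by simp
  let ?c = "num_rings N n rho0 \<omega>"
  obtain F where F: "finite F" "F \<subseteq> rings N \<omega> {s<..t}" "card F = ?c t - ?c s"
    using num_rings_increment[OF N pos T0 fin st, of n rho0] by blast
  have eq: "coll_path T N n rho0 \<phi> \<omega> u = coll_pair N n \<phi> (traj N n rho0 \<omega> (?c u))" if "u \<in> {0..T}" for u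
    using that unfolding coll_path_def state_at_num_rings[OF N pos] by simp
  have incr: "\<bar>coll_pair N n \<phi> (traj N n rho0 \<omega> (Suc m)) - coll_pair N n \<phi> (traj N n rho0 \<omega> m)\<bar>
     \<le> (1 / real N)^2 / ((1 / real N)^CARD('d) * n^2) * (2 * real CARD('d) * B)" for m
    unfolding st_Suc[OF N pos] by (rule coll_pair_step[OF N n B])
  from lipschitz_seq[of "\<lambda>m. coll_pair N n \<phi> (traj N n rho0 \<omega> m)", OF incr num_rings_mono[OF N pos T0 fin st, of n rho0]]
  show ?thesis using F eq st by (intro exI[of _ F]) auto
qed

lemma coll_path_0:
  assumes "0 < N" "positive_clocks N \<omega>" "0 < T" "finite (rings N \<omega> {0<..T})"
  shows "coll_path T N n rho0 \<phi> \<omega> 0 = 0"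
proof -
  have "num_rings N n rho0 \<omega> 0 = 0"
  proof (rule ccontr)
    assume "num_rings N n rho0 \<omega> 0 \<noteq> 0"
    then have "Suc 0 \<le> num_rings N n rho0 \<omega> 0" by simp
    then show False
      using le_num_rings_iff[OF assms(1,2) less_imp_le[OF assms(3)] assms(4), where t=0 and m="Suc 0"]
        tm_pos[OF assms(1,2), of n rho0 0] assms(3) by fastforce
  qed
  then show ?thesis using assms(3)
    by (simp add: coll_path_def state_at_num_rings[OF assms(1,2)] traj_def coll_pair_def init_state_def)
qed

section \<open>Counting exponential clocks\<close>

text \<open>Used in two ways: to separate different clocks, and to separate an initial stretch of
  the waiting times of one clock from those that follow.\<close>

lemma (in prob_space) nn_integral_prod_blocks:
  fixes X :: "'i \<Rightarrow> 'a \<Rightarrow> real" and F :: "'b \<Rightarrow> ('i \<Rightarrow> real) \<Rightarrow> ennreal"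
  assumes X: "indep_vars (\<lambda>_. borel) X I" and A: "finite A"
    and K: "\<And>a. a \<in> A \<Longrightarrow> K a \<subseteq> I" "disjoint_family_on K A"
    and F: "\<And>a. a \<in> A \<Longrightarrow> F a \<in> borel_measurable (PiM (K a) (\<lambda>_. borel))"
  shows "(\<integral>\<^sup>+\<omega>. (\<Prod>a\<in>A. F a (restrict (\<lambda>i. X i \<omega>) (K a))) \<partial>M) =
         (\<Prod>a\<in>A. \<integral>\<^sup>+\<omega>. F a (restrict (\<lambda>i. X i \<omega>) (K a)) \<partial>M)"
proof -
  have "indep_vars (\<lambda>a. PiM (K a) (\<lambda>_. borel)) (\<lambda>a \<omega>. restrict (\<lambda>i. X i \<omega>) (K a)) A"
    by (rule indep_vars_restrict[OF X K])
  then have "indep_vars (\<lambda>_. borel) (\<lambda>a \<omega>. F a (restrict (\<lambda>i. X i \<omega>) (K a))) A"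
    using F by (rule indep_vars_compose2)
  then show ?thesis using A by (intro indep_vars_nn_integral) auto
qed

text \<open>Dominates \<open>(1/h) ^ n\<close> if the renewal process with waiting times \<open>w\<close> has \<open>n\<close> points in the window
  \<open>(u, u + h]\<close>: then some point \<open>j\<close> in the window is followed by \<open>n - 1\<close> waiting times of total length at
  most \<open>h\<close>. The two indicators depend on different waiting times, so the expectation factorises.\<close>

definition burst_weight :: "real \<Rightarrow> real \<Rightarrow> (nat \<Rightarrow> real) \<Rightarrow> ennreal" where
  "burst_weight u h w = 1 + (\<Sum>k. ennreal ((1/h)^Suc k) *
     (\<Sum>j. indicator {u<..u+h} (\<Sum>i\<le>j. w i) * indicator {..h} (\<Sum>i\<in>{j<..j+k}. w i)))"

text \<open>Take the least index \<open>j\<close> in \<open>F\<close>. The set has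
  \<open>k + 1\<close> elements, so its largest index is at least \<open>j + k\<close> even if
  \<open>F\<close> has gaps; the partial sums at the least and the largest index lie in the window,
  so the \<open>k\<close> waiting times after \<open>j\<close> sum to at most
  \<open>h\<close>.\<close>

lemma burst_weight_ge:
  assumes h: "0 < h" and w: "\<And>i. 0 < w i" and F: "finite F" "\<And>j. j \<in> F \<Longrightarrow> (\<Sum>i\<le>j. w i) \<in> {u<..u+h}"
  shows "ennreal ((1/h)^card F) \<le> burst_weight u h w"
proof (cases "F = {}")
  case True
  then show ?thesis by (simp add: burst_weight_def)
next
  case False
  define j where "j = Min F"
  define k where "k = card F - 1"
  define f where "f k = ennreal ((1/h)^Suc k) *
     (\<Sum>j. indicator {u<..u+h} (\<Sum>i\<le>j. w i) * indicator {..h} (\<Sum>i\<in>{j<..j+k}. w i))" for k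
  have jF: "j \<in> F" using False F(1) by (simp add: j_def)
  have c: "card F = Suc k" using False F(1) by (simp add: k_def card_gt_0_iff)
  have "F \<subseteq> {j..Max F}" using F(1) by (auto simp: j_def)
  then have "card F \<le> card {j..Max F}" by (intro card_mono) auto
  then have jk: "j + k \<le> Max F" using c by simp
  have MF: "Max F \<in> F" using False F(1) by simp
  have mono: "(\<Sum>i\<le>a. w i) \<le> (\<Sum>i\<le>b. w i)" if "a \<le> b" for a b
    using that w by (intro sum_mono2) (auto intro: less_imp_le)
  have split: "(\<Sum>i\<le>j+k. w i) = (\<Sum>i\<le>j. w i) + (\<Sum>i\<in>{j<..j+k}. w i)"
    by (subst sum.union_disjoint[symmetric]) (auto intro: sum.cong)
  have "(\<Sum>i\<in>{j<..j+k}. w i) \<le> h"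
    using mono[OF jk] F(2)[OF MF] F(2)[OF jF] split by auto
  then have 1: "indicator {u<..u+h} (\<Sum>i\<le>j. w i) * indicator {..h} (\<Sum>i\<in>{j<..j+k}. w i) = (1::ennreal)"
    using F(2)[OF jF] by simp
  have le: "a i \<le> (\<Sum>i. a i)" for a :: "nat \<Rightarrow> ennreal" and i
    using sum_le_suminf[of a "{i}"] by simp
  have "ennreal ((1/h)^card F) = ennreal ((1/h)^Suc k) * 1" by (simp add: c)
  also have "\<dots> \<le> f k"
    unfolding f_def using le[of "\<lambda>j. indicator {u<..u+h} (\<Sum>i\<le>j. w i) * indicator {..h} (\<Sum>i\<in>{j<..j+k}. w i)" j]
    by (intro mult_left_mono) (auto simp: 1)
  also have "\<dots> \<le> (\<Sum>k. f k)" by (rule le)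
  also have "\<dots> \<le> burst_weight u h w" by (simp add: burst_weight_def f_def)
  finally show ?thesis .
qed

text \<open>The exponential series: the densities of all arrival times of a Poisson process add up
  to its constant intensity.\<close>

lemma suminf_erlang_density:
  assumes "0 < \<kappa>" "0 \<le> x"
  shows "(\<Sum>j. ennreal (erlang_density j \<kappa> x)) = ennreal \<kappa>"
proof (rule suminf_ennreal_eq)
  show "0 \<le> erlang_density j \<kappa> x" for j using assms by simp
  have "(\<lambda>j. (\<kappa> * x)^j /\<^sub>R fact j) sums exp (\<kappa> * x)" by (rule exp_converges)
  then have 1: "(\<lambda>j. \<kappa> * exp (- \<kappa> * x) * ((\<kappa> * x)^j /\<^sub>R fact j)) sums (\<kappa> * exp (- \<kappa> * x) * exp (\<kappa> * x))"
    by (rule sums_mult)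
  have 2: "\<kappa> * exp (- \<kappa> * x) * exp (\<kappa> * x) = \<kappa>" by (simp add: exp_minus)
  have 3: "\<kappa> * exp (- \<kappa> * x) * ((\<kappa> * x)^j /\<^sub>R fact j) = erlang_density j \<kappa> x" for j
    using assms by (simp add: erlang_density_def power_mult_distrib field_simps)
  show "(\<lambda>j. erlang_density j \<kappa> x) sums \<kappa>" using 1 unfolding 2 3 .
qed

section \<open>Exponential moments of one Poisson clock\<close>

context prob_space
begin

context
  fixes X :: "nat \<Rightarrow> 'a \<Rightarrow> real" and \<kappa> :: real
  assumes \<kappa>: "0 < \<kappa>" and ind: "indep_vars (\<lambda>_. borel) X UNIV"
    and expo: "\<And>i. distributed M lborel (X i) (exponential_density \<kappa>)"
begin

lemma X_measurable [measurable]: "X i \<in> borel_measurable M"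
  using distributed_measurable[OF expo[of i]] by simp

text \<open>The partial sums have Erlang densities, whose sum over \<open>j\<close> is the constant
  \<kappa> on the positive half-line. The result is the mean number of arrivals in the
  window.\<close>

lemma renewal_measure:
  assumes "0 \<le> u" "0 \<le> h"
  shows "(\<Sum>j. emeasure M {\<omega> \<in> space M. (\<Sum>i\<le>j. X i \<omega>) \<in> {u<..u+h}}) = ennreal (\<kappa> * h)"
proof -
  have eq: "emeasure M {\<omega> \<in> space M. (\<Sum>i\<le>j. X i \<omega>) \<in> {u<..u+h}} =
      (\<integral>\<^sup>+x. ennreal (erlang_density j \<kappa> x) * indicator {u<..u+h} x \<partial>lborel)" for j
  proof -
    have "distributed M lborel (\<lambda>\<omega>. \<Sum>i\<in>{..j}. X i \<omega>) (erlang_density (card {..j} - 1) \<kappa>)"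
      using \<kappa> expo indep_vars_subset[OF ind, of "{..j}"] by (intro exponential_distributed_sum) auto
    then have "emeasure M ((\<lambda>\<omega>. \<Sum>i\<le>j. X i \<omega>) -` {u<..u+h} \<inter> space M) =
      (\<integral>\<^sup>+x. ennreal (erlang_density j \<kappa> x) * indicator {u<..u+h} x \<partial>lborel)"
      by (subst distributed_emeasure) auto
    then show ?thesis by (simp add: vimage_def Int_def conj_commute)
  qed
  have "(\<Sum>j. emeasure M {\<omega> \<in> space M. (\<Sum>i\<le>j. X i \<omega>) \<in> {u<..u+h}}) =
      (\<integral>\<^sup>+x. (\<Sum>j. ennreal (erlang_density j \<kappa> x) * indicator {u<..u+h} x) \<partial>lborel)"
    unfolding eq by (rule nn_integral_suminf[symmetric]) measurable
  also have "\<dots> = (\<integral>\<^sup>+x. ennreal \<kappa> * indicator {u<..u+h} x \<partial>lborel)"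
    using suminf_erlang_density[OF \<kappa>] assms
    by (intro nn_integral_cong) (auto simp: indicator_def)
  also have "\<dots> = ennreal (\<kappa> * h)"
    using \<kappa> assms by (subst nn_integral_cmult_indicator) (auto simp: ennreal_mult)
  finally show ?thesis .
qed

text \<open>Exponential tilting: multiplying the density of rate \<kappa> by
  \<open>exp (- s * x)\<close> gives, up to the factor \<open>\<kappa> / (\<kappa> + s)\<close>, the
  density of rate \<open>\<kappa> + s\<close>.\<close>

lemma laplace_exponential:
  assumes s: "0 \<le> s"
  shows "(\<integral>\<^sup>+\<omega>. ennreal (exp (- s * X i \<omega>)) \<partial>M) = ennreal (\<kappa> / (\<kappa> + s))"
proof -
  have "(\<integral>\<^sup>+\<omega>. ennreal (exp (- s * X i \<omega>)) \<partial>M) =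
      (\<integral>\<^sup>+x. ennreal (exponential_density \<kappa> x) * ennreal (exp (- s * x)) \<partial>lborel)"
    by (subst distributed_nn_integral[OF expo, symmetric]) auto
  also have "\<dots> = (\<integral>\<^sup>+x. ennreal (\<kappa> / (\<kappa> + s)) * ennreal (exponential_density (\<kappa> + s) x) \<partial>lborel)"
  proof (rule nn_integral_cong)
    fix x :: real
    have "exp (- x * \<kappa>) * exp (- s * x) = exp (- x * (\<kappa> + s))"
      by (simp add: exp_add[symmetric] algebra_simps)
    then have "exponential_density \<kappa> x * exp (- s * x) = \<kappa> / (\<kappa> + s) * exponential_density (\<kappa> + s) x"
      using \<kappa> s by (simp add: exponential_density_def)
    then show "ennreal (exponential_density \<kappa> x) * ennreal (exp (- s * x)) =
        ennreal (\<kappa> / (\<kappa> + s)) * ennreal (exponential_density (\<kappa> + s) x)"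
      using \<kappa> s by (simp add: ennreal_mult[symmetric])
  qed
  also have "\<dots> = ennreal (\<kappa> / (\<kappa> + s)) * emeasure (density lborel (exponential_density (\<kappa> + s))) UNIV"
    by (subst nn_integral_cmult) (auto simp: emeasure_density)
  also have "emeasure (density lborel (exponential_density (\<kappa> + s))) UNIV = 1"
    using prob_space.emeasure_space_1[OF prob_space_exponential_density[of "\<kappa> + s"]] \<kappa> s by simp
  finally show ?thesis by simp
qed

text \<open>Chernoff's bound for the short sum, whose waiting times come after index
  \<open>j\<close> and are independent of the arrival at \<open>j\<close>. The arrival probability
  stays as a factor because it is going to be summed over \<open>j\<close>.\<close>

lemma burst_prob:
  assumes z: "0 < z" and h: "0 \<le> h"
  shows "(\<integral>\<^sup>+\<omega>. indicator {u<..u+h} (\<Sum>i\<le>j. X i \<omega>) * indicator {..h} (\<Sum>i\<in>{j<..j+k}. X i \<omega>) \<partial>M)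
    \<le> emeasure M {\<omega> \<in> space M. (\<Sum>i\<le>j. X i \<omega>) \<in> {u<..u+h}} * ennreal (exp (2 * \<kappa> * z * h) * (1 / (2 * z))^k)"
proof -
  \<comment> \<open>This tilt makes each Laplace factor \<open>\<kappa> / (\<kappa> + s)\<close> at
    most \<open>1 / (2 * z)\<close>, so a weight \<open>z\<close> per waiting time still leaves a
    factor \<open>1/2\<close>. The price \<open>exp (s * h)\<close> is harmless for
    \<open>z = 1/h\<close>.\<close>
  define s where "s = 2 * \<kappa> * z"
  have s: "0 < s" using \<kappa> z by (simp add: s_def)
  define K where "K b = (if b then {..j} else {j<..j+k})" for b
  define F :: "bool \<Rightarrow> (nat \<Rightarrow> real) \<Rightarrow> ennreal" where
    "F b w = (if b then indicator {u<..u+h} (\<Sum>i\<le>j. w i) else (\<Prod>i\<in>{j<..j+k}. ennreal (exp (- s * w i))))" for b w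
  have Fm: "F b \<in> borel_measurable (PiM (K b) (\<lambda>_. borel))" for b
  proof (cases b)
    case True
    have "(\<lambda>w. \<Sum>i\<le>j. w i) \<in> borel_measurable (PiM {..j} (\<lambda>_. borel :: real measure))" by measurable
    then have "(\<lambda>w. indicator {u<..u+h} (\<Sum>i\<le>j. w i) :: ennreal) \<in> borel_measurable (PiM {..j} (\<lambda>_. borel))"
      by measurable
    then show ?thesis using True by (simp add: F_def[abs_def] K_def)
  next
    case False
    have "(\<lambda>w. \<Prod>i\<in>{j<..j+k}. ennreal (exp (- s * w i))) \<in> borel_measurable (PiM {j<..j+k} (\<lambda>_. borel))" by measurable
    then show ?thesis using False by (simp add: F_def[abs_def] K_def)
  qed
  have FT: "F True (restrict (\<lambda>i. X i \<omega>) (K True)) = indicator {u<..u+h} (\<Sum>i\<le>j. X i \<omega>)" for \<omega>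
    by (simp add: F_def K_def)
  have FF: "F False (restrict (\<lambda>i. X i \<omega>) (K False)) = (\<Prod>i\<in>{j<..j+k}. ennreal (exp (- s * X i \<omega>)))" for \<omega>
    by (simp add: F_def K_def)
  have "indicator {..h} (\<Sum>i\<in>{j<..j+k}. X i \<omega>) \<le> ennreal (exp (s * h)) * (\<Prod>i\<in>{j<..j+k}. ennreal (exp (- s * X i \<omega>)))" for \<omega>
  proof (cases "(\<Sum>i\<in>{j<..j+k}. X i \<omega>) \<le> h")
    case True
    then have "s * (\<Sum>i\<in>{j<..j+k}. X i \<omega>) \<le> s * h" using s by (intro mult_left_mono) auto
    then have "1 \<le> exp (s * h) * exp (\<Sum>i\<in>{j<..j+k}. - s * X i \<omega>)"
      by (simp add: exp_add[symmetric] sum_negf sum_distrib_left)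
    then show ?thesis using True
      by (simp add: prod_ennreal exp_sum ennreal_mult[symmetric] prod_nonneg ennreal_1[symmetric] del: ennreal_1)
  qed simp
  then have "(\<integral>\<^sup>+\<omega>. indicator {u<..u+h} (\<Sum>i\<le>j. X i \<omega>) * indicator {..h} (\<Sum>i\<in>{j<..j+k}. X i \<omega>) \<partial>M)
    \<le> (\<integral>\<^sup>+\<omega>. ennreal (exp (s * h)) * (\<Prod>b\<in>UNIV. F b (restrict (\<lambda>i. X i \<omega>) (K b))) \<partial>M)"
    by (intro nn_integral_mono) (auto simp: UNIV_bool FT FF mult_ac indicator_def intro!: mult_left_mono)
  also have "\<dots> = ennreal (exp (s * h)) * (\<integral>\<^sup>+\<omega>. (\<Prod>b\<in>UNIV. F b (restrict (\<lambda>i. X i \<omega>) (K b))) \<partial>M)"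
    by (intro nn_integral_cmult) (simp add: UNIV_bool FT FF)
  also have "(\<integral>\<^sup>+\<omega>. (\<Prod>b\<in>UNIV. F b (restrict (\<lambda>i. X i \<omega>) (K b))) \<partial>M) =
      (\<Prod>b\<in>UNIV. \<integral>\<^sup>+\<omega>. F b (restrict (\<lambda>i. X i \<omega>) (K b)) \<partial>M)"
    by (rule nn_integral_prod_blocks[OF ind _ _ _ Fm]) (auto simp: K_def disjoint_family_on_def)
  also have "\<dots> = emeasure M {\<omega> \<in> space M. (\<Sum>i\<le>j. X i \<omega>) \<in> {u<..u+h}} *
      (\<integral>\<^sup>+\<omega>. (\<Prod>i\<in>{j<..j+k}. ennreal (exp (- s * X i \<omega>))) \<partial>M)"
  proof -
    have "(\<integral>\<^sup>+\<omega>. indicator {u<..u+h} (\<Sum>i\<le>j. X i \<omega>) \<partial>M) =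
       (\<integral>\<^sup>+\<omega>. indicator {\<omega> \<in> space M. (\<Sum>i\<le>j. X i \<omega>) \<in> {u<..u+h}} \<omega> \<partial>M)"
      by (intro nn_integral_cong) (auto simp: indicator_def)
    also have "\<dots> = emeasure M {\<omega> \<in> space M. (\<Sum>i\<le>j. X i \<omega>) \<in> {u<..u+h}}"
      by (intro nn_integral_indicator) measurable
    finally show ?thesis by (simp add: UNIV_bool FT FF mult.commute)
  qed
  also have "(\<integral>\<^sup>+\<omega>. (\<Prod>i\<in>{j<..j+k}. ennreal (exp (- s * X i \<omega>))) \<partial>M) =
      (\<Prod>i\<in>{j<..j+k}. \<integral>\<^sup>+\<omega>. ennreal (exp (- s * X i \<omega>)) \<partial>M)"
    using indep_vars_compose2[OF indep_vars_subset[OF ind], of "{j<..j+k}" "\<lambda>_ x. ennreal (exp (- s * x))" "\<lambda>_. borel"]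
    by (intro indep_vars_nn_integral) auto
  also have "\<dots> = ennreal ((\<kappa> / (\<kappa> + s))^k)"
    unfolding laplace_exponential[OF less_imp_le[OF s]] using s \<kappa> by (simp add: ennreal_power)
  also have "ennreal (exp (s * h)) * (emeasure M {\<omega> \<in> space M. (\<Sum>i\<le>j. X i \<omega>) \<in> {u<..u+h}} * ennreal ((\<kappa> / (\<kappa> + s))^k))
     = emeasure M {\<omega> \<in> space M. (\<Sum>i\<le>j. X i \<omega>) \<in> {u<..u+h}} * ennreal (exp (s * h) * (\<kappa> / (\<kappa> + s))^k)"
    using \<kappa> s by (simp add: ennreal_mult mult_ac)
  also have "\<dots> \<le> emeasure M {\<omega> \<in> space M. (\<Sum>i\<le>j. X i \<omega>) \<in> {u<..u+h}} * ennreal (exp (2 * \<kappa> * z * h) * (1 / (2 * z))^k)"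
  proof (intro mult_left_mono ennreal_leI)
    have "\<kappa> / (\<kappa> + s) \<le> 1 / (2 * z)" using \<kappa> z frac_le[of \<kappa> \<kappa> s "\<kappa> + s"] s by (simp add: s_def)
    then show "exp (s * h) * (\<kappa> / (\<kappa> + s))^k \<le> exp (2 * \<kappa> * z * h) * (1 / (2 * z))^k"
      using \<kappa> s by (intro mult_mono power_mono) (auto simp: s_def)
  qed auto
  finally show ?thesis .
qed

text \<open>Taking \<open>z = 1/h\<close> makes the powers of \<open>h\<close> cancel:
  \<open>(1/h)^(k+1)\<close> against \<open>\<kappa> * h\<close> from the renewal measure and
  \<open>(h/2)^k\<close> from the waiting times. A geometric series remains, and the bound is free
  of \<open>h\<close>, so it serves all scales.\<close>

lemma burst_weight_integral:
  assumes u: "0 \<le> u" and h: "0 < h"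
  shows "(\<integral>\<^sup>+\<omega>. burst_weight u h (\<lambda>i. X i \<omega>) \<partial>M) \<le> ennreal (exp (4 * \<kappa>))"
proof -
  define P where "P j = emeasure M {\<omega> \<in> space M. (\<Sum>i\<le>j. X i \<omega>) \<in> {u<..u+h}}" for j
  have "(\<integral>\<^sup>+\<omega>. burst_weight u h (\<lambda>i. X i \<omega>) \<partial>M) = 1 + (\<Sum>k. ennreal ((1/h)^Suc k) *
      (\<Sum>j. \<integral>\<^sup>+\<omega>. indicator {u<..u+h} (\<Sum>i\<le>j. X i \<omega>) * indicator {..h} (\<Sum>i\<in>{j<..j+k}. X i \<omega>) \<partial>M))"
    unfolding burst_weight_def
    by (subst nn_integral_add) (auto simp: nn_integral_suminf nn_integral_cmult emeasure_space_1)
  also have "\<dots> \<le> 1 + (\<Sum>k. ennreal ((1/h)^Suc k) * (\<Sum>j. P j * ennreal (exp (2 * \<kappa>) * (h / 2)^k)))"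
  proof (intro add_left_mono suminf_le mult_left_mono)
    fix k j
    show "(\<integral>\<^sup>+\<omega>. indicator {u<..u+h} (\<Sum>i\<le>j. X i \<omega>) * indicator {..h} (\<Sum>i\<in>{j<..j+k}. X i \<omega>) \<partial>M)
      \<le> P j * ennreal (exp (2 * \<kappa>) * (h / 2)^k)"
      using burst_prob[of "1/h" h u j k] h by (simp add: P_def)
  qed auto
  also have "\<dots> = 1 + (\<Sum>k. ennreal ((1/h)^Suc k) * (ennreal (\<kappa> * h) * ennreal (exp (2 * \<kappa>) * (h / 2)^k)))"
    using renewal_measure[of u h] u h by (simp add: P_def)
  also have "\<dots> = 1 + (\<Sum>k. ennreal (\<kappa> * exp (2 * \<kappa>) * (1/2)^k))"
  proof -
    have "(1/h)^Suc k * ((\<kappa> * h) * (exp (2 * \<kappa>) * (h / 2)^k)) = \<kappa> * exp (2 * \<kappa>) * (1/2)^k" for k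
      using h by (simp add: power_divide)
    moreover have "ennreal ((1/h)^Suc k) * (ennreal (\<kappa> * h) * ennreal (exp (2 * \<kappa>) * (h / 2)^k)) =
        ennreal ((1/h)^Suc k * ((\<kappa> * h) * (exp (2 * \<kappa>) * (h / 2)^k)))" for k
      using h \<kappa> by (simp add: ennreal_mult[symmetric] del: power_Suc)
    ultimately show ?thesis by (simp only:)
  qed
  also have "(\<Sum>k. ennreal (\<kappa> * exp (2 * \<kappa>) * (1/2)^k)) = ennreal (\<kappa> * exp (2 * \<kappa>) * 2)"
  proof (rule suminf_ennreal_eq)
    show "0 \<le> \<kappa> * exp (2 * \<kappa>) * (1/2)^k" for k using \<kappa> by simp
    have "(\<lambda>k. (1/2 :: real)^k) sums (1 / (1 - 1/2))" by (rule geometric_sums) simp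
    then show "(\<lambda>k. \<kappa> * exp (2 * \<kappa>) * (1/2)^k) sums (\<kappa> * exp (2 * \<kappa>) * 2)" by (intro sums_mult) simp
  qed
  also have "1 + ennreal (\<kappa> * exp (2 * \<kappa>) * 2) = ennreal (1 + \<kappa> * exp (2 * \<kappa>) * 2)"
    using \<kappa> by (subst ennreal_plus) auto
  also have "\<dots> \<le> ennreal (exp (4 * \<kappa>))"
  proof (rule ennreal_leI)
    have "1 + \<kappa> * exp (2 * \<kappa>) * 2 \<le> exp (2 * \<kappa>) * (1 + 2 * \<kappa>)" using \<kappa> by (simp add: algebra_simps)
    also have "\<dots> \<le> exp (2 * \<kappa>) * exp (2 * \<kappa>)"
      using exp_ge_add_one_self[of "2 * \<kappa>"] by (intro mult_left_mono) auto
    also have "\<dots> = exp (4 * \<kappa>)" by (simp add: exp_add[symmetric])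
    finally show "1 + \<kappa> * exp (2 * \<kappa>) * 2 \<le> exp (4 * \<kappa>)" .
  qed
  finally show ?thesis .
qed

end

end

section \<open>The probability space of the graphical construction\<close>

lemma sets_omega_comp [measurable_cong]: "sets (omega_comp N i) = sets borel"
  by (cases i) (auto simp: omega_comp_def)

lemma space_omega_comp: "space (omega_comp N i) = UNIV"
  by (cases i) (auto simp: omega_comp_def)

lemma prob_space_omega_comp:
  assumes "0 < N" shows "prob_space (omega_comp N i)"
proof (cases i)
  case (Init x)
  then show ?thesis by (auto simp: omega_comp_def intro!: prob_space_uniform_measure)
next
  case (Clock x y j)
  then show ?thesis using assms by (auto simp: omega_comp_def intro!: prob_space_exponential_density)
qed

lemma product_prob_space_omega:
  assumes "0 < N" shows "product_prob_space (omega_comp N)"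
  using prob_space_omega_comp[OF assms] by (rule product_prob_spaceI)

lemma prob_space_prob_N:
  assumes "0 < N" shows "prob_space (prob_N N)"
  unfolding prob_N_def using prob_space_omega_comp[OF assms] by (intro prob_space_PiM)

lemma space_prob_N: "space (prob_N N) = UNIV"
  by (simp add: prob_N_def space_PiM space_omega_comp PiE_UNIV_domain)

lemma coordinate_measurable [measurable]: "(\<lambda>\<omega>. \<omega> i) \<in> borel_measurable (prob_N N)"
proof -
  have "(\<lambda>\<omega>. \<omega> i) \<in> measurable (prob_N N) (omega_comp N i)"
    unfolding prob_N_def by (intro measurable_component_singleton) auto
  then show ?thesis by (simp cong: measurable_cong_sets add: measurable_cong_sets[OF refl sets_omega_comp])
qed

lemma distr_coordinate:
  assumes "0 < N" shows "distr (prob_N N) (omega_comp N i) (\<lambda>\<omega>. \<omega> i) = omega_comp N i"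
  unfolding prob_N_def by (rule product_prob_space.PiM_component[OF product_prob_space_omega[OF assms]]) simp

lemma indep_coordinates:
  assumes "0 < N"
  shows "prob_space.indep_vars (prob_N N) (\<lambda>_. borel) (\<lambda>i \<omega>. \<omega> i) UNIV"
proof -
  interpret P: prob_space "prob_N N" by (rule prob_space_prob_N[OF assms])
  have m: "(\<lambda>\<omega>. \<omega> i) \<in> measurable (prob_N N) (omega_comp N i)" for i
    unfolding prob_N_def by (intro measurable_component_singleton) auto
  have "P.indep_vars (omega_comp N) (\<lambda>i \<omega>. \<omega> i) UNIV"
  proof (subst P.indep_vars_iff_distr_eq_PiM)
    have "distr (prob_N N) (PiM UNIV (omega_comp N)) (\<lambda>x. \<lambda>i\<in>UNIV. x i) = prob_N N"
      by (simp add: prob_N_def restrict_UNIV)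
    also have "\<dots> = PiM UNIV (\<lambda>i. distr (prob_N N) (omega_comp N i) (\<lambda>x. x i))"
      by (simp only: distr_coordinate[OF assms]) (simp only: prob_N_def)
    finally show "distr (prob_N N) (PiM UNIV (omega_comp N)) (\<lambda>x. \<lambda>i\<in>UNIV. x i) =
      PiM UNIV (\<lambda>i. distr (prob_N N) (omega_comp N i) (\<lambda>x. x i))" .
  qed (auto simp: m)
  then show ?thesis
    using P.indep_vars_compose2[of "omega_comp N" "\<lambda>i \<omega>. \<omega> i" UNIV "\<lambda>_ x. x" "\<lambda>_. borel"]
    by (simp add: measurable_cong_sets[OF sets_omega_comp refl])
qed

lemma clock_distributed:
  assumes "0 < N"
  shows "distributed (prob_N N) lborel (\<lambda>\<omega>. \<omega> (Clock x y j)) (exponential_density (real N ^ 2))"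
proof -
  have "distr (prob_N N) lborel (\<lambda>\<omega>. \<omega> (Clock x y j)) = distr (prob_N N) (omega_comp N (Clock x y j)) (\<lambda>\<omega>. \<omega> (Clock x y j))"
    by (intro distr_cong) (auto simp: sets_omega_comp)
  also have "\<dots> = density lborel (exponential_density (real N ^ 2))"
    by (simp add: distr_coordinate[OF assms]) (simp add: omega_comp_def)
  finally show ?thesis by (simp add: distributed_def)
qed

lemma clocks_indep:
  assumes "0 < N"
  shows "prob_space.indep_vars (prob_N N) (\<lambda>_. borel) (\<lambda>j \<omega>. \<omega> (Clock x y j)) UNIV"
proof -
  interpret P: prob_space "prob_N N" by (rule prob_space_prob_N[OF assms])
  have "P.indep_vars (\<lambda>j. PiM {Clock x y j} (\<lambda>_. borel)) (\<lambda>j \<omega>. restrict (\<lambda>i. \<omega> i) {Clock x y j}) UNIV"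
    by (rule P.indep_vars_restrict[OF indep_coordinates[OF assms]]) (auto simp: disjoint_family_on_def)
  then have "P.indep_vars (\<lambda>_. borel) (\<lambda>j \<omega>. restrict (\<lambda>i. \<omega> i) {Clock x y j} (Clock x y j)) UNIV"
    by (rule P.indep_vars_compose2) (auto intro: measurable_component_singleton)
  then show ?thesis by simp
qed

text \<open>An exponential variable is almost surely positive, and only countably many clock
  variables belong to edges.\<close>

lemma AE_positive_clocks:
  assumes "0 < N"
  shows "AE \<omega> in prob_N N. positive_clocks N (\<omega> :: 'd::finite rv_idx \<Rightarrow> real)"
proof -
  have 1: "AE \<omega> in prob_N N. 0 < \<omega> (Clock x y j)" for x y :: "'d \<Rightarrow> nat" and j
  proof -
    have "AE t in density lborel (exponential_density (real N ^ 2)). 0 < t"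
    proof (subst AE_density)
      have "AE t in lborel. t \<noteq> (0::real)" by (rule AE_lborel_singleton)
      then show "AE t in lborel. 0 < ennreal (exponential_density ((real N)\<^sup>2) t) \<longrightarrow> 0 < t"
        by eventually_elim (auto simp: exponential_density_def)
    qed auto
    moreover have "omega_comp N (Clock x y j) = density lborel (exponential_density (real N ^ 2))"
      by (simp add: omega_comp_def)
    ultimately have "AE t in omega_comp N (Clock x y j). 0 < t" by metis
    then show ?thesis
      unfolding prob_N_def
      by (rule product_prob_space.AE_component[OF product_prob_space_omega[OF assms], rotated]) simp
  qed
  have "AE \<omega> in prob_N N. \<forall>p\<in>(edges N :: (('d \<Rightarrow> nat) \<times> ('d \<Rightarrow> nat)) set) \<times> (UNIV :: nat set).
      0 < \<omega> (Clock (fst (fst p)) (snd (fst p)) (snd p))"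
    using 1 by (intro AE_ball_countable' ) (auto intro!: countable_SIGMA countable_finite finite_edges)
  then show ?thesis by eventually_elim (auto simp: positive_clocks_def)
qed

text \<open>Phrased with the product of the burst weights instead of the number of rings: it is
  plainly measurable and fits Markov's inequality, and for positive clocks and
  \<open>h \<le> 1\<close> it contains the event of at least \<open>c\<close> rings in the
  window.\<close>

definition burst_event :: "nat \<Rightarrow> real \<Rightarrow> real \<Rightarrow> real \<Rightarrow> ('d::finite rv_idx \<Rightarrow> real) set" where
  "burst_event N u h c = {\<omega>. ennreal ((1/h) powr c) \<le>
     (\<Prod>e\<in>edges N. burst_weight u h (\<lambda>i. \<omega> (Clock (fst e) (snd e) i)))}"

lemma burst_weight_measurable [measurable]:
  assumes "\<And>i. (\<lambda>\<omega>. f \<omega> i) \<in> borel_measurable M"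
  shows "(\<lambda>\<omega>. burst_weight u h (f \<omega>)) \<in> borel_measurable M"
  unfolding burst_weight_def using assms by measurable

lemma burst_event_sets: "burst_event N u h c \<in> sets (prob_N N)"
proof -
  have "{\<omega> \<in> space (prob_N N). ennreal ((1/h) powr c) \<le>
     (\<Prod>e\<in>edges N. burst_weight u h (\<lambda>i. \<omega> (Clock (fst e) (snd e) i)))} \<in> sets (prob_N N)"
    by measurable
  then show ?thesis by (simp add: burst_event_def space_prob_N)
qed

text \<open>Markov's inequality and independence of the clocks: every edge contributes a factor
  \<open>exp (4 * N^2)\<close>, which is free of \<open>h\<close>.\<close>

lemma burst_event_prob:
  assumes N: "0 < N" and u: "0 \<le> u" and h: "0 < h"
  shows "measure (prob_N N) (burst_event N u h c :: ('d::finite rv_idx \<Rightarrow> real) set)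
    \<le> h powr c * exp (4 * real N ^ 2 * real (card (edges N :: (('d \<Rightarrow> nat) \<times> ('d \<Rightarrow> nat)) set)))"
proof -
  interpret P: prob_space "prob_N N :: ('d rv_idx \<Rightarrow> real) measure" by (rule prob_space_prob_N[OF N])
  let ?E = "edges N :: (('d \<Rightarrow> nat) \<times> ('d \<Rightarrow> nat)) set"
  let ?W = "\<lambda>e (\<omega> :: 'd rv_idx \<Rightarrow> real). burst_weight u h (\<lambda>i. \<omega> (Clock (fst e) (snd e) i))"
  have z: "0 < (1/h) powr c" using h by simp
  define K :: "('d \<Rightarrow> nat) \<times> ('d \<Rightarrow> nat) \<Rightarrow> 'd rv_idx set" where "K e = range (Clock (fst e) (snd e))" for e
  have "(\<integral>\<^sup>+\<omega>. (\<Prod>e\<in>?E. ?W e \<omega>) \<partial>prob_N N) = (\<integral>\<^sup>+\<omega>. (\<Prod>e\<in>?E. ?W e (restrict (\<lambda>i. \<omega> i) (K e))) \<partial>prob_N N)"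
    by (simp add: K_def)
  also have "\<dots> = (\<Prod>e\<in>?E. \<integral>\<^sup>+\<omega>. ?W e (restrict (\<lambda>i. \<omega> i) (K e)) \<partial>prob_N N)"
  proof (rule P.nn_integral_prod_blocks[OF indep_coordinates[OF N]])
    show "finite ?E" by (rule finite_edges)
    show "disjoint_family_on K ?E" by (auto simp: K_def disjoint_family_on_def prod_eq_iff)
    fix e
    show "?W e \<in> borel_measurable (PiM (K e) (\<lambda>_. borel))"
      by (rule burst_weight_measurable) (auto simp: K_def intro!: measurable_component_singleton)
  qed auto
  also have "\<dots> = (\<Prod>e\<in>?E. \<integral>\<^sup>+\<omega>. ?W e \<omega> \<partial>prob_N N)" by (simp add: K_def)
  also have "\<dots> \<le> (\<Prod>e\<in>?E. ennreal (exp (4 * real N ^ 2)))"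
  proof (intro prod_mono_ennreal)
    fix e :: "('d \<Rightarrow> nat) \<times> ('d \<Rightarrow> nat)"
    show "(\<integral>\<^sup>+\<omega>. ?W e \<omega> \<partial>prob_N N) \<le> ennreal (exp (4 * real N ^ 2))"
      using P.burst_weight_integral[OF _ clocks_indep[OF N] clock_distributed[OF N] u h] N by simp
  qed
  also have "\<dots> = ennreal (exp (4 * real N ^ 2 * real (card ?E)))"
    by (simp add: ennreal_power exp_of_nat_mult[symmetric] mult_ac)
  finally have int: "(\<integral>\<^sup>+\<omega>. (\<Prod>e\<in>?E. ?W e \<omega>) \<partial>prob_N N) \<le> ennreal (exp (4 * real N ^ 2 * real (card ?E)))" .
  \<comment> \<open>Markov's inequality is applied to a multiple of the function compared with
    \<open>1\<close>, so the threshold is moved to the other side as the factor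
    \<open>h powr c\<close>.\<close>
  have eq: "burst_event N u h c = {\<omega> \<in> space (prob_N N). 1 \<le> ennreal (h powr c) * (\<Prod>e\<in>?E. ?W e \<omega>)}"
  proof -
    have "ennreal ((1/h) powr c) \<le> y \<longleftrightarrow> 1 \<le> ennreal (h powr c) * y" for y
    proof -
      have hc: "h powr c * (1/h) powr c = 1" using h by (simp add: powr_mult[symmetric])
      have e1: "ennreal (h powr c) * ennreal ((1/h) powr c) = 1"
        using hc by (simp add: ennreal_mult[symmetric])
      show ?thesis
      proof
        assume "ennreal ((1/h) powr c) \<le> y"
        then have "ennreal (h powr c) * ennreal ((1/h) powr c) \<le> ennreal (h powr c) * y" by (intro mult_left_mono) auto
        then show "1 \<le> ennreal (h powr c) * y" using e1 by simp
      next
        assume "1 \<le> ennreal (h powr c) * y"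
        then have "ennreal ((1/h) powr c) * 1 \<le> ennreal ((1/h) powr c) * (ennreal (h powr c) * y)"
          by (intro mult_left_mono) auto
        also have "\<dots> = (ennreal (h powr c) * ennreal ((1/h) powr c)) * y" by (simp only: mult_ac)
        also have "\<dots> = y" unfolding e1 by simp
        finally show "ennreal ((1/h) powr c) \<le> y" by simp
      qed
    qed
    then show ?thesis by (simp add: burst_event_def space_prob_N)
  qed
  have "emeasure (prob_N N) (burst_event N u h c :: ('d rv_idx \<Rightarrow> real) set) \<le> ennreal (h powr c) * (\<integral>\<^sup>+\<omega>. (\<Prod>e\<in>?E. ?W e \<omega>) \<partial>prob_N N)"
  proof -
    have "(\<lambda>\<omega>. (\<Prod>e\<in>?E. ?W e \<omega>) * indicator (space (prob_N N)) \<omega>) \<in> borel_measurable (prob_N N)"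
      by measurable
    from nn_integral_Markov_inequality[OF this sets.top, of "ennreal (h powr c)"]
    show ?thesis unfolding eq by (simp add: space_prob_N)
  qed
  also have "\<dots> \<le> ennreal (h powr c) * ennreal (exp (4 * real N ^ 2 * real (card ?E)))"
    using int by (rule mult_left_mono) simp
  finally have "ennreal (measure (prob_N N) (burst_event N u h c :: ('d rv_idx \<Rightarrow> real) set)) \<le>
      ennreal (h powr c * exp (4 * real N ^ 2 * real (card ?E)))"
    by (simp add: P.emeasure_eq_measure ennreal_mult)
  then show ?thesis by (simp add: ennreal_le_iff)
qed

text \<open>With at most \<open>2 * CARD('d) * N ^ CARD('d)\<close> edges the exponent becomes a
  multiple of \<open>N ^ (CARD('d) + 2)\<close>, the order of the speed.\<close>

lemma burst_event_prob':
  assumes N: "0 < N" and u: "0 \<le> u" and h: "0 < h"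
  shows "measure (prob_N N) (burst_event N u h c :: ('d::finite rv_idx \<Rightarrow> real) set)
    \<le> h powr c * exp (8 * real CARD('d) * real N ^ (CARD('d) + 2))"
proof -
  have "real (card (edges N :: (('d \<Rightarrow> nat) \<times> ('d \<Rightarrow> nat)) set)) \<le> real (2 * CARD('d) * N ^ CARD('d))"
    using card_edges by (rule of_nat_mono)
  then have "4 * real N ^ 2 * real (card (edges N :: (('d \<Rightarrow> nat) \<times> ('d \<Rightarrow> nat)) set))
      \<le> 4 * real N ^ 2 * real (2 * CARD('d) * N ^ CARD('d))"
    by (intro mult_left_mono) auto
  also have "\<dots> = 8 * real CARD('d) * real N ^ (CARD('d) + 2)" by (simp add: power_add power2_eq_square)
  finally have "h powr c * exp (4 * real N ^ 2 * real (card (edges N :: (('d \<Rightarrow> nat) \<times> ('d \<Rightarrow> nat)) set)))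
      \<le> h powr c * exp (8 * real CARD('d) * real N ^ (CARD('d) + 2))"
    by (intro mult_left_mono) auto
  then show ?thesis using burst_event_prob[where 'd = 'd, OF N u h, of c] by linarith
qed

text \<open>The labels in \<open>F\<close> split by edge, and the weights multiply as the counts
  add. A finite subset is used because finiteness of the set of all rings in the window is itself
  deduced from this bound.\<close>

lemma card_rings_less:
  fixes \<omega> :: "'d::finite rv_idx \<Rightarrow> real"
  assumes pos: "positive_clocks N \<omega>" and nb: "\<omega> \<notin> burst_event N u h c" and h: "0 < h" "h \<le> 1"
    and F: "finite F" "F \<subseteq> rings N \<omega> {u<..u+h}"
  shows "real (card F) < c"
proof (rule ccontr)
  assume "\<not> real (card F) < c"
  then have c: "c \<le> real (card F)" by simp
  let ?E = "edges N :: (('d \<Rightarrow> nat) \<times> ('d \<Rightarrow> nat)) set"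
  define G where "G e = {j. (e, j) \<in> F}" for e
  have fG: "finite (G e)" for e
  proof -
    have "G e \<subseteq> snd ` F" by (force simp: G_def)
    then show ?thesis using F(1) finite_subset by blast
  qed
  have "F = Sigma ?E G" using F(2) by (auto simp: G_def rings_def)
  then have cF: "card F = (\<Sum>e\<in>?E. card (G e))" using card_SigmaI[OF finite_edges[of N], where B = G] fG by simp
  have z: "1 \<le> 1/h" using h by simp
  have "(1/h) powr c \<le> (1/h) powr real (card F)" using z c by (intro powr_mono) auto
  also have "\<dots> = (1/h) ^ card F" using h by (simp add: powr_realpow)
  finally have "ennreal ((1/h) powr c) \<le> ennreal ((1/h) ^ card F)" by (rule ennreal_leI)
  also have "\<dots> = (\<Prod>e\<in>?E. ennreal ((1/h) ^ card (G e)))"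
    using h by (simp add: cF power_sum prod_ennreal)
  also have "\<dots> \<le> (\<Prod>e\<in>?E. burst_weight u h (\<lambda>i. \<omega> (Clock (fst e) (snd e) i)))"
  proof (rule prod_mono_ennreal)
    fix e assume e: "e \<in> ?E"
    show "ennreal ((1/h) ^ card (G e)) \<le> burst_weight u h (\<lambda>i. \<omega> (Clock (fst e) (snd e) i))"
    proof (rule burst_weight_ge[OF h(1) _ fG])
      show "0 < \<omega> (Clock (fst e) (snd e) i)" for i using pos e by (auto simp: positive_clocks_def)
      show "(\<Sum>i\<le>j. \<omega> (Clock (fst e) (snd e) i)) \<in> {u<..u+h}" if "j \<in> G e" for j
        using F(2) that by (auto simp: G_def rings_def ring_def arrival_def)
    qed
  qed
  finally show False using nb by (simp add: burst_event_def)
qed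

section \<open>The conditioning event\<close>

subsection \<open>The expected initial mass\<close>

text \<open>In direction \<open>i\<close> the slab between \<open>-h\<close> and \<open>0\<close> is
  moved by one period onto the slab between \<open>1 - h\<close> and \<open>1\<close>. The set
  \<open>S\<close> records the coordinates already moved, which allows an induction over the
  coordinates.\<close>

lemma integral_periodic_shift_coordinate:
  fixes f :: "real^'d::finite \<Rightarrow> real"
  assumes f: "continuous_on UNIV f" "\<And>z i. f (z + axis i 1) = f z"
    and h: "0 \<le> h" "h \<le> 1" and i: "i \<notin> S"
  shows "integral (cbox (\<chi> j. if j \<in> insert i S then 0 else - h) (\<chi> j. if j \<in> insert i S then 1 else 1 - h)) f =
         integral (cbox (\<chi> j. if j \<in> S then 0 else - h) (\<chi> j. if j \<in> S then 1 else 1 - h)) f"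
proof -
  define lo where "lo j = (if j \<in> S then 0 else - h)" for j
  define hi where "hi j = (if j \<in> S then 1 else 1 - h)" for j
  define B where "B l r = cbox (\<chi> j. if j = i then l else lo j) (\<chi> j. if j = i then r else hi j)" for l r :: real
  have memB: "x \<in> B l r \<longleftrightarrow> l \<le> x $ i \<and> x $ i \<le> r \<and> (\<forall>j. j \<noteq> i \<longrightarrow> lo j \<le> x $ j \<and> x $ j \<le> hi j)" for x l r
    unfolding B_def mem_box_cart by (simp add: all_conj_distrib) metis
  have int: "f integrable_on B l r" for l r
    unfolding B_def using f(1) by (intro integrable_continuous) (auto intro: continuous_on_subset)
  have split: "integral (B l r) f = integral (B l c) f + integral (B c r) f" if "l \<le> c" "c \<le> r" for l c r
  proof -
    have 1: "B l r \<inter> {x. x \<bullet> axis i 1 \<le> c} = B l c"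
      using that by (auto simp: memB inner_axis)
    have 2: "B l r \<inter> {x. x \<bullet> axis i 1 \<ge> c} = B c r"
      using that by (auto simp: memB inner_axis)
    have "(f has_integral (integral (B l c) f + integral (B c r) f)) (B l r)"
      unfolding B_def[of l r]
    proof (rule has_integral_split[where k = "axis i 1" and c = c])
      show "axis i 1 \<in> (Basis :: (real^'d) set)" by (simp add: axis_in_Basis_iff)
    qed (unfold B_def[of l r, symmetric] 1 2, use int in \<open>auto intro: integrable_integral\<close>)
    then show ?thesis by (rule integral_unique)
  qed
  have "integral (B (1 - h) 1) f = integral (B (- h) 0) f"
  proof -
    have a: "(\<chi> j. if j = i then a else b j) - axis i 1 = (\<chi> j. if j = i then a - 1 else b j)" for a :: real and b :: "'d \<Rightarrow> real"
      by (auto simp: vec_eq_iff axis_def)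
    have "integral (B (1 - h) 1) f = integral (B (1 - h - 1) (1 - 1)) (\<lambda>x. f (x + axis i 1))"
      unfolding B_def a[symmetric] by (rule integral_shift_cbox[symmetric])
    then show ?thesis by (simp add: f(2))
  qed
  then have "integral (B 0 1) f = integral (B (- h) (1 - h)) f"
    using split[of 0 "1 - h" 1] split[of "- h" 0 "1 - h"] h by simp
  moreover have "B 0 1 = cbox (\<chi> j. if j \<in> insert i S then 0 else - h) (\<chi> j. if j \<in> insert i S then 1 else 1 - h)"
    unfolding B_def by (intro arg_cong2[of _ _ _ _ cbox]) (auto simp: vec_eq_iff lo_def hi_def)
  moreover have "B (- h) (1 - h) = cbox (\<chi> j. if j \<in> S then 0 else - h) (\<chi> j. if j \<in> S then 1 else 1 - h)"
    unfolding B_def using i by (intro arg_cong2[of _ _ _ _ cbox]) (auto simp: vec_eq_iff lo_def hi_def)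
  ultimately show ?thesis by simp
qed

lemma integral_periodic_shift:
  fixes f :: "real^'d::finite \<Rightarrow> real"
  assumes f: "continuous_on UNIV f" "\<And>z i. f (z + axis i 1) = f z" and h: "0 \<le> h" "h \<le> 1"
  shows "integral (cbox (\<chi> j. - h) (\<chi> j. 1 - h)) f = integral (cbox 0 (\<chi> j. 1)) f"
proof -
  have "integral (cbox (\<chi> j. if j \<in> S then 0 else - h) (\<chi> j. if j \<in> S then 1 else 1 - h)) f =
     integral (cbox (\<chi> j. - h) (\<chi> j. 1 - h)) f" if "finite S" for S :: "'d set"
    using that
  proof (induction S rule: finite_induct)
    case (insert i S)
    then show ?case using integral_periodic_shift_coordinate[OF f h insert.hyps(2)] by simp
  qed simp
  from this[of UNIV] show ?thesis by (simp add: zero_vec_def)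
qed

text \<open>The cells of side \<open>1/N\<close> centred at the sites tile a cube shifted by half a
  mesh, and periodicity moves it back to the unit cube. For a nonnegative density this identifies
  the prescribed particle number with the sum of the Bernoulli parameters.\<close>

lemma sum_bern_param:
  fixes rho0 :: "real^'d::finite \<Rightarrow> real"
  assumes f: "continuous_on UNIV rho0" "\<And>z i. rho0 (z + axis i 1) = rho0 z" and N: "0 < N"
  shows "(\<Sum>x\<in>sites N. bern_param N n rho0 x) = n * integral (cbox 0 (\<chi> i. 1)) rho0"
proof -
  define h where "h = 1 / (2 * real N)"
  have h: "0 < h" "h \<le> 1" "2 * h = 1 / real N" using N by (auto simp: h_def divide_le_eq)
  define a :: "('d \<Rightarrow> nat) \<Rightarrow> real^'d" where "a x = (\<chi> i. real (x i) / real N - h)" for x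
  define b :: "('d \<Rightarrow> nat) \<Rightarrow> real^'d" where "b x = (\<chi> i. real (x i) / real N + h)" for x
  have bp: "bern_param N n rho0 x = n * integral (cbox (a x) (b x)) rho0" for x
  proof -
    have "pt N x - (\<chi> i. 1 / (2 * real N)) = a x" "pt N x + (\<chi> i. 1 / (2 * real N)) = b x"
      by (auto simp: a_def b_def pt_def h_def vec_eq_iff)
    then show ?thesis by (simp add: bern_param_def)
  qed
  have gap: "b x $ i \<le> a y $ i" if "x i < y i" for x y i
  proof -
    have "real (x i) + 1 \<le> real (y i)" using that by simp
    then have "(real (x i) + 1) / real N \<le> real (y i) / real N" by (intro divide_right_mono) auto
    then show ?thesis using h(3) by (simp add: a_def b_def add_divide_distrib)
  qed
  have ne: "a x \<in> cbox (a x) (b x)" for x using h by (auto simp: mem_box_cart a_def b_def)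
  have disj: "box (a x) (b x) \<inter> box (a y) (b y) = {}" if "x \<noteq> y" for x y
  proof -
    from that obtain i where "x i \<noteq> y i" by auto
    then have "b x $ i \<le> a y $ i \<or> b y $ i \<le> a x $ i" using gap[of x i y] gap[of y i x] by (auto simp: linorder_neq_iff)
    moreover have "a x $ i < z $ i \<and> z $ i < b x $ i" if "z \<in> box (a x) (b x)" for x z
      using that by (simp add: mem_box_cart)
    ultimately show ?thesis by (smt (verit) disjoint_iff)
  qed
  have boxne: "box (a x) (b x) \<noteq> {}" for x
  proof -
    have "(\<chi> i. real (x i) / real N) \<in> box (a x) (b x)" using h by (auto simp: mem_box_cart a_def b_def)
    then show ?thesis by blast
  qed
  have inj: "inj_on (\<lambda>x. cbox (a x) (b x)) (sites N)"
  proof (rule inj_onI)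
    fix x y assume "cbox (a x) (b x) = cbox (a y) (b y)"
    then have "box (a x) (b x) = box (a y) (b y)" by (metis interior_cbox)
    then show "x = y" using disj[of x y] boxne[of x] by auto
  qed
  have div: "(\<lambda>x. cbox (a x) (b x)) ` sites N division_of cbox (\<chi> j. - h) (\<chi> j. 1 - h)"
  proof (rule division_ofI)
    show "finite ((\<lambda>x. cbox (a x) (b x)) ` sites N)" by (simp add: finite_sites)
    show "K \<noteq> {}" if "K \<in> (\<lambda>x. cbox (a x) (b x)) ` sites N" for K using that ne by auto
    show "\<exists>p q. K = cbox p q" if "K \<in> (\<lambda>x. cbox (a x) (b x)) ` sites N" for K using that by auto
    show "interior K1 \<inter> interior K2 = {}" if K: "K1 \<in> (\<lambda>x. cbox (a x) (b x)) ` sites N" "K2 \<in> (\<lambda>x. cbox (a x) (b x)) ` sites N"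
      "K1 \<noteq> K2" for K1 K2
    proof -
      obtain x y where "K1 = cbox (a x) (b x)" "K2 = cbox (a y) (b y)" using K by blast
      then show ?thesis using disj[of x y] K(3) by (auto simp: interior_cbox)
    qed
    have sub: "cbox (a x) (b x) \<subseteq> cbox (\<chi> j. - h) (\<chi> j. 1 - h)" if "x \<in> sites N" for x
    proof -
      have ab: "- h \<le> a x $ i" "b x $ i \<le> 1 - h" for i
      proof -
        show "- h \<le> a x $ i" by (simp add: a_def)
        have "x i < N" using that by (simp add: sites_def)
        then have "real (x i) + 1 \<le> real N" by linarith
        then have "(real (x i) + 1) / real N \<le> 1" using N by (simp add: divide_le_eq)
        then show "b x $ i \<le> 1 - h" using h(3) by (simp add: b_def add_divide_distrib)
      qed
      show ?thesis
      proof
        fix y assume y: "y \<in> cbox (a x) (b x)"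
        show "y \<in> cbox (\<chi> j. - h) (\<chi> j. 1 - h)"
          unfolding mem_box_cart
        proof
          fix i
          have "a x $ i \<le> y $ i" "y $ i \<le> b x $ i" using y unfolding mem_box_cart by blast+
          then show "(\<chi> j. - h) $ i \<le> y $ i \<and> y $ i \<le> (\<chi> j. 1 - h) $ i"
            using ab[of i] by simp
        qed
      qed
    qed
    then show "K \<subseteq> cbox (\<chi> j. - h) (\<chi> j. 1 - h)" if "K \<in> (\<lambda>x. cbox (a x) (b x)) ` sites N" for K using that by auto
    have "y \<in> \<Union> ((\<lambda>x. cbox (a x) (b x)) ` sites N)" if y: "y \<in> cbox (\<chi> j. - h) (\<chi> j. 1 - h)" for y
    proof -
      \<comment> \<open>A coordinate on the upper face \<open>1 - h\<close> has floor
        \<open>N\<close>, which is not a site; the minimum assigns it to the last cell.\<close>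
      define x where "x i = min (N - 1) (nat \<lfloor>(y $ i + h) * real N\<rfloor>)" for i
      have xs: "x \<in> sites N" using N by (auto simp: sites_def x_def)
      have "a x $ i \<le> y $ i \<and> y $ i \<le> b x $ i" for i
      proof -
        let ?q = "(y $ i + h) * real N"
        have yi: "- h \<le> y $ i" "y $ i \<le> 1 - h" using y by (auto simp: mem_box_cart)
        have q: "0 \<le> ?q" "?q \<le> real N" using yi mult_right_mono[of "y $ i + h" 1 "real N"] by auto
        have fl: "real (nat \<lfloor>?q\<rfloor>) \<le> ?q" "?q < real (nat \<lfloor>?q\<rfloor>) + 1" using q(1) by linarith+
        have lo: "real (x i) \<le> ?q" using fl(1) by (auto simp: x_def min_def)
        have hi: "?q \<le> real (x i) + 1"
        proof (cases "nat \<lfloor>?q\<rfloor> \<le> N - 1")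
          case True
          then show ?thesis using fl(2) by (simp add: x_def min_def)
        next
          case False
          then show ?thesis using q(2) N by (simp add: x_def min_def of_nat_diff)
        qed
        have "real (x i) / real N \<le> y $ i + h" using lo N by (simp add: divide_le_eq)
        moreover have "y $ i + h \<le> real (x i) / real N + 2 * h"
          unfolding h(3) using hi N by (simp add: le_divide_eq add_divide_distrib[symmetric])
        ultimately show ?thesis by (simp add: a_def b_def)
      qed
      then have "y \<in> cbox (a x) (b x)" by (simp add: mem_box_cart)
      then show ?thesis using xs by blast
    qed
    then show "\<Union> ((\<lambda>x. cbox (a x) (b x)) ` sites N) = cbox (\<chi> j. - h) (\<chi> j. 1 - h)" using sub by blast
  qed
  have "rho0 integrable_on cbox (\<chi> j. - h) (\<chi> j. 1 - h)"
    using f(1) by (intro integrable_continuous) (auto intro: continuous_on_subset)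
  from integral_combine_division_topdown[OF this div]
  have "integral (cbox (\<chi> j. - h) (\<chi> j. 1 - h)) rho0 = (\<Sum>x\<in>sites N. integral (cbox (a x) (b x)) rho0)"
    using sum.reindex[OF inj, of "\<lambda>K. integral K rho0"] by (simp add: comp_def)
  then show ?thesis
    using integral_periodic_shift[OF f, of h] h by (simp add: bp sum_distrib_left)
qed

subsection \<open>A lower bound for its probability\<close>

text \<open>An integrality argument. The sites \<open>H\<close> with parameter above
  \<open>1 - q\<close>, if there are any, carry a sum exceeding \<open>card H - 1\<close>, hence
  \<open>card H \<le> m\<close>; the sites \<open>Z\<close> with parameter below \<open>q\<close>
  carry less than \<open>1\<close>, hence \<open>m\<close> does not exceed the number of the others.
  Two elements ensure \<open>q \<le> 1/2\<close>, which makes \<open>H\<close> and \<open>Z\<close>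
  disjoint.\<close>

lemma likely_configuration:
  fixes p :: "'a \<Rightarrow> real"
  assumes S: "finite S" "2 \<le> card S" and p: "\<And>x. x \<in> S \<Longrightarrow> 0 \<le> p x" "\<And>x. x \<in> S \<Longrightarrow> p x \<le> 1"
    and m: "(\<Sum>x\<in>S. p x) = real m"
  shows "\<exists>A\<subseteq>S. card A = m \<and> (\<forall>x\<in>A. 1 / real (card S) \<le> p x) \<and> (\<forall>x\<in>S - A. 1 / real (card S) \<le> 1 - p x)"
proof -
  define q where "q = 1 / real (card S)"
  have q: "0 < q" "q \<le> 1/2" "q * real (card S) = 1" using S by (auto simp: q_def field_simps)
  define H where "H = {x \<in> S. 1 - q < p x}"
  define Z where "Z = {x \<in> S. p x < q}"
  have fin: "finite H" "finite Z" "finite (S - Z)" using S by (auto simp: H_def Z_def)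
  have qcard: "q * real (card Y) \<le> 1" if "Y \<subseteq> S" for Y
    using mult_left_mono[of "real (card Y)" "real (card S)" q] card_mono[OF S(1) that] q by simp
  have "card H \<le> m"
  proof (cases "H = {}")
    case False
    have "real (card H) - 1 \<le> (1 - q) * real (card H)" using qcard[of H] by (auto simp: H_def algebra_simps)
    also have "\<dots> = (\<Sum>x\<in>H. 1 - q)" by simp
    also have "\<dots> < (\<Sum>x\<in>H. p x)" using False fin by (intro sum_strict_mono) (auto simp: H_def)
    also have "\<dots> \<le> (\<Sum>x\<in>S. p x)" using S p by (intro sum_mono2) (auto simp: H_def)
    finally show ?thesis using m by simp
  qed simp
  moreover have "m \<le> card (S - Z)"
  proof -
    have "real m = (\<Sum>x\<in>S - Z. p x) + (\<Sum>x\<in>Z. p x)"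
      using sum.subset_diff[of Z S p] S m by (auto simp: Z_def)
    also have "\<dots> < real (card (S - Z)) + 1"
    proof -
      have "(\<Sum>x\<in>S - Z. p x) \<le> (\<Sum>x\<in>S - Z. 1)" using p by (intro sum_mono) auto
      moreover have "(\<Sum>x\<in>Z. p x) < 1"
      proof (cases "Z = {}")
        case False
        have "(\<Sum>x\<in>Z. p x) < (\<Sum>x\<in>Z. q)" using False fin by (intro sum_strict_mono) (auto simp: Z_def)
        also have "\<dots> \<le> 1" using qcard[of Z] by (auto simp: Z_def mult.commute)
        finally show ?thesis .
      qed simp
      ultimately show ?thesis by simp
    qed
    finally show ?thesis by linarith
  qed
  moreover have "H \<subseteq> S - Z" using q by (auto simp: H_def Z_def)
  ultimately obtain A where A: "H \<subseteq> A" "A \<subseteq> S - Z" "card A = m"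
    using exists_subset_between[OF _ _ _ fin(3)] by blast
  have "q \<le> p x" if "x \<in> A" for x using A(2) that by (auto simp: Z_def)
  moreover have "q \<le> 1 - p x" if "x \<in> S - A" for x using A(1) that by (auto simp: H_def)
  ultimately show ?thesis using A unfolding q_def by blast
qed

lemma measure_uniform_unit:
  assumes "0 \<le> p" "p \<le> 1"
  shows "measure (uniform_measure lborel {0..1::real}) {..<p} = p"
    and "measure (uniform_measure lborel {0..1::real}) {p..} = 1 - p"
proof -
  have *: "measure (uniform_measure lborel {0..1::real}) B = measure lborel ({0..1} \<inter> B)" if "B \<in> sets borel" for B
    using measure_uniform_measure[of lborel "{0..1::real}" B] that by simp
  have 1: "{0..1} \<inter> {..<p} = {0..<p}" and 2: "{0..1} \<inter> {p..} = {p..1}" using assms by auto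
  show "measure (uniform_measure lborel {0..1::real}) {..<p} = p" using *[of "{..<p}"] 1 assms(1) by simp
  show "measure (uniform_measure lborel {0..1::real}) {p..} = 1 - p" using *[of "{p..}"] 2 assms(2) by simp
qed

lemma mass_event_sets: "mass_event N n rho0 \<in> sets (prob_N N)"
proof -
  let ?p = "bern_param N n rho0"
  have "real (card {x \<in> sites N. occ (init_state N n rho0 \<omega>) x}) = (\<Sum>x\<in>sites N. indicator {..<?p x} (\<omega> (Init x)))" for \<omega>
  proof -
    have "real (card {x \<in> sites N. occ (init_state N n rho0 \<omega>) x}) = (\<Sum>x\<in>{x \<in> sites N. \<omega> (Init x) < ?p x}. 1)"
      by (auto simp: init_state_def intro!: arg_cong[of _ _ card])
    also have "\<dots> = (\<Sum>x\<in>sites N. if \<omega> (Init x) < ?p x then 1 else 0)"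
      by (intro sum.inter_filter finite_sites)
    finally show ?thesis by (simp add: indicator_def lessThan_def of_bool_def)
  qed
  then have "mass_event N n rho0 = {\<omega> \<in> space (prob_N N). (\<Sum>x\<in>sites N. indicator {..<?p x} (\<omega> (Init x))) / n
       = integral (cbox 0 (\<chi> i. 1)) (\<lambda>z. \<bar>rho0 z\<bar>)}"
    by (simp add: mass_event_def space_prob_N)
  also have "\<dots> \<in> sets (prob_N N)" by measurable
  finally show ?thesis .
qed

text \<open>Nonemptiness of the event says that the prescribed particle number is a natural number
  \<open>m\<close>, and \<open>m\<close> is also the sum of the parameters. The event contains the
  cylinder in which exactly the sites of one likely set of size \<open>m\<close> are occupied, and
  each site contributes to it a factor of at least \<open>1 / N ^ CARD('d)\<close>.\<close>

lemma mass_event_prob: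
  fixes rho0 :: "real^'d::finite \<Rightarrow> real"
  assumes rho: "continuous_on UNIV rho0" "\<And>z i. rho0 (z + axis i 1) = rho0 z" "\<And>z. 0 \<le> rho0 z"
    and N: "2 \<le> N" and n: "0 < n" and p1: "\<And>x. x \<in> sites N \<Longrightarrow> bern_param N n rho0 x \<le> 1"
    and ne: "mass_event N n rho0 \<noteq> {}"
  shows "(1 / real (N ^ CARD('d))) ^ (N ^ CARD('d)) \<le> measure (prob_N N) (mass_event N n rho0)"
proof -
  let ?p = "bern_param N n rho0"
  let ?S = "sites N :: ('d \<Rightarrow> nat) set"
  let ?L = "N ^ CARD('d)"
  have N0: "0 < N" using N by simp
  interpret P: product_prob_space "omega_comp N" "UNIV :: 'd rv_idx set"
    by (rule product_prob_space_omega[OF N0])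
  have p0: "0 \<le> ?p x" for x
    unfolding bern_param_def using n rho by (intro mult_nonneg_nonneg integral_nonneg integrable_continuous)
      (auto intro: continuous_on_subset)
  obtain \<omega>0 where "\<omega>0 \<in> mass_event N n rho0" using ne by blast
  define m where "m = card {x \<in> ?S. occ (init_state N n rho0 \<omega>0) x}"
  have m: "real m / n = integral (cbox 0 (\<chi> i. 1)) rho0"
    using \<open>\<omega>0 \<in> _\<close> rho(3) by (simp add: mass_event_def m_def)
  have "(\<Sum>x\<in>?S. ?p x) = real m"
    using sum_bern_param[OF rho(1,2) N0, of n] m n by (simp add: field_simps)
  moreover have "2 \<le> card ?S"
    using N self_le_power[of N "CARD('d)"] by (simp add: card_sites)
  ultimately obtain A where A: "A \<subseteq> ?S" "card A = m" "\<And>x. x \<in> A \<Longrightarrow> 1 / real ?L \<le> ?p x"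
    "\<And>x. x \<in> ?S - A \<Longrightarrow> 1 / real ?L \<le> 1 - ?p x"
    using likely_configuration[OF finite_sites, of N ?p m] p0 p1 by (auto simp: card_sites)
  define Y where "Y i = (case i of Init x \<Rightarrow> if x \<in> A then {..<?p x} else {?p x..} | _ \<Rightarrow> UNIV)" for i
  define C where "C = {\<omega> \<in> space (prob_N N). \<forall>i\<in>Init ` ?S. \<omega> i \<in> Y i}"
  have Ym: "Y i \<in> sets (omega_comp N i)" for i by (cases i) (auto simp: Y_def sets_omega_comp)
  have "measure (prob_N N) C = (\<Prod>i\<in>Init ` ?S. measure (omega_comp N i) (Y i))"
  proof -
    have "emeasure (prob_N N) C = (\<Prod>i\<in>Init ` ?S. emeasure (omega_comp N i) (Y i))"
      unfolding C_def prob_N_def using Ym by (intro P.emeasure_PiM_Collect) (auto simp: finite_sites)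
    then show ?thesis
      using P.P.emeasure_eq_measure[of C] P.M.emeasure_eq_measure
      by (simp add: prob_N_def prod_ennreal prod_nonneg)
  qed
  also have "\<dots> = (\<Prod>x\<in>?S. measure (omega_comp N (Init x)) (Y (Init x)))"
    by (subst prod.reindex) (auto simp: inj_on_def)
  also have "\<dots> \<ge> (\<Prod>x\<in>?S. 1 / real ?L)"
  proof (intro prod_mono conjI)
    fix x assume x: "x \<in> ?S"
    show "1 / real ?L \<le> measure (omega_comp N (Init x)) (Y (Init x))"
      using A(3,4)[of x] x measure_uniform_unit[OF p0 p1[OF x]] by (auto simp: omega_comp_def Y_def)
  qed simp
  finally have "(1 / real ?L) ^ ?L \<le> measure (prob_N N) C" by (simp add: card_sites)
  also have "\<dots> \<le> measure (prob_N N) (mass_event N n rho0)"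
  proof (rule finite_measure.finite_measure_mono[OF prob_space.finite_measure[OF prob_space_prob_N[OF N0]] _ mass_event_sets])
    show "C \<subseteq> mass_event N n rho0"
    proof
      fix \<omega> assume w: "\<omega> \<in> C"
      have "\<omega> (Init x) < ?p x \<longleftrightarrow> x \<in> A" if "x \<in> ?S" for x
        using w that unfolding C_def Y_def by (auto split: if_splits)
      then have "{x \<in> ?S. occ (init_state N n rho0 \<omega>) x} = A"
        using A(1) by (auto simp: init_state_def)
      then show "\<omega> \<in> mass_event N n rho0" using m A(2) rho(3) by (simp add: mass_event_def)
    qed
  qed
  finally show ?thesis .
qed

section \<open>Exponential tightness\<close>

lemma smooth_fun_continuous:
  assumes "smooth_fun f" shows "continuous_on UNIV f"
proof -
  have "\<forall>x. f differentiable (at x)" using assms by (cases rule: smooth_fun.cases) auto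
  then show ?thesis
    by (intro continuous_at_imp_continuous_on ballI) (auto intro: differentiable_imp_continuous_within)
qed

lemma smooth_family_bounded:
  fixes \<phi> :: "'d::finite \<Rightarrow> bool \<Rightarrow> real^'d \<Rightarrow> real"
  assumes "\<And>l b. smooth_fun (\<phi> l b)"
  shows "\<exists>B\<ge>0. \<forall>l b. \<forall>z\<in>cbox (\<chi> i. -1) (\<chi> i. 2). \<bar>\<phi> l b z\<bar> \<le> B"
proof -
  let ?Q = "cbox (\<chi> i. -1) (\<chi> i. 2) :: (real^'d) set"
  have "\<exists>C. \<forall>z\<in>?Q. \<bar>\<phi> l b z\<bar> \<le> C" for l b
  proof -
    have "continuous_on ?Q (\<phi> l b)"
      using smooth_fun_continuous[OF assms] continuous_on_subset by blast
    then have "bounded (\<phi> l b ` ?Q)"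
      by (intro compact_imp_bounded compact_continuous_image) auto
    then show ?thesis by (auto simp: bounded_iff)
  qed
  then obtain C where C: "\<And>l b z. z \<in> ?Q \<Longrightarrow> \<bar>\<phi> l b z\<bar> \<le> C l b" by metis
  define B where "B = (\<Sum>l\<in>UNIV. \<Sum>b\<in>UNIV. \<bar>C l b\<bar>)"
  have "\<bar>\<phi> l b z\<bar> \<le> B" if "z \<in> ?Q" for l b z
  proof -
    have "\<bar>\<phi> l b z\<bar> \<le> \<bar>C l b\<bar>" using C[OF that, of l b] by simp
    also have "\<dots> \<le> (\<Sum>b\<in>UNIV. \<bar>C l b\<bar>)" by (intro member_le_sum) auto
    also have "\<dots> \<le> B" unfolding B_def by (intro member_le_sum[of l UNIV "\<lambda>l. \<Sum>b\<in>UNIV. \<bar>C l b\<bar>"]) (auto intro: sum_nonneg)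
    finally show ?thesis .
  qed
  moreover have "0 \<le> B" unfolding B_def by (intro sum_nonneg) auto
  ultimately show ?thesis by blast
qed

text \<open>The bound on finite subsets shows that the set is finite, after which it applies to the
  whole set.\<close>

lemma rings_card_less:
  fixes \<omega> :: "'d::finite rv_idx \<Rightarrow> real"
  assumes pos: "positive_clocks N \<omega>" and nb: "\<omega> \<notin> burst_event N u h c" and h: "0 < h" "h \<le> 1"
  shows "finite (rings N \<omega> {u<..u+h})" "real (card (rings N \<omega> {u<..u+h})) < c"
proof -
  note less = card_rings_less[OF pos nb h]
  have "card G \<le> nat \<lceil>c\<rceil>" if "G \<subseteq> rings N \<omega> {u<..u+h}" "finite G" for G
    using less[OF that(2,1)] by linarith
  then show fin: "finite (rings N \<omega> {u<..u+h})" using finite_if_finite_subsets_card_bdd by blast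
  show "real (card (rings N \<omega> {u<..u+h})) < c" using less[OF fin] by simp
qed

text \<open>The threshold \<open>\<gamma> / i\<close> is tuned to the length \<open>(1/2)^i\<close>:
  the length to this power is \<open>2 powr (- \<gamma>)\<close> for every \<open>i\<close>. One
  window more than the possible starting windows is included, because an interval starting in one
  window may end in the next.\<close>

definition scale_bad :: "real \<Rightarrow> nat \<Rightarrow> nat \<Rightarrow> real \<Rightarrow> ('d::finite rv_idx \<Rightarrow> real) set" where
  "scale_bad T N I \<gamma> = (\<Union>i\<in>{1..I}. \<Union>k\<in>{..Suc (nat \<lceil>T * 2^i\<rceil>)}. burst_event N (real k * (1/2)^i) ((1/2)^i) (\<gamma> / real i))"

text \<open>Windows of length \<open>2 * \<delta>\<close> on a grid of mesh \<delta> overlap, so any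
  two rings at distance below \<delta> share one of them. The two end windows provide the first and
  the last gap of the skeleton.\<close>

definition gap_bad :: "real \<Rightarrow> nat \<Rightarrow> real \<Rightarrow> ('d::finite rv_idx \<Rightarrow> real) set" where
  "gap_bad T N \<delta> = (\<Union>k\<in>{..nat \<lceil>T / \<delta>\<rceil>}. burst_event N (real k * \<delta>) (2 * \<delta>) 2)
     \<union> burst_event N 0 \<delta> 1 \<union> burst_event N (T - \<delta>) \<delta> 1"

section \<open>Paths outside the exceptional events\<close>

context
  fixes T :: real and N I :: nat and \<gamma> \<delta> :: real and \<omega> :: "'d::finite rv_idx \<Rightarrow> real"
  assumes T: "0 < T" and I: "1 \<le> I" and pos: "positive_clocks N \<omega>"
    and scale: "\<omega> \<notin> scale_bad T N I \<gamma>"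
begin

lemma scale_good:
  assumes "1 \<le> i" "i \<le> I" "k \<le> Suc (nat \<lceil>T * 2^i\<rceil>)"
  shows "finite (rings N \<omega> {real k * (1/2)^i <.. real k * (1/2)^i + (1/2)^i})"
    "real (card (rings N \<omega> {real k * (1/2)^i <.. real k * (1/2)^i + (1/2)^i})) < \<gamma> / real i"
proof -
  have "\<omega> \<notin> burst_event N (real k * (1/2)^i) ((1/2)^i) (\<gamma> / real i)"
    using scale assms unfolding scale_bad_def by auto
  from rings_card_less[OF pos this] show "finite (rings N \<omega> {real k * (1/2)^i <.. real k * (1/2)^i + (1/2)^i})"
    "real (card (rings N \<omega> {real k * (1/2)^i <.. real k * (1/2)^i + (1/2)^i})) < \<gamma> / real i"
    by (auto simp: power_le_one)
qed

text \<open>An interval shorter than a dyadic window is covered by two adjacent windows, whence the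
  factor \<open>2\<close>.\<close>

lemma rings_card_scale:
  assumes i: "1 \<le> i" "i \<le> I" and s: "0 \<le> s" "s \<le> T" and t: "t < s + (1/2)^i"
  shows "finite (rings N \<omega> {s<..t})" "real (card (rings N \<omega> {s<..t})) \<le> 2 * \<gamma> / real i"
proof -
  define h :: real where "h = (1/2)^i"
  have h: "0 < h" "1 / h = 2^i" by (auto simp: h_def power_one_over)
  define k where "k = nat \<lfloor>s / h\<rfloor>"
  have q: "0 \<le> s / h" using s h by simp
  have k1: "real k \<le> s / h" "s / h < real k + 1" using q unfolding k_def by linarith+
  have k2: "real k * h \<le> s" "s < (real k + 1) * h" using k1 h(1) by (simp_all add: pos_le_divide_eq pos_divide_less_eq)
  have "s / h \<le> T * 2^i"
  proof -
    have "s / h = s * (1 / h)" by simp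
    also have "\<dots> = s * 2^i" unfolding h(2) ..
    also have "\<dots> \<le> T * 2^i" using s by (intro mult_right_mono) auto
    finally show ?thesis .
  qed
  then have "real k \<le> real (nat \<lceil>T * 2^i\<rceil>)" using k1 real_nat_ceiling_ge[of "T * 2^i"] by linarith
  then have kk: "k \<le> Suc (nat \<lceil>T * 2^i\<rceil>)" "Suc k \<le> Suc (nat \<lceil>T * 2^i\<rceil>)" by auto
  note g1 = scale_good[OF i kk(1), folded h_def] and g2 = scale_good[OF i kk(2), folded h_def]
  let ?R1 = "rings N \<omega> {real k * h <.. real k * h + h}" and ?R2 = "rings N \<omega> {real (Suc k) * h <.. real (Suc k) * h + h}"
  have sub: "rings N \<omega> {s<..t} \<subseteq> ?R1 \<union> ?R2"
    using k2 t unfolding rings_def h_def[symmetric] by (auto simp: algebra_simps)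
  then show "finite (rings N \<omega> {s<..t})" using g1(1) g2(1) by (meson finite_UnI finite_subset)
  have "card (rings N \<omega> {s<..t}) \<le> card (?R1 \<union> ?R2)" using sub g1(1) g2(1) by (intro card_mono) auto
  also have "\<dots> \<le> card ?R1 + card ?R2" by (rule card_Un_le)
  finally have "real (card (rings N \<omega> {s<..t})) \<le> real (card ?R1) + real (card ?R2)" by linarith
  also have "\<dots> \<le> \<gamma> / real i + \<gamma> / real i" using g1(2) g2(2) by linarith
  finally show "real (card (rings N \<omega> {s<..t})) \<le> 2 * \<gamma> / real i" by simp
qed

lemma finite_rings_T: "finite (rings N \<omega> {0<..T})"
proof -
  have "rings N \<omega> {0<..T} \<subseteq> (\<Union>k\<in>{..nat \<lceil>T * 2^1\<rceil>}. rings N \<omega> {real k * (1/2)^1 <.. real k * (1/2)^1 + (1/2)^1})"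
  proof
    fix p assume p: "p \<in> rings N \<omega> {0<..T}"
    define x where "x = ring \<omega> p"
    have x: "0 < x" "x \<le> T" using p by (auto simp: rings_def x_def)
    \<comment> \<open>The windows are open on the left, so a ring on a grid point belongs to the
      window ending there; the ceiling minus one selects it.\<close>
    define k where "k = nat (\<lceil>2 * x\<rceil> - 1)"
    have k: "real k < 2 * x" "2 * x \<le> real k + 1" using x unfolding k_def by linarith+
    have "T * 2^1 \<le> real (nat \<lceil>T * 2^1\<rceil>)" by (rule real_nat_ceiling_ge)
    moreover have "2 * x \<le> T * 2^1" using x by simp
    ultimately have "real k \<le> real (nat \<lceil>T * 2^1\<rceil>)" using k by linarith
    then show "p \<in> (\<Union>k\<in>{..nat \<lceil>T * 2^1\<rceil>}. rings N \<omega> {real k * (1/2)^1 <.. real k * (1/2)^1 + (1/2)^1})"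
      using p k by (intro UN_I[of k]) (auto simp: rings_def x_def[symmetric])
  qed
  moreover have "finite (\<Union>k\<in>{..nat \<lceil>T * 2^1\<rceil>}. rings N \<omega> {real k * (1/2)^1 <.. real k * (1/2)^1 + (1/2)^1})"
    using scale_good(1)[of 1] I by (intro finite_UN_I) auto
  ultimately show ?thesis by (rule finite_subset)
qed

text \<open>The constant \<open>c\<close> bounds a single jump. Scales finer than \<open>I\<close>
  are not controlled and fall back on the bound of scale \<open>I\<close>, which becomes the
  additive error.\<close>

lemma coll_path_log_modulus:
  fixes \<phi> :: "'d \<Rightarrow> bool \<Rightarrow> real^'d \<Rightarrow> real"
  assumes N: "0 < N" and n: "0 < n"
    and B: "\<And>l b z. z \<in> cbox (\<chi> i. -1) (\<chi> i. 2) \<Longrightarrow> \<bar>\<phi> l b z\<bar> \<le> B" "0 \<le> B" and \<gamma>: "0 \<le> \<gamma>"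
    and c: "c = (1 / real N)^2 / ((1 / real N)^CARD('d) * n^2) * (2 * real CARD('d) * B)"
  shows "log_modulus T (2 * c * \<gamma>) (2 * c * \<gamma> / real I) (coll_path T N n rho0 \<phi> \<omega>)"
proof -
  have c0: "0 \<le> c" using B(2) by (simp add: c)
  let ?X = "coll_path T N n rho0 \<phi> \<omega>"
  have main: "\<bar>?X t - ?X s\<bar> \<le> 2 * c * \<gamma> / real i + 2 * c * \<gamma> / real I"
    if i: "1 \<le> i" and st: "s \<in> {0..T}" "t \<in> {0..T}" "s \<le> t" "t - s < (1/2)^i" for i s t
  proof -
    define j where "j = min i I"
    have j: "1 \<le> j" "j \<le> I" using i I by (auto simp: j_def)
    have "(1/2::real)^i \<le> (1/2)^j" by (intro power_decreasing) (auto simp: j_def)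
    then have t: "t < s + (1/2)^j" using st(4) by linarith
    note r = rings_card_scale[OF j _ _ t]
    have "\<exists>F. finite F \<and> F \<subseteq> rings N \<omega> {s<..t} \<and> \<bar>?X t - ?X s\<bar> \<le> c * real (card F)"
      unfolding c by (rule coll_path_increment[OF N n pos T finite_rings_T B(1) st(1,2,3)])
    then obtain F where F: "finite F" "F \<subseteq> rings N \<omega> {s<..t}" "\<bar>?X t - ?X s\<bar> \<le> c * real (card F)"
      by blast
    have "real (card F) \<le> 2 * \<gamma> / real j"
      using card_mono[OF r(1) F(2)] r(2) st by (smt (verit) atLeastAtMost_iff of_nat_mono)
    then have "c * real (card F) \<le> c * (2 * \<gamma> / real j)" using c0 by (intro mult_left_mono) auto
    moreover have "c * (2 * \<gamma> / real j) \<le> 2 * c * \<gamma> / real i + 2 * c * \<gamma> / real I"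
    proof -
      have "0 \<le> 2 * c * \<gamma> / real i" "0 \<le> 2 * c * \<gamma> / real I" using c0 \<gamma> by auto
      moreover have eq: "c * (2 * \<gamma> / real j) = 2 * c * \<gamma> / real j" by simp
      ultimately show ?thesis unfolding eq by (cases "i \<le> I") (auto simp: j_def min_def)
    qed
    ultimately show ?thesis using F(3) by linarith
  qed
  show ?thesis unfolding log_modulus_def
  proof (intro allI impI ballI)
    fix i :: nat and s t assume a: "1 \<le> i" "s \<in> {0..T}" "t \<in> {0..T}" "\<bar>s - t\<bar> < (1/2)^i"
    show "\<bar>?X s - ?X t\<bar> \<le> 2 * c * \<gamma> / real i + 2 * c * \<gamma> / real I"
      using main[OF a(1), of s t] main[OF a(1), of t s] a by (cases "s \<le> t") (auto simp: abs_minus_commute)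
  qed
qed

lemma coll_path_step:
  assumes N: "0 < N" and d: "0 < \<delta>" "2 * \<delta> \<le> 1" "\<delta> \<le> T" and gap: "\<omega> \<notin> gap_bad T N \<delta>"
  shows "\<exists>m \<tau> v. coll_path T N n rho0 \<phi> \<omega> = step_fun m \<tau> v \<and> jump_skeleton T \<delta> m \<tau>"
proof -
  \<comment> \<open>Threshold \<open>1\<close> means that the window contains no ring at
    all.\<close>
  have "\<omega> \<notin> burst_event N 0 \<delta> 1" "\<omega> \<notin> burst_event N (T - \<delta>) \<delta> 1" using gap by (auto simp: gap_bad_def)
  from rings_card_less[OF pos this(1)] rings_card_less[OF pos this(2)] d
  have ends: "rings N \<omega> {0<..\<delta>} = {}" "rings N \<omega> {T-\<delta><..T} = {}" by auto
  have sep: "\<delta> \<le> \<bar>ring \<omega> p - ring \<omega> q\<bar>"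
    if pq: "p \<in> rings N \<omega> {0<..T}" "q \<in> rings N \<omega> {0<..T}" "p \<noteq> q" for p q
  proof -
    have *: "\<delta> \<le> ring \<omega> q - ring \<omega> p"
      if pq: "p \<in> rings N \<omega> {0<..T}" "q \<in> rings N \<omega> {0<..T}" "p \<noteq> q" "ring \<omega> p \<le> ring \<omega> q" for p q
    proof (rule ccontr)
      assume close: "\<not> \<delta> \<le> ring \<omega> q - ring \<omega> p"
      \<comment> \<open>The ring \<open>p\<close> lies in the left-open first half of window
        \<open>k\<close>, so \<open>q\<close>, less than \<delta> later, lies in the same window;
        threshold \<open>2\<close> excludes this.\<close>
      define k where "k = nat (\<lceil>ring \<omega> p / \<delta>\<rceil> - 1)"
      have x: "0 < ring \<omega> p" "ring \<omega> p \<le> T" using pq by (auto simp: rings_def)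
      then have "0 < ring \<omega> p / \<delta>" using d by simp
      then have k: "real k < ring \<omega> p / \<delta>" "ring \<omega> p / \<delta> \<le> real k + 1" unfolding k_def by linarith+
      have "ring \<omega> p / \<delta> \<le> T / \<delta>" using x d by (intro divide_right_mono) auto
      then have "real k \<le> real (nat \<lceil>T / \<delta>\<rceil>)" using k real_nat_ceiling_ge[of "T / \<delta>"] by linarith
      then have "\<omega> \<notin> burst_event N (real k * \<delta>) (2 * \<delta>) 2" using gap by (auto simp: gap_bad_def)
      from card_rings_less[OF pos this, of "{p, q}"] d
      have no: "\<not> {p, q} \<subseteq> rings N \<omega> {real k * \<delta> <.. real k * \<delta> + 2 * \<delta>}" using pq(3) by auto
      have "real k * \<delta> < ring \<omega> p" "ring \<omega> p \<le> real k * \<delta> + \<delta>"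
        using k d by (auto simp: pos_less_divide_eq pos_divide_le_eq algebra_simps)
      then show False using no pq close by (auto simp: rings_def)
    qed
    show ?thesis using *[of p q] *[of q p] pq by (cases "ring \<omega> p \<le> ring \<omega> q") auto
  qed
  show ?thesis
    using jump_skeleton_rings[OF N pos T d(1,3) finite_rings_T ends sep]
      coll_path_step_fun[OF N pos T finite_rings_T, of n rho0 \<phi>] by blast
qed

end

section \<open>Probabilities of the exceptional events\<close>

lemma scale_bad_sets: "scale_bad T N I \<gamma> \<in> sets (prob_N N)"
  unfolding scale_bad_def using burst_event_sets by (intro sets.finite_UN) auto

lemma gap_bad_sets: "gap_bad T N \<delta> \<in> sets (prob_N N)"
  unfolding gap_bad_def using burst_event_sets by (intro sets.Un sets.finite_UN) auto

text \<open>Each single event has probability at most \<open>2 powr (- \<gamma>)\<close> times the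
  exponential factor, whatever its scale. The union bound runs over \<open>I\<close> scales with at
  most \<open>(T + 3) * 2^I\<close> windows each.\<close>

lemma scale_bad_prob:
  assumes N: "0 < N" and T: "0 < T"
  shows "measure (prob_N N) (scale_bad T N I \<gamma> :: ('d::finite rv_idx \<Rightarrow> real) set)
    \<le> real I * (T + 3) * 2^I * 2 powr (- \<gamma>) * exp (8 * real CARD('d) * real N ^ (CARD('d) + 2))"
proof -
  interpret P: prob_space "prob_N N :: ('d rv_idx \<Rightarrow> real) measure" by (rule prob_space_prob_N[OF N])
  let ?E = "exp (8 * real CARD('d) * real N ^ (CARD('d) + 2))"
  let ?b = "\<lambda>i k. burst_event N (real k * (1/2)^i) ((1/2)^i) (\<gamma> / real i) :: ('d rv_idx \<Rightarrow> real) set"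
  have b: "P.prob (?b i k) \<le> 2 powr (- \<gamma>) * ?E" if "i \<in> {1..I}" for i k
  proof -
    have "((1/2)^i) powr (\<gamma> / real i) = 2 powr (- \<gamma>)"
    proof -
      have "(1/2::real)^i = 2 powr (- real i)" by (simp add: powr_minus powr_realpow power_one_over inverse_eq_divide)
      then show ?thesis using that by (simp add: powr_powr)
    qed
    then show ?thesis using burst_event_prob'[where 'd = 'd, OF N, of "real k * (1/2)^i" "(1/2)^i" "\<gamma> / real i"] by simp
  qed
  have i_bound: "P.prob (\<Union>k\<in>{..Suc (nat \<lceil>T * 2^i\<rceil>)}. ?b i k) \<le> (T + 3) * 2^I * (2 powr (- \<gamma>) * ?E)" if i: "i \<in> {1..I}" for i
  proof -
    have "P.prob (\<Union>k\<in>{..Suc (nat \<lceil>T * 2^i\<rceil>)}. ?b i k) \<le> (\<Sum>k\<in>{..Suc (nat \<lceil>T * 2^i\<rceil>)}. P.prob (?b i k))"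
      using burst_event_sets by (intro P.finite_measure_subadditive_finite) auto
    also have "\<dots> \<le> (\<Sum>k\<in>{..Suc (nat \<lceil>T * 2^i\<rceil>)}. 2 powr (- \<gamma>) * ?E)" using b[OF i] by (intro sum_mono)
    also have "\<dots> = (real (nat \<lceil>T * 2^i\<rceil>) + 2) * (2 powr (- \<gamma>) * ?E)" by simp
    also have "\<dots> \<le> ((T + 3) * 2^I) * (2 powr (- \<gamma>) * ?E)"
    proof (rule mult_right_mono)
      have p: "(1::real) \<le> 2^i" "(2::real)^i \<le> 2^I" using i by (auto intro: power_increasing)
      have "0 \<le> T * 2^i" using T by simp
      then have "real (nat \<lceil>T * 2^i\<rceil>) \<le> T * 2^i + 1" by linarith
      then have "real (nat \<lceil>T * 2^i\<rceil>) + 2 \<le> T * 2^i + 3 * 2^i" using p by linarith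
      also have "\<dots> = (T + 3) * 2^i" by (simp add: algebra_simps)
      also have "\<dots> \<le> (T + 3) * 2^I" using p T by (intro mult_left_mono) auto
      finally show "real (nat \<lceil>T * 2^i\<rceil>) + 2 \<le> (T + 3) * 2^I" .
    qed simp
    finally show ?thesis .
  qed
  have "P.prob (scale_bad T N I \<gamma>) \<le> (\<Sum>i\<in>{1..I}. P.prob (\<Union>k\<in>{..Suc (nat \<lceil>T * 2^i\<rceil>)}. ?b i k))"
    unfolding scale_bad_def using burst_event_sets
    by (intro P.finite_measure_subadditive_finite) (auto intro!: sets.finite_UN)
  also have "\<dots> \<le> (\<Sum>i\<in>{1..I}. (T + 3) * 2^I * (2 powr (- \<gamma>) * ?E))" using i_bound by (intro sum_mono)
  finally show ?thesis by (simp add: mult_ac)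
qed

text \<open>About \<open>T / \<delta>\<close> windows each cost a multiple of
  \<open>\<delta>^2\<close>, since two rings are required, so the union is of order \<delta>. An
  exponentially small \<delta> can therefore beat the exponential factor.\<close>

lemma gap_bad_prob:
  assumes N: "0 < N" and T: "0 < T" and d: "0 < \<delta>" "2 * \<delta> \<le> 1" "\<delta> \<le> T"
  shows "measure (prob_N N) (gap_bad T N \<delta> :: ('d::finite rv_idx \<Rightarrow> real) set)
    \<le> \<delta> * (4 * T + 10) * exp (8 * real CARD('d) * real N ^ (CARD('d) + 2))"
proof -
  interpret P: prob_space "prob_N N :: ('d rv_idx \<Rightarrow> real) measure" by (rule prob_space_prob_N[OF N])
  let ?E = "exp (8 * real CARD('d) * real N ^ (CARD('d) + 2))"
  let ?U = "(\<Union>k\<in>{..nat \<lceil>T / \<delta>\<rceil>}. burst_event N (real k * \<delta>) (2 * \<delta>) 2) :: ('d rv_idx \<Rightarrow> real) set"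
  have "P.prob ?U \<le> (\<Sum>k\<in>{..nat \<lceil>T / \<delta>\<rceil>}. P.prob (burst_event N (real k * \<delta>) (2 * \<delta>) 2))"
    using burst_event_sets by (intro P.finite_measure_subadditive_finite) auto
  also have "\<dots> \<le> (\<Sum>k\<in>{..nat \<lceil>T / \<delta>\<rceil>}. 4 * \<delta>^2 * ?E)"
  proof (rule sum_mono)
    fix k
    have "(2 * \<delta>) powr 2 = 4 * \<delta>^2" using d by (simp add: powr_numeral power_mult_distrib)
    then show "P.prob (burst_event N (real k * \<delta>) (2 * \<delta>) 2) \<le> 4 * \<delta>^2 * ?E"
      using burst_event_prob'[where 'd = 'd, OF N, of "real k * \<delta>" "2 * \<delta>" 2] d by simp
  qed
  also have "\<dots> = (real (nat \<lceil>T / \<delta>\<rceil>) + 1) * (4 * \<delta>^2 * ?E)" by simp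
  also have "\<dots> \<le> (T / \<delta> + 2) * (4 * \<delta>^2 * ?E)"
  proof (rule mult_right_mono)
    have "0 \<le> T / \<delta>" using T d by simp
    then show "real (nat \<lceil>T / \<delta>\<rceil>) + 1 \<le> T / \<delta> + 2" by linarith
  qed (use d in auto)
  also have "\<dots> = \<delta> * (4 * T + 8 * \<delta>) * ?E" using d by (simp add: field_simps power2_eq_square)
  also have "\<dots> \<le> \<delta> * (4 * T + 8) * ?E" using d by (intro mult_right_mono mult_left_mono) auto
  finally have U: "P.prob ?U \<le> \<delta> * (4 * T + 8) * ?E" .
  have ends: "P.prob (burst_event N 0 \<delta> 1) \<le> \<delta> * ?E" "P.prob (burst_event N (T - \<delta>) \<delta> 1) \<le> \<delta> * ?E"
    using burst_event_prob'[where 'd = 'd, OF N, of 0 \<delta> 1] burst_event_prob'[where 'd = 'd, OF N, of "T - \<delta>" \<delta> 1] d by simp_all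
  have Us: "?U \<in> P.events" using burst_event_sets by (intro sets.finite_UN) auto
  have "P.prob (gap_bad T N \<delta>) \<le> P.prob ?U + P.prob (burst_event N 0 \<delta> 1) + P.prob (burst_event N (T - \<delta>) \<delta> 1)"
    unfolding gap_bad_def
    using measure_Un_le[OF Us burst_event_sets, of 0 \<delta> 1]
      measure_Un_le[OF sets.Un[OF Us burst_event_sets] burst_event_sets, of 0 \<delta> 1 "T - \<delta>" \<delta> 1]
    by linarith
  also have "\<dots> \<le> \<delta> * (4 * T + 8) * ?E + \<delta> * ?E + \<delta> * ?E" using U ends by linarith
  finally show ?thesis by (simp add: algebra_simps)
qed

lemma outer_prob_le:
  assumes "prob_space M" "A \<inter> space M \<subseteq> C" "C \<in> sets M"
  shows "outer_prob M A \<le> measure M C"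
  unfolding outer_prob_def using assms
  by (intro cINF_lower bdd_belowI[of _ 0]) auto

text \<open>The exceptional sets and a null set form a measurable cover of the event that the path
  is outside \<open>K\<close>. The arbitrary set \<open>E\<close>, later the conditioning event, is
  discarded by monotonicity, as the cover does not refer to the initial configuration.\<close>

lemma outer_prob_path:
  fixes \<phi> :: "'d::finite \<Rightarrow> bool \<Rightarrow> real^'d \<Rightarrow> real"
  assumes N: "0 < N" and n: "0 < n" and T: "0 < T" and I: "1 \<le> I" and d: "0 < \<delta>" "2 * \<delta> \<le> 1" "\<delta> \<le> T"
    and B: "\<And>l b z. z \<in> cbox (\<chi> i. -1) (\<chi> i. 2) \<Longrightarrow> \<bar>\<phi> l b z\<bar> \<le> B" "0 \<le> B" and \<gamma>: "0 \<le> \<gamma>"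
    and c: "c = (1 / real N)^2 / ((1 / real N)^CARD('d) * n^2) * (2 * real CARD('d) * B)"
    and K: "\<And>m \<tau> v. jump_skeleton T \<delta> m \<tau> \<Longrightarrow> step_fun m \<tau> v 0 = 0 \<Longrightarrow>
       log_modulus T (2 * c * \<gamma>) (2 * c * \<gamma> / real I) (step_fun m \<tau> v) \<Longrightarrow> step_fun m \<tau> v \<in> K"
  shows "outer_prob (prob_N N) ({\<omega> \<in> space (prob_N N). coll_path T N n rho0 \<phi> \<omega> \<notin> K} \<inter> E)
    \<le> (real I * (T + 3) * 2^I * 2 powr (- \<gamma>) + \<delta> * (4 * T + 10)) * exp (8 * real CARD('d) * real N ^ (CARD('d) + 2))"
proof -
  interpret P: prob_space "prob_N N :: ('d rv_idx \<Rightarrow> real) measure" by (rule prob_space_prob_N[OF N])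
  obtain W :: "('d rv_idx \<Rightarrow> real) set" where W: "{\<omega> \<in> space (prob_N N). \<not> positive_clocks N \<omega>} \<subseteq> W" "W \<in> null_sets (prob_N N)"
    using AE_positive_clocks[OF N] by (auto simp: eventually_ae_filter)
  let ?C = "W \<union> (scale_bad T N I \<gamma> \<union> gap_bad T N \<delta>)"
  have Ws: "W \<in> P.events" using W(2) by auto
  have good: "coll_path T N n rho0 \<phi> \<omega> \<in> K" if w: "\<omega> \<notin> ?C" for \<omega>
  proof -
    have pos: "positive_clocks N \<omega>" using w W(1) by (auto simp: space_prob_N)
    have sc: "\<omega> \<notin> scale_bad T N I \<gamma>" and gp: "\<omega> \<notin> gap_bad T N \<delta>" using w by auto
    obtain m \<tau> v where X: "coll_path T N n rho0 \<phi> \<omega> = step_fun m \<tau> v" "jump_skeleton T \<delta> m \<tau>"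
      using coll_path_step[OF T I pos sc N d gp, of n rho0 \<phi>] by blast
    moreover have "coll_path T N n rho0 \<phi> \<omega> 0 = 0"
      by (rule coll_path_0[OF N pos T finite_rings_T[OF T I pos sc]])
    moreover have "log_modulus T (2 * c * \<gamma>) (2 * c * \<gamma> / real I) (coll_path T N n rho0 \<phi> \<omega>)"
      by (rule coll_path_log_modulus[OF T I pos sc N n B \<gamma> c])
    ultimately show ?thesis using K[OF X(2), of v] by simp
  qed
  have "outer_prob (prob_N N) ({\<omega> \<in> space (prob_N N). coll_path T N n rho0 \<phi> \<omega> \<notin> K} \<inter> E) \<le> P.prob ?C"
    using good Ws scale_bad_sets gap_bad_sets
    by (intro outer_prob_le prob_space_prob_N[OF N] sets.Un) blast+
  also have "\<dots> \<le> P.prob W + P.prob (scale_bad T N I \<gamma> \<union> gap_bad T N \<delta>)"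
    by (intro measure_Un_le Ws sets.Un scale_bad_sets gap_bad_sets)
  also have "\<dots> \<le> 0 + (P.prob (scale_bad T N I \<gamma>) + P.prob (gap_bad T N \<delta>))"
    using W(2) measure_Un_le[OF scale_bad_sets[of T N I \<gamma>] gap_bad_sets[of T N \<delta>]]
    by (simp add: measure_eq_0_null_sets)
  also have "\<dots> \<le> 0 + (real I * (T + 3) * 2^I * 2 powr (- \<gamma>) * exp (8 * real CARD('d) * real N ^ (CARD('d) + 2))
      + \<delta> * (4 * T + 10) * exp (8 * real CARD('d) * real N ^ (CARD('d) + 2)))"
    by (intro add_mono scale_bad_prob[OF N T] gap_bad_prob[OF N T d] order_refl)
  finally show ?thesis by (simp add: algebra_simps)
qed

text \<open>The right-hand side is \<open>exp (- (N^d * d * ln N))\<close>, of smaller order in the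
  exponent than the speed; the crude estimate \<open>ln N \<le> N\<close> gives the comparison from
  an explicit size of \<open>N\<close> on.\<close>

lemma mass_event_not_too_rare:
  assumes "1 \<le> N" "0 < \<alpha>" "real d / \<alpha>^2 \<le> real N"
  shows "exp (- (\<alpha>^2 * real N ^ (d + 2))) \<le> (1 / real (N ^ d)) ^ (N ^ d)"
proof -
  have N: "0 < real N" using assms(1) by simp
  have "ln (real N) \<le> real N" using ln_le_minus_one[OF N] by simp
  then have "real d * ln (real N) \<le> real d * real N" by (intro mult_left_mono) auto
  also have "\<dots> \<le> (\<alpha>^2 * real N) * real N"
    using assms by (intro mult_right_mono) (auto simp: pos_divide_le_eq mult.commute)
  finally have "real (N ^ d) * (real d * ln (real N)) \<le> real (N ^ d) * (\<alpha>^2 * real N * real N)"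
    by (intro mult_left_mono) auto
  also have "\<dots> = \<alpha>^2 * real N ^ (d + 2)" by (simp add: power_add power2_eq_square)
  finally have "exp (- (\<alpha>^2 * real N ^ (d + 2))) \<le> exp (- (real (N ^ d) * (real d * ln (real N))))" by simp
  also have "\<dots> = exp (- (real d * ln (real N))) ^ (N ^ d)"
    by (simp only: exp_of_nat_mult[symmetric]) (simp only: mult_minus_right)
  also have "exp (- (real d * ln (real N))) = 1 / real (N ^ d)"
    using N by (simp add: exp_minus exp_of_nat_mult inverse_eq_divide)
  finally show ?thesis .
qed

text \<open>A nonpositive \<open>q\<close> gives minus infinity, so a vanishing conditional
  probability is covered.\<close>

lemma ln_ereal_scaled_le:
  assumes "0 < \<beta>" "q \<le> exp (- a * \<beta>)"
  shows "ereal (1 / \<beta>) * ln_ereal q \<le> ereal (- a)"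
proof (cases "q \<le> 0")
  case True
  then show ?thesis using assms(1) by (simp add: ln_ereal_def)
next
  case False
  then have "ln q \<le> - a * \<beta>" using assms(2) by (metis exp_gt_zero ln_exp ln_le_cancel_iff not_le)
  then have "1 / \<beta> * ln q \<le> - a" using assms(1) by (simp add: pos_divide_le_eq)
  then show ?thesis using False by (simp add: ln_ereal_def)
qed

theorem theorem5p4:
  fixes \<alpha> T :: real and N nn :: "nat \<Rightarrow> nat"
    and rho0 :: "real^'d::finite \<Rightarrow> real" and \<phi> :: "'d \<Rightarrow> bool \<Rightarrow> real^'d \<Rightarrow> real"
  assumes "0 < \<alpha>" and "\<alpha> < 1" and "0 < T"
    and "\<forall>k. 0 < N k" and "filterlim N at_top sequentially"
    and "\<forall>k. real (nn k) = \<alpha> / (1 / real (N k)) ^ CARD('d)"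
    and "continuous_on UNIV rho0" and "\<forall>z. 0 \<le> rho0 z"
    and "\<forall>z i. rho0 (z + axis i 1) = rho0 z"
    and "\<forall>k x. x \<in> sites (N k) \<longrightarrow> bern_param (N k) (real (nn k)) rho0 x \<le> 1"
    and "\<forall>l b. smooth_fun (\<phi> l b) \<and> (\<forall>z i. \<phi> l b (z + axis i 1) = \<phi> l b z)"
  shows "exp_tight_cond T
           (\<lambda>k. (1 / real (N k)) ^ CARD('d) * real (nn k) ^ 2 / (1 / real (N k)) ^ 2)
           (\<lambda>k. prob_N (N k))
           (\<lambda>k. mass_event (N k) (real (nn k)) rho0)
           (\<lambda>k. coll_path T (N k) (real (nn k)) rho0 \<phi>)"
proof -
  note \<alpha> = assms(1) and T = assms(3)
  have Npos: "0 < N k" for k using assms(4) by blast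
  obtain B where B: "0 \<le> B" "\<And>l b z. z \<in> cbox (\<chi> i. -1) (\<chi> i. 2) \<Longrightarrow> \<bar>\<phi> l b z\<bar> \<le> B"
    using smooth_family_bounded[of \<phi>] assms(11) by blast
  have nn: "real (nn k) = \<alpha> * real (N k) ^ CARD('d)" for k
    using assms(6) by (simp add: power_one_over)
  have npos: "0 < real (nn k)" for k using \<alpha> Npos[of k] by (simp add: nn)
  define \<beta> where "\<beta> k = (1 / real (N k)) ^ CARD('d) * real (nn k) ^ 2 / (1 / real (N k)) ^ 2" for k
  have \<beta>: "\<beta> k = \<alpha>^2 * real (N k) ^ (CARD('d) + 2)" for k
  proof -
    let ?x = "real (N k) ^ CARD('d)"
    have x: "0 < ?x" using Npos[of k] by simp
    have "\<beta> k = 1 / ?x * (\<alpha> * ?x)^2 * real (N k)^2" unfolding \<beta>_def nn by (simp add: power_one_over)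
    also have "\<dots> = \<alpha>^2 * (?x * real (N k)^2)" using x by (simp add: power2_eq_square)
    finally show ?thesis by (simp add: power_add power2_eq_square)
  qed
  have \<beta>pos: "0 < \<beta> k" for k using \<alpha> Npos[of k] by (simp add: \<beta>)
  have Nlim: "filterlim (\<lambda>k. real (N k)) at_top sequentially"
    using filterlim_compose[OF filterlim_real_sequentially assms(5)] .
  have \<beta>lim: "filterlim \<beta> at_top sequentially"
  proof (rule filterlim_at_top_mono)
    show "filterlim (\<lambda>k. \<alpha>^2 * real (N k)) at_top sequentially"
      using \<alpha> by (intro filterlim_tendsto_pos_mult_at_top[OF tendsto_const _ Nlim]) auto
    show "\<forall>\<^sub>F k in sequentially. \<alpha>^2 * real (N k) \<le> \<beta> k"
    proof (intro always_eventually allI)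
      fix k
      have "real (N k) \<le> real (N k) ^ (CARD('d) + 2)" using Npos[of k] by (intro self_le_power) auto
      then show "\<alpha>^2 * real (N k) \<le> \<beta> k" unfolding \<beta> by (intro mult_left_mono) auto
    qed
  qed
  show ?thesis
    unfolding exp_tight_cond_def \<beta>_def[symmetric]
  proof (intro allI impI)
    fix a :: real assume a: "0 < a"
    \<comment> \<open>Chosen so that the exponential factor of the window estimates is exactly
      \<open>exp (L * \<beta> k)\<close>.\<close>
    define L where "L = 8 * real CARD('d) / \<alpha>^2"
    \<comment> \<open>The summands pay, in order, for the target rate \<open>a\<close>, the
      conditioning, the factor \<open>exp (L * \<beta> k)\<close>, the number of scales and windows
      (at most \<open>4 ^ I k\<close> up to a constant), and the remaining constants. Dividing by
      \<open>ln 2\<close> converts to powers of two.\<close>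
    define A where "A = (a + 1 + L + 2 * ln 2 + ln (8 * (T + 3))) / ln 2"
    \<comment> \<open>This is \<open>2 * c * \<gamma>\<close> for
      \<open>\<gamma> = \<beta> k * A\<close>. It does not depend on \<open>k\<close>, because the
      jump size is inversely proportional to the speed.\<close>
    define \<Lambda> where "\<Lambda> = 4 * real CARD('d) * B * A"
    define I where "I k = nat \<lceil>\<beta> k\<rceil>" for k
    define \<eta> where "\<eta> k = \<Lambda> / real (I k)" for k
    \<comment> \<open>The last term makes the gap estimate, before its exponential factor, at most
      half of \<open>exp (- (a + 1 + L) * \<beta> k)\<close>; the other two are the conditions
      \<open>2 * \<delta> k \<le> 1\<close> and \<open>\<delta> k \<le> T\<close>.\<close>
    define \<delta> where "\<delta> k = min (min (1/2) T) (exp (- (a + 1 + L) * \<beta> k) / (2 * (4 * T + 10)))" for k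
    have L: "0 \<le> L" by (simp add: L_def)
    have "0 \<le> ln (8 * (T + 3))" using T by simp
    then have A: "0 \<le> A" using a L by (auto simp: A_def)
    have \<Lambda>: "0 \<le> \<Lambda>" using A B(1) by (simp add: \<Lambda>_def)
    have I1: "1 \<le> I k" for k using \<beta>pos[of k] unfolding I_def by linarith
    have I2: "\<beta> k \<le> real (I k)" "real (I k) \<le> \<beta> k + 1" for k
      using \<beta>pos[of k] unfolding I_def by linarith+
    have \<eta>0: "0 \<le> \<eta> k" for k using \<Lambda> by (simp add: \<eta>_def)
    have "filterlim (\<lambda>k. real (I k)) at_top sequentially"
      using I2(1) by (intro filterlim_at_top_mono[OF \<beta>lim]) auto
    then have \<eta>lim: "\<eta> \<longlonglongrightarrow> 0"
      unfolding \<eta>_def by (intro real_tendsto_divide_at_top[OF tendsto_const])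
    have \<delta>: "0 < \<delta> k" "2 * \<delta> k \<le> 1" "\<delta> k \<le> T" "\<delta> k * (4 * T + 10) \<le> exp (- (a + 1 + L) * \<beta> k) / 2" for k
    proof -
      have "0 < exp (- (a + 1 + L) * \<beta> k) / (2 * (4 * T + 10))" using T by simp
      then show "0 < \<delta> k" using T by (simp add: \<delta>_def)
      have "\<delta> k \<le> 1/2" unfolding \<delta>_def by (rule min.coboundedI1[OF min.cobounded1])
      then show "2 * \<delta> k \<le> 1" by simp
      show "\<delta> k \<le> T" unfolding \<delta>_def by (rule min.coboundedI1[OF min.cobounded2])
      have "\<delta> k \<le> exp (- (a + 1 + L) * \<beta> k) / (2 * (4 * T + 10))" by (simp add: \<delta>_def)
      then have "\<delta> k * (4 * T + 10) \<le> exp (- (a + 1 + L) * \<beta> k) / (2 * (4 * T + 10)) * (4 * T + 10)"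
        using T by (intro mult_right_mono) auto
      also have "\<dots> = exp (- (a + 1 + L) * \<beta> k) / 2" using T by (simp add: field_simps)
      finally show "\<delta> k * (4 * T + 10) \<le> exp (- (a + 1 + L) * \<beta> k) / 2" .
    qed
    define K where "K = path_compactum T \<Lambda> \<eta> \<delta>"
    have Kc: "K \<subseteq> cadlag_space T" unfolding K_def by (rule path_compactum_cadlag[OF \<delta>(1)])
    have Kk: "compactin (skorohod_top T) K"
      unfolding K_def by (rule compact_path_compactum[OF T \<Lambda> \<eta>0 \<eta>lim \<delta>(1)])
    let ?q = "\<lambda>k. cond_outer_prob (prob_N (N k)) (mass_event (N k) (real (nn k)) rho0)
                  {\<omega> \<in> space (prob_N (N k)). coll_path T (N k) (real (nn k)) rho0 \<phi> \<omega> \<notin> K}"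
    have q: "?q k \<le> exp (- a * \<beta> k)"
      if k: "1 \<le> \<beta> k" "2 \<le> N k" "real CARD('d) / \<alpha>^2 \<le> real (N k)" for k
    \<comment> \<open>When the prescribed mass is not attainable, the quotient has denominator
      \<open>0\<close> and equals \<open>0\<close> by convention.\<close>
    proof (cases "mass_event (N k) (real (nn k)) rho0 = {}")
      case True
      then show ?thesis by (simp add: cond_outer_prob_def)
    next
      case False
      define c where "c = (1 / real (N k))^2 / ((1 / real (N k))^CARD('d) * real (nn k)^2) * (2 * real CARD('d) * B)"
      have c\<beta>: "c * \<beta> k = 2 * real CARD('d) * B"
        using Npos[of k] npos[of k] by (simp add: c_def \<beta>_def)
      have c2: "2 * c * (\<beta> k * A) = \<Lambda>"
      proof -
        have "2 * c * (\<beta> k * A) = 2 * (c * \<beta> k) * A" by simp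
        then show ?thesis unfolding c\<beta> by (simp add: \<Lambda>_def)
      qed
      have E: "exp (8 * real CARD('d) * real (N k) ^ (CARD('d) + 2)) = exp (L * \<beta> k)"
        using \<alpha> by (simp add: L_def \<beta>)
      have \<gamma>: "0 \<le> \<beta> k * A" using A \<beta>pos[of k] by simp
      have mem: "step_fun m \<tau> v \<in> K"
        if "jump_skeleton T (\<delta> k) m \<tau>" "step_fun m \<tau> v 0 = 0"
          "log_modulus T (2 * c * (\<beta> k * A)) (2 * c * (\<beta> k * A) / real (I k)) (step_fun m \<tau> v)" for m \<tau> v
        using that unfolding c2 \<eta>_def[symmetric] K_def path_compactum_def by blast
      have scale: "real (I k) * (T + 3) * 2^I k * 2 powr (- (\<beta> k * A)) \<le> exp (- (a + 1 + L) * \<beta> k) / 2"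
      proof -
        \<comment> \<open>The number of scales is absorbed in a second power \<open>2 ^ I k\<close>;
          with \<open>I k \<le> \<beta> k + 1\<close> the product is at most
          \<open>4 * exp (2 * ln 2 * \<beta> k)\<close>.\<close>
        have "real (I k) \<le> 2 ^ I k" using less_exp[of "I k"] by (metis less_imp_le of_nat_le_iff of_nat_numeral of_nat_power)
        then have "real (I k) * 2 ^ I k \<le> 2 ^ I k * 2 ^ I k" by (intro mult_right_mono) auto
        also have "\<dots> = 2 powr (2 * real (I k))" by (simp add: powr_realpow[symmetric] powr_add[symmetric])
        also have "\<dots> \<le> 2 powr (2 * \<beta> k + 2)" using I2(2)[of k] by (intro powr_mono) auto
        also have "\<dots> = 2 powr (2 * \<beta> k) * 2 powr 2" by (rule powr_add)
        also have "\<dots> = 4 * exp (2 * ln 2 * \<beta> k)" unfolding powr_def[of 2 "2 * \<beta> k"] by (simp add: mult_ac)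
        finally have 1: "real (I k) * 2 ^ I k \<le> 4 * exp (2 * ln 2 * \<beta> k)" .
        define l where "l = ln (8 * (T + 3))"
        have "A * ln 2 = a + 1 + L + 2 * ln 2 + l" by (simp add: A_def l_def)
        then have "\<beta> k * A * ln 2 = \<beta> k * (a + 1 + L + 2 * ln 2 + l)" by (metis mult.assoc)
        also have "\<dots> = (a + 1 + L) * \<beta> k + 2 * ln 2 * \<beta> k + l * \<beta> k" by (simp add: algebra_simps)
        finally have Al: "\<beta> k * A * ln 2 = (a + 1 + L) * \<beta> k + 2 * ln 2 * \<beta> k + l * \<beta> k" .
        \<comment> \<open>Here \<open>1 \<le> \<beta> k\<close> allows the constant \<open>l\<close>
          to be paid for by the exponent.\<close>
        have "l * 1 \<le> l * \<beta> k" using T k(1) unfolding l_def by (intro mult_left_mono) auto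
        then have "- (\<beta> k * A * ln 2) \<le> - (a + 1 + L) * \<beta> k + (- (2 * ln 2 * \<beta> k) + - l)"
          unfolding Al minus_mult_left[symmetric] by linarith
        moreover have "2 powr (- (\<beta> k * A)) = exp (- (\<beta> k * A * ln 2))" by (simp add: powr_def)
        ultimately have "2 powr (- (\<beta> k * A)) \<le> exp (- (a + 1 + L) * \<beta> k + (- (2 * ln 2 * \<beta> k) + - l))"
          by simp
        also have "\<dots> = exp (- (a + 1 + L) * \<beta> k) * (exp (- (2 * ln 2 * \<beta> k)) * exp (- l))"
          by (simp only: exp_add)
        also have "exp (- l) = 1 / (8 * (T + 3))"
          using T by (simp add: l_def exp_minus inverse_eq_divide)
        finally have 2: "2 powr (- (\<beta> k * A)) \<le> exp (- (a + 1 + L) * \<beta> k) * (exp (- (2 * ln 2 * \<beta> k)) * (1 / (8 * (T + 3))))" .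
        have "real (I k) * (T + 3) * 2^I k * 2 powr (- (\<beta> k * A)) = (T + 3) * ((real (I k) * 2^I k) * 2 powr (- (\<beta> k * A)))"
          by (simp add: mult_ac)
        also have "\<dots> \<le> (T + 3) * ((4 * exp (2 * ln 2 * \<beta> k)) *
            (exp (- (a + 1 + L) * \<beta> k) * (exp (- (2 * ln 2 * \<beta> k)) * (1 / (8 * (T + 3))))))"
          using T by (intro mult_left_mono[OF mult_mono[OF 1 2]]) auto
        also have "\<dots> = (exp (2 * ln 2 * \<beta> k) * exp (- (2 * ln 2 * \<beta> k))) * exp (- (a + 1 + L) * \<beta> k) * (4 * (T + 3) / (8 * (T + 3)))"
          by simp
        also have "4 * (T + 3) / (8 * (T + 3)) = 1/2" using T by (simp add: field_simps)
        also have "exp (2 * ln 2 * \<beta> k) * exp (- (2 * ln 2 * \<beta> k)) = 1" by (simp add: exp_minus)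
        also have "1 * exp (- (a + 1 + L) * \<beta> k) * (1/2) = exp (- (a + 1 + L) * \<beta> k) / 2" by simp
        finally show ?thesis .
      qed
      have "outer_prob (prob_N (N k)) ({\<omega> \<in> space (prob_N (N k)). coll_path T (N k) (real (nn k)) rho0 \<phi> \<omega> \<notin> K}
            \<inter> mass_event (N k) (real (nn k)) rho0)
          \<le> (real (I k) * (T + 3) * 2^I k * 2 powr (- (\<beta> k * A)) + \<delta> k * (4 * T + 10)) * exp (L * \<beta> k)"
        unfolding E[symmetric]
        by (rule outer_prob_path[OF Npos npos T I1 \<delta>(1,2,3) B(2,1) \<gamma> c_def mem])
      also have "\<dots> \<le> (exp (- (a + 1 + L) * \<beta> k) / 2 + exp (- (a + 1 + L) * \<beta> k) / 2) * exp (L * \<beta> k)"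
        by (intro mult_right_mono add_mono scale \<delta>(4)) auto
      \<comment> \<open>The factor \<open>exp (- \<beta> k)\<close> was kept in reserve by the
        \<open>1\<close> in the exponent and is now spent on the probability of the conditioning
        event.\<close>
      also have "\<dots> = exp (- a * \<beta> k) * exp (- \<beta> k)" by (simp add: exp_add[symmetric] algebra_simps)
      also have "\<dots> \<le> exp (- a * \<beta> k) * measure (prob_N (N k)) (mass_event (N k) (real (nn k)) rho0)"
      proof (intro mult_left_mono)
        have "exp (- \<beta> k) \<le> (1 / real (N k ^ CARD('d))) ^ (N k ^ CARD('d))"
          unfolding \<beta> using k \<alpha> by (intro mass_event_not_too_rare) auto
        also have "\<dots> \<le> measure (prob_N (N k)) (mass_event (N k) (real (nn k)) rho0)"
          using assms(7-10) k(2) npos[of k] False by (intro mass_event_prob) auto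
        finally show "exp (- \<beta> k) \<le> measure (prob_N (N k)) (mass_event (N k) (real (nn k)) rho0)" .
      qed simp
      finally show ?thesis
        unfolding cond_outer_prob_def
        by (cases "measure (prob_N (N k)) (mass_event (N k) (real (nn k)) rho0) = 0")
           (auto simp: pos_divide_le_eq zero_less_measure_iff)
    qed
    have "\<forall>\<^sub>F k in sequentially. 1 \<le> \<beta> k" using \<beta>lim by (simp add: filterlim_at_top)
    moreover have "\<forall>\<^sub>F k in sequentially. 2 \<le> N k" using assms(5) by (simp add: filterlim_at_top)
    moreover have "\<forall>\<^sub>F k in sequentially. real CARD('d) / \<alpha>^2 \<le> real (N k)" using Nlim by (simp add: filterlim_at_top)
    ultimately have "\<forall>\<^sub>F k in sequentially. ereal (1 / \<beta> k) * ln_ereal (?q k) \<le> ereal (- a)"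
      by eventually_elim (intro ln_ereal_scaled_le \<beta>pos q)
    then have "limsup (\<lambda>k. ereal (1 / \<beta> k) * ln_ereal (?q k)) \<le> ereal (- a)"
      by (rule Limsup_bounded)
    then show "\<exists>K\<subseteq>cadlag_space T. compactin (skorohod_top T) K \<and>
        limsup (\<lambda>k. ereal (1 / \<beta> k) * ln_ereal (cond_outer_prob (prob_N (N k)) (mass_event (N k) (real (nn k)) rho0)
                  {\<omega> \<in> space (prob_N (N k)). coll_path T (N k) (real (nn k)) rho0 \<phi> \<omega> \<notin> K})) \<le> ereal (- a)"
      using Kc Kk by blast
  qed
qed

end
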